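(* Let $\widehat{G} := \mathbb{N}\times\mathbb{N}\times\mathbb{R}\times\mathbb{R}^*$, with elements $\widehat{x}=(n,m,\nu,\lambda)$ and measure $d\widehat{x} := \delta(n)\delta(m)\,d\nu\,d\lambda$ (counting measure on $\mathbb{N}^2$ times Lebesgue measure), let $a(\widehat{x}) := E_m(\nu,\lambda)$, and let $\delta_{n,m}$ be the Kronecker symbol. For all measurable functions $F:\mathbb{R}_+\to\mathbb{R}$, the function $F\circ a$ belongs to $L^1(\widehat{G},\delta_{n,m}\,d\widehat{x})$ if and only if $F\in L^1(\mathbb{R}_+,r^{5/2}dr)$, and (in this case) there holds $$\int_{\widehat{G}} F(a(\widehat{x}))\,\delta_{n,m}\,d\widehat{x} = \left(\sum_{m\in\mathbb{N}}\int_{\mathbb{R}}\frac{3}{\mathsf{E}_m(\mu)^{7/2}}\,d\mu\right)\int_0^\infty r^{5/2}F(r)\,dr .$$ Moreover, $$\sum_{m\in\mathbb{N}}\int_{\mathbb{R}}\frac{1}{\mathsf{E}_m(\mu)^{\gamma}}\,d\mu<\infty \quad\Longleftrightarrow\quad \gamma>2 .$$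
   Context: $\mathbb{N}=\{0,1,2,\dots\}$, $\mathbb{R}^*=\mathbb{R}\setminus\{0\}$, $\mathbb{R}_+=[0,\infty)$. For $\mu\in\mathbb{R}$, $\mathsf{P}_\mu := -\frac{d^2}{d\theta^2}+\left(\frac{\theta^2}{2}-\mu\right)^2$ on $L^2(\mathbb{R})$ with domain $\{u\in L^2(\mathbb{R}): \mathsf{P}_\mu u\in L^2(\mathbb{R})\}$. It is selfadjoint with compact resolvent and its spectrum consists of simple eigenvalues $0<\mathsf{E}_0(\mu)<\mathsf{E}_1(\mu)<\cdots\to+\infty$. For $(\nu,\lambda)\in\mathbb{R}\times\mathbb{R}^*$ and $m\in\mathbb{N}$, $E_m(\nu,\lambda) := |\lambda|^{2/3}\,\mathsf{E}_m\!\left(\nu/|\lambda|^{4/3}\right)$. *)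

theory Defs
  imports "HOL-Analysis.Analysis"
begin

section \<open>The operator P and its eigenvalues\<close>

definition L2 :: "(real \<Rightarrow> complex) set" where
  "L2 = {u \<in> borel_measurable lebesgue. integrable lebesgue (\<lambda>\<theta>. (cmod (u \<theta>))\<^sup>2)}"

text \<open>Real-valued test functions suffice to test complex-valued distributions, by linearity.\<close>

definition test_function :: "(real \<Rightarrow> real) \<Rightarrow> bool" where
  "test_function \<phi> \<longleftrightarrow>
     (\<forall>n x. ((deriv ^^ n) \<phi>) differentiable (at x)) \<and> compact (closure {x. \<phi> x \<noteq> 0})"

text \<open>\<open>P_maps \<mu> u f\<close> states that \<open>- u'' + (\<theta>\<^sup>2/2 - \<mu>)\<^sup>2 u = f\<close> in the sense of
  distributions on the real line.  It is meant for \<open>u\<close> and \<open>f\<close> in \<open>L2\<close>, for which all the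
  integrals below exist.\<close>

definition P_maps :: "real \<Rightarrow> (real \<Rightarrow> complex) \<Rightarrow> (real \<Rightarrow> complex) \<Rightarrow> bool" where
  "P_maps \<mu> u f \<longleftrightarrow> (\<forall>\<phi>. test_function \<phi> \<longrightarrow>
     (LINT \<theta>|lebesgue.
        u \<theta> * complex_of_real (- (deriv ^^ 2) \<phi> \<theta> + (\<theta>\<^sup>2 / 2 - \<mu>)\<^sup>2 * \<phi> \<theta>))
     = (LINT \<theta>|lebesgue. f \<theta> * complex_of_real (\<phi> \<theta>)))"

definition P_domain :: "real \<Rightarrow> (real \<Rightarrow> complex) set" where
  "P_domain \<mu> = {u \<in> L2. \<exists>f\<in>L2. P_maps \<mu> u f}"

definition P_eigenvalues :: "real \<Rightarrow> real set" where
  "P_eigenvalues \<mu> = {e. \<exists>u\<in>P_domain \<mu>.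
     \<not> (AE \<theta> in lebesgue. u \<theta> = 0) \<and> P_maps \<mu> u (\<lambda>\<theta>. complex_of_real e * u \<theta>)}"

text \<open>The eigenvalues are simple and form a sequence increasing to infinity;
  \<open>eigval m \<mu>\<close> is the \<open>m\<close>-th one in increasing order, counted from \<open>0\<close>.\<close>

definition eigval :: "nat \<Rightarrow> real \<Rightarrow> real" where
  "eigval m \<mu> =
     (THE e :: nat \<Rightarrow> real. strict_mono e \<and> range e = P_eigenvalues \<mu>) m"

definition scaled_eigval :: "nat \<Rightarrow> real \<Rightarrow> real \<Rightarrow> real" where
  "scaled_eigval m \<nu> l = \<bar>l\<bar> powr (2/3) * eigval m (\<nu> / \<bar>l\<bar> powr (4/3))"


section \<open>The measure space\<close>

text \<open>The point \<open>(n, m, \<nu>, l)\<close> is represented as \<open>((n, m), (\<nu>, l))\<close>.\<close>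

type_synonym dual_point = "(nat \<times> nat) \<times> (real \<times> real)"

definition dual_measure :: "dual_point measure" where
  "dual_measure =
     count_space UNIV \<Otimes>\<^sub>M lebesgue_on (UNIV \<times> (UNIV - {0}))"

definition kronecker :: "dual_point \<Rightarrow> real" where
  "kronecker = (\<lambda>((n, m), (\<nu>, l)). if n = m then 1 else 0)"

definition symb :: "dual_point \<Rightarrow> real" where
  "symb = (\<lambda>((n, m), (\<nu>, l)). scaled_eigval m \<nu> l)"

end

theory Submission
  imports Defs
begin

text \<open>The proof treats \<open>- u'' + V u = e u\<close>, with \<open>V x = (x\<^sup>2 / 2 - \<mu>)\<^sup>2\<close>, as an ordinary
differential equation and reads the whole spectrum off a rotating angle.

\<^bold>\<open>Spectrum.\<close> The solution with data \<open>u 0 = sin \<alpha>\<close>, \<open>u' 0 = cos \<alpha>\<close> is an entire power series,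
continuous in \<open>(x, e, \<mu>)\<close>, and so is its Pruefer angle \<open>\<theta>\<close>, defined by \<open>u' + i u = r exp (i \<theta>)\<close>.
The angle crosses multiples of \<open>\<pi>\<close> only upwards and increases with \<open>e\<close>.  Where \<open>V > e\<close> a solution
either grows, and its angle is trapped below some \<open>(k - 1/2) \<pi>\<close>, or decays, and its angle stays
between \<open>(k - 1/2) \<pi>\<close> and \<open>k \<pi>\<close>.  Hence the least energy from which on the angle exceeds \<open>k \<pi>\<close>
carries a square integrable solution, and a Wronskian argument shows that no other energy has one
with the same \<open>k\<close> (\<open>level_sector\<close>, \<open>sector_unique\<close>, \<open>sq_int_iff\<close>).  Since \<open>V\<close> is even, the
data \<open>\<alpha> = \<pi> / 2\<close> (even solutions) and \<open>\<alpha> = 0\<close> (odd solutions) suffice, and the two families of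
levels interlace to one strictly increasing sequence \<open>energy\<close>.  Each level is upper semicontinuous
in \<open>\<mu>\<close>, because its sublevel sets are open, so it is Borel measurable.

\<^bold>\<open>Distributions.\<close> A weak eigenfunction annihilates every test function that is orthogonal to the two
classical solutions, because variation of constants solves the equation for such a right hand side
by a test function (\<open>solve_test\<close>).  Therefore it is almost everywhere a combination of the two
solutions (\<open>eigenfunction_form\<close>), and \<open>eigval m \<mu> = energy m \<mu>\<close> (\<open>eigval_eq\<close>).

\<^bold>\<open>Size of the eigenvalues.\<close> Comparing the angle, rescaled by the square root of the energy, with that
of a harmonic oscillator gives \<open>energy m \<mu> \<ge> (m + 1) sqrt (1 + \<bar>\<mu>\<bar>) / 40\<close>, and a long enough stretch
near the bottom of a well gives \<open>energy 0 \<mu> \<le> 15 sqrt \<mu>\<close> for \<open>\<mu> \<ge> 1\<close>.  So the series converges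
exactly when \<open>\<mu> powr (- \<gamma> / 2)\<close> is integrable at infinity, that is when \<open>\<gamma> > 2\<close>.

\<^bold>\<open>Integration formula.\<close> For fixed \<open>m\<close> substitute \<open>\<nu> = \<mu> \<bar>l\<bar> powr (4/3)\<close> and then
\<open>r = \<bar>l\<bar> powr (2/3) * energy m \<mu>\<close>; the Jacobian is \<open>3/2 * r powr (5/2) / energy m \<mu> powr (7/2)\<close> and
the two signs of \<open>l\<close> double it (\<open>slice_integral\<close>).  Null sets of the half line have null
preimages, which extends the formula from Borel to Lebesgue measurable functions.\<close>

section \<open>Solutions of the differential equation as power series\<close>

definition pot :: "real \<Rightarrow> real \<Rightarrow> real" where
  "pot \<mu> x = (x\<^sup>2 / 2 - \<mu>)\<^sup>2"

text \<open>Taylor coefficients at \<open>0\<close> of the solution of \<open>u'' = (V - e) u\<close>; the three terms of the recursion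
come from \<open>V x - e = (\<mu>\<^sup>2 - e) - \<mu> x\<^sup>2 + x ^ 4 / 4\<close>.  The initial data are given by an angle so that
the Pruefer angle starts at \<open>\<alpha>\<close>.\<close>

fun ode_coeff :: "real \<Rightarrow> real \<Rightarrow> real \<Rightarrow> nat \<Rightarrow> real" where
  "ode_coeff \<alpha> e \<mu> 0 = sin \<alpha>"
| "ode_coeff \<alpha> e \<mu> (Suc 0) = cos \<alpha>"
| "ode_coeff \<alpha> e \<mu> (Suc (Suc n)) =
     ((\<mu>\<^sup>2 - e) * ode_coeff \<alpha> e \<mu> n - \<mu> * (if n < 2 then 0 else ode_coeff \<alpha> e \<mu> (n - 2))
        + (if n < 4 then 0 else ode_coeff \<alpha> e \<mu> (n - 4)) / 4) / (real (Suc n) * real (Suc (Suc n)))"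

text \<open>One step of the recursion multiplies the weighted coefficients by at most
\<open>Q / ((n + 1) (n + 2))\<close>.  This is at most \<open>1\<close> as soon as \<open>n \<ge> Q\<close>, so growth by the factor \<open>Q\<close>
happens at most \<open>N\<close> times.\<close>

lemma ode_coeff_bound:
  assumes B: "1 \<le> B" and r: "1 \<le> r" and e: "\<bar>e\<bar> \<le> B" and m: "\<bar>\<mu>\<bar> \<le> B"
    and Q: "Q = (B + 1)\<^sup>2 * r ^ 6" and N: "Q \<le> real N"
  shows "\<bar>ode_coeff \<alpha> e \<mu> n\<bar> * r ^ n \<le> r * Q ^ N"
proof -
  have Q1: "1 \<le> Q"
  proof -
    have "1 \<le> (B + 1)\<^sup>2" using B by (simp add: power2_eq_square algebra_simps)
    moreover have "1 \<le> r ^ 6" using r by simp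
    ultimately show ?thesis unfolding Q using mult_mono[of 1 "(B+1)\<^sup>2" 1 "r^6"] by simp
  qed
  \<comment> \<open>The exponent stops growing at \<open>N\<close>, where the denominators take over.\<close>
  define D where "D n = r * Q ^ (min n N)" for n
  have Dmono: "D i \<le> D j" if "i \<le> j" for i j
    unfolding D_def using that r Q1 by (intro mult_left_mono power_increasing) auto
  have D0: "0 \<le> D i" for i unfolding D_def using r Q1 by auto
  have "\<bar>ode_coeff \<alpha> e \<mu> n\<bar> * r ^ n \<le> D n" for n
  proof (induction n rule: less_induct)
    case (less n)
    consider "n = 0" | "n = 1" | k where "n = Suc (Suc k)"
      by (metis One_nat_def not0_implies_Suc)
    then show ?case
    proof cases
      case 1
      have "\<bar>sin \<alpha>\<bar> \<le> r" using r abs_sin_le_one[of \<alpha>] by linarith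
      then show ?thesis using 1 by (simp add: D_def)
    next
      case 2
      have "\<bar>cos \<alpha>\<bar> * r \<le> 1 * r" using r by (intro mult_right_mono) auto
      also have "\<dots> \<le> D 1"
        unfolding D_def using r Q1 mult_left_mono[of 1 "Q ^ min 1 N" r] by simp
      finally show ?thesis using 2 by simp
    next
      case 3
      have IH: "\<bar>ode_coeff \<alpha> e \<mu> j\<bar> * r ^ j \<le> D k" if "j \<le> k" for j
        using less.IH[of j] Dmono[OF that] that 3 by force
      have r26: "r ^ 2 \<le> r ^ 6" "r ^ 4 \<le> r ^ 6" using r by (auto intro: power_increasing)
      let ?b = "if k < 2 then 0 else ode_coeff \<alpha> e \<mu> (k - 2)"
      let ?c = "if k < 4 then 0 else ode_coeff \<alpha> e \<mu> (k - 4)"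
      have a: "\<bar>ode_coeff \<alpha> e \<mu> k\<bar> * r ^ (k + 2) \<le> r ^ 6 * D k"
      proof -
        have "\<bar>ode_coeff \<alpha> e \<mu> k\<bar> * r ^ (k + 2) = r ^ 2 * (\<bar>ode_coeff \<alpha> e \<mu> k\<bar> * r ^ k)"
          by (simp add: power_add power2_eq_square)
        also have "\<dots> \<le> r ^ 6 * D k" using r26 IH[of k] r by (intro mult_mono) auto
        finally show ?thesis .
      qed
      have b: "\<bar>?b\<bar> * r ^ (k + 2) \<le> r ^ 6 * D k"
      proof (cases "k < 2")
        case False
        then have "k + 2 = 4 + (k - 2)" by simp
        then have "\<bar>?b\<bar> * r ^ (k + 2) = r ^ 4 * (\<bar>ode_coeff \<alpha> e \<mu> (k - 2)\<bar> * r ^ (k - 2))"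
          using False by (simp only: power_add) simp
        also have "\<dots> \<le> r ^ 6 * D k" using r26 IH[of "k - 2"] r by (intro mult_mono) auto
        finally show ?thesis .
      qed (use D0 r in auto)
      have c: "\<bar>?c\<bar> * r ^ (k + 2) \<le> r ^ 6 * D k"
      proof (cases "k < 4")
        case False
        then have "k + 2 = 6 + (k - 4)" by simp
        then have "\<bar>?c\<bar> * r ^ (k + 2) = r ^ 6 * (\<bar>ode_coeff \<alpha> e \<mu> (k - 4)\<bar> * r ^ (k - 4))"
          using False by (simp only: power_add) simp
        also have "\<dots> \<le> r ^ 6 * D k" using IH[of "k - 4"] r by (intro mult_mono) auto
        finally show ?thesis .
      qed (use D0 r in auto)
      define P where "P = real (Suc k) * real (Suc (Suc k))"
      have P1: "P \<ge> 1" unfolding P_def by (simp add: algebra_simps)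
      have m2: "\<bar>\<mu>\<^sup>2 - e\<bar> \<le> B\<^sup>2 + B"
      proof -
        have "\<mu>\<^sup>2 \<le> B\<^sup>2" using m by (metis abs_le_square_iff abs_of_nonneg B order_trans zero_le_one)
        then show ?thesis using e by (smt (verit) zero_le_power2)
      qed
      have "\<bar>(\<mu>\<^sup>2 - e) * ode_coeff \<alpha> e \<mu> k - \<mu> * ?b + ?c / 4\<bar> * r ^ (k + 2)
          \<le> (\<bar>\<mu>\<^sup>2 - e\<bar> * \<bar>ode_coeff \<alpha> e \<mu> k\<bar> + \<bar>\<mu>\<bar> * \<bar>?b\<bar> + \<bar>?c\<bar> / 4) * r ^ (k + 2)"
        using r by (intro mult_right_mono) (auto simp: abs_mult[symmetric])
      also have "\<dots> = \<bar>\<mu>\<^sup>2 - e\<bar> * (\<bar>ode_coeff \<alpha> e \<mu> k\<bar> * r ^ (k + 2)) + \<bar>\<mu>\<bar> * (\<bar>?b\<bar> * r ^ (k + 2))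
          + (\<bar>?c\<bar> * r ^ (k + 2)) / 4" by (simp add: algebra_simps)
      also have "\<dots> \<le> (B\<^sup>2 + B) * (r ^ 6 * D k) + B * (r ^ 6 * D k) + (r ^ 6 * D k) / 4"
      proof -
        have "p * A + q * A' + A'' / 4 \<le> p' * M + q' * M + M / 4"
          if "A \<le> M" "A' \<le> M" "A'' \<le> M" "p \<le> p'" "q \<le> q'" "0 \<le> p" "0 \<le> q" "0 \<le> A" "0 \<le> A'"
          for p q p' q' A A' A'' M :: real
          using that by (intro add_mono mult_mono divide_right_mono) auto
        from this[OF a b c m2 m] show ?thesis using r by simp
      qed
      also have "\<dots> \<le> Q * D k"
      proof -
        have "(B\<^sup>2 + B) * X + B * X + X / 4 \<le> (B + 1)\<^sup>2 * X" if "0 \<le> X" for X :: real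
          using that by (simp add: power2_eq_square algebra_simps)
        from this[of "r ^ 6 * D k"] show ?thesis unfolding Q using D0 r by (simp add: mult.assoc)
      qed
      finally have main: "\<bar>(\<mu>\<^sup>2 - e) * ode_coeff \<alpha> e \<mu> k - \<mu> * ?b + ?c / 4\<bar> * r ^ (k + 2) \<le> Q * D k" .
      have "\<bar>ode_coeff \<alpha> e \<mu> n\<bar> * r ^ n = (\<bar>(\<mu>\<^sup>2 - e) * ode_coeff \<alpha> e \<mu> k - \<mu> * ?b + ?c / 4\<bar> * r ^ (k + 2)) / P"
        unfolding 3 ode_coeff.simps P_def by (simp add: abs_divide abs_mult)
      also have "\<dots> \<le> Q * D k / P" using main P1 by (intro divide_right_mono) auto
      also have "\<dots> \<le> D n"
      proof (cases "k < N")
        case True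
        have "Q * D k / P \<le> Q * D k"
          using P1 Q1 D0[of k] mult_left_mono[of 1 P "Q * D k"] by (simp add: divide_le_eq)
        also have "\<dots> = D (Suc k)" unfolding D_def using True by (simp add: min_def)
        also have "\<dots> \<le> D n" using 3 by (intro Dmono) auto
        finally show ?thesis .
      next
        case False
        have "Q \<le> P"
        proof -
          have "Q \<le> real (Suc k) * 1" using N False by simp
          also have "\<dots> \<le> P" unfolding P_def by (intro mult_left_mono) auto
          finally show ?thesis .
        qed
        then have "Q * D k / P \<le> D k" using P1 D0[of k] by (simp add: divide_le_eq mult_right_mono mult.commute)
        also have "\<dots> \<le> D n" using 3 by (intro Dmono) auto
        finally show ?thesis .
      qed
      finally show ?thesis .
    qed
  qed
  also have "D n \<le> r * Q ^ N" unfolding D_def using r Q1 by (intro mult_left_mono power_increasing) auto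
  finally show ?thesis .
qed

text \<open>Coefficient families, depending on \<open>e\<close> and \<open>\<mu>\<close>, of power series that converge everywhere, locally
uniformly in all variables.\<close>

definition tame :: "(real \<Rightarrow> real \<Rightarrow> nat \<Rightarrow> real) \<Rightarrow> bool" where
  "tame c \<longleftrightarrow> (\<forall>B\<ge>1. \<forall>r\<ge>1. \<exists>K. \<forall>e \<mu> n. \<bar>e\<bar> \<le> B \<longrightarrow> \<bar>\<mu>\<bar> \<le> B \<longrightarrow> \<bar>c e \<mu> n\<bar> * r ^ n \<le> K)
     \<and> (\<forall>n. continuous_on UNIV (\<lambda>(e, \<mu>). c e \<mu> n))"

lemma tame_bound:
  assumes "tame c" "1 \<le> B" "1 \<le> r"
  shows "\<exists>K. \<forall>e \<mu> n. \<bar>e\<bar> \<le> B \<longrightarrow> \<bar>\<mu>\<bar> \<le> B \<longrightarrow> \<bar>c e \<mu> n\<bar> * r ^ n \<le> K"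
  using assms unfolding tame_def by meson

lemma tame_ode_coeff: "tame (ode_coeff \<alpha>)"
  unfolding tame_def
proof (intro conjI allI impI)
  fix B r :: real assume B: "1 \<le> B" and r: "1 \<le> r"
  define Q where "Q = (B + 1)\<^sup>2 * r ^ 6"
  obtain N where "Q \<le> real N" using real_arch_simple by blast
  then show "\<exists>K. \<forall>e \<mu> n. \<bar>e\<bar> \<le> B \<longrightarrow> \<bar>\<mu>\<bar> \<le> B \<longrightarrow> \<bar>ode_coeff \<alpha> e \<mu> n\<bar> * r ^ n \<le> K"
    using ode_coeff_bound[OF B r _ _ Q_def] by blast
next
  fix n
  show "continuous_on UNIV (\<lambda>(e, \<mu>). ode_coeff \<alpha> e \<mu> n)"
  proof (induction n rule: less_induct)
    case (less n)
    consider "n = 0" | "n = 1" | k where "n = Suc (Suc k)"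
      by (metis One_nat_def not0_implies_Suc)
    then show ?case
    proof cases
      case 3
      have [continuous_intros]: "continuous_on UNIV (\<lambda>x. ode_coeff \<alpha> (fst x) (snd x) j)" if "j \<le> k" for j
        using less.IH[of j] that 3 by (simp add: case_prod_unfold)
      show ?thesis unfolding 3 ode_coeff.simps case_prod_unfold
        by (cases "k < 2"; cases "k < 4") (auto intro!: continuous_intros)
    qed (auto simp: case_prod_unfold)
  qed
qed

lemma tame_diffs: "tame c \<Longrightarrow> tame (\<lambda>e \<mu>. diffs (c e \<mu>))"
proof -
  assume c: "tame c"
  show ?thesis unfolding tame_def
  proof (intro conjI allI impI)
    fix B r :: real assume B: "1 \<le> B" and r: "1 \<le> r"
    have "1 \<le> 2 * r" using r by simp
    then obtain K where "\<forall>e \<mu> n. \<bar>e\<bar> \<le> B \<longrightarrow> \<bar>\<mu>\<bar> \<le> B \<longrightarrow> \<bar>c e \<mu> n\<bar> * (2 * r) ^ n \<le> K"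
      using tame_bound[OF c B] by meson
    then have K: "\<bar>e\<bar> \<le> B \<Longrightarrow> \<bar>\<mu>\<bar> \<le> B \<Longrightarrow> \<bar>c e \<mu> n\<bar> * (2 * r) ^ n \<le> K" for e \<mu> n by blast
    have "\<bar>diffs (c e \<mu>) n\<bar> * r ^ n \<le> K" if "\<bar>e\<bar> \<le> B" "\<bar>\<mu>\<bar> \<le> B" for e \<mu> n
    proof -
      have n2: "real (Suc n) \<le> 2 ^ Suc n" using less_exp[of "Suc n"] by (metis less_imp_le of_nat_le_iff of_nat_numeral of_nat_power)
      have "\<bar>diffs (c e \<mu>) n\<bar> * r ^ n = \<bar>c e \<mu> (Suc n)\<bar> * (real (Suc n) * r ^ n)"
        by (simp add: diffs_def abs_mult)
      also have "\<dots> \<le> \<bar>c e \<mu> (Suc n)\<bar> * (2 ^ Suc n * r ^ Suc n)"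
        using n2 r by (intro mult_left_mono mult_mono power_increasing) auto
      also have "\<dots> = \<bar>c e \<mu> (Suc n)\<bar> * (2 * r) ^ Suc n" by (simp only: power_mult_distrib)
      also have "\<dots> \<le> K" using K[OF that] by blast
      finally show ?thesis .
    qed
    then show "\<exists>K. \<forall>e \<mu> n. \<bar>e\<bar> \<le> B \<longrightarrow> \<bar>\<mu>\<bar> \<le> B \<longrightarrow> \<bar>diffs (c e \<mu>) n\<bar> * r ^ n \<le> K" by blast
  next
    fix n
    show "continuous_on UNIV (\<lambda>(e, \<mu>). diffs (c e \<mu>) n)"
      using c unfolding tame_def diffs_def case_prod_unfold by (auto intro!: continuous_intros)
  qed
qed

text \<open>The bound is taken at twice the radius, so that the terms are dominated by a geometric series.\<close>

lemma tame_term: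
  assumes K: "\<And>n. \<bar>c n\<bar> * (2 * B) ^ n \<le> K" and x: "\<bar>x\<bar> \<le> B" and B: "1 \<le> (B::real)"
  shows "norm (c n * x ^ n) \<le> K * (1 / 2) ^ n"
proof -
  have "norm (c n * x ^ n) = \<bar>c n\<bar> * \<bar>x\<bar> ^ n" by (simp add: abs_mult power_abs)
  also have "\<dots> \<le> \<bar>c n\<bar> * B ^ n" using x by (intro mult_left_mono power_mono) auto
  also have "\<dots> = \<bar>c n\<bar> * (2 * B) ^ n * (1 / 2) ^ n" by (simp add: power_mult_distrib power_divide)
  also have "\<dots> \<le> K * (1 / 2) ^ n" using K by (intro mult_right_mono) auto
  finally show ?thesis .
qed

lemma tame_summable:
  assumes "tame c"
  shows "summable (\<lambda>n. c e \<mu> n * x ^ n)"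
proof -
  define B where "B = 1 + \<bar>e\<bar> + \<bar>\<mu>\<bar> + \<bar>x\<bar>"
  have B: "1 \<le> B" "1 \<le> 2 * B" "\<bar>e\<bar> \<le> B" "\<bar>\<mu>\<bar> \<le> B" "\<bar>x\<bar> \<le> B" unfolding B_def by auto
  obtain K where "\<forall>e \<mu> n. \<bar>e\<bar> \<le> B \<longrightarrow> \<bar>\<mu>\<bar> \<le> B \<longrightarrow> \<bar>c e \<mu> n\<bar> * (2 * B) ^ n \<le> K"
      using tame_bound[OF assms B(1,2)] ..
    then have K: "\<bar>e\<bar> \<le> B \<Longrightarrow> \<bar>\<mu>\<bar> \<le> B \<Longrightarrow> \<bar>c e \<mu> n\<bar> * (2 * B) ^ n \<le> K" for e \<mu> n by blast
  show ?thesis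
    by (rule summable_comparison_test'[where N = 0, OF _ tame_term[OF K[OF B(3,4)] B(5) B(1)]])
      (auto intro!: summable_mult summable_geometric)
qed

lemma tame_continuous:
  assumes "tame c"
  shows "continuous_on UNIV (\<lambda>(x, e, \<mu>). \<Sum>n. c e \<mu> n * x ^ n)"
proof -
  have "isCont (\<lambda>(x, e, \<mu>). \<Sum>n. c e \<mu> n * x ^ n) z" for z :: "real \<times> real \<times> real"
  proof -
    define B where "B = 1 + norm z"
    have B: "1 \<le> B" "1 \<le> 2 * B" unfolding B_def by auto
    obtain K where "\<forall>e \<mu> n. \<bar>e\<bar> \<le> B \<longrightarrow> \<bar>\<mu>\<bar> \<le> B \<longrightarrow> \<bar>c e \<mu> n\<bar> * (2 * B) ^ n \<le> K"
      using tame_bound[OF assms B(1,2)] ..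
    then have K: "\<bar>e\<bar> \<le> B \<Longrightarrow> \<bar>\<mu>\<bar> \<le> B \<Longrightarrow> \<bar>c e \<mu> n\<bar> * (2 * B) ^ n \<le> K" for e \<mu> n by blast
    have in_ball: "\<bar>fst y\<bar> \<le> B" "\<bar>fst (snd y)\<bar> \<le> B" "\<bar>snd (snd y)\<bar> \<le> B" if "y \<in> ball 0 B" for y
      using that norm_fst_le[of "fst y" "snd y"] norm_snd_le[of "snd y" "fst y"]
        norm_fst_le[of "fst (snd y)" "snd (snd y)"] norm_snd_le[of "snd (snd y)" "fst (snd y)"]
      by auto
    have tt: "norm (c (fst (snd y)) (snd (snd y)) n * fst y ^ n) \<le> K * (1 / 2) ^ n" if "y \<in> ball 0 B" for y n
      by (rule tame_term[OF K[OF in_ball(2,3)[OF that]] in_ball(1)[OF that] B(1)])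
    have "uniform_limit (ball 0 B) (\<lambda>n y. \<Sum>i<n. c (fst (snd y)) (snd (snd y)) i * fst y ^ i)
        (\<lambda>y. \<Sum>n. c (fst (snd y)) (snd (snd y)) n * fst y ^ n) sequentially"
      by (rule Weierstrass_m_test[where M = "\<lambda>n. K * (1 / 2) ^ n"])
        (intro tt summable_mult summable_geometric | simp)+
    moreover have "continuous_on (ball 0 B) (\<lambda>y::real \<times> real \<times> real. c (fst (snd y)) (snd (snd y)) i)" for i
    proof -
      have "continuous_on UNIV (\<lambda>y. c (fst y) (snd y) i)"
        using assms unfolding tame_def by (auto simp: case_prod_unfold)
      from continuous_on_compose2[OF this, of "ball (0::real \<times> real \<times> real) B" snd] show ?thesis
        by (simp add: linear_continuous_on bounded_linear_snd)
    qed
    then have "continuous_on (ball 0 B) (\<lambda>y. \<Sum>i<n. c (fst (snd y)) (snd (snd y)) i * fst y ^ i)" for n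
      by (auto intro!: continuous_intros)
    ultimately have "continuous_on (ball 0 B) (\<lambda>y. \<Sum>n. c (fst (snd y)) (snd (snd y)) n * fst y ^ n)"
      by (intro uniform_limit_theorem[OF _ _ sequentially_bot]) auto
    moreover have "z \<in> ball 0 B" unfolding B_def by simp
    ultimately show ?thesis
      unfolding case_prod_unfold by (simp add: continuous_on_eq_continuous_at)
  qed
  then show ?thesis by (simp add: continuous_on_eq_continuous_at)
qed

definition sol :: "real \<Rightarrow> real \<Rightarrow> real \<Rightarrow> real \<Rightarrow> real" where
  "sol \<alpha> e \<mu> x = (\<Sum>n. ode_coeff \<alpha> e \<mu> n * x ^ n)"

definition dsol :: "real \<Rightarrow> real \<Rightarrow> real \<Rightarrow> real \<Rightarrow> real" where
  "dsol \<alpha> e \<mu> x = (\<Sum>n. diffs (ode_coeff \<alpha> e \<mu>) n * x ^ n)"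

lemma continuous_sol: "continuous_on UNIV (\<lambda>(x, e, \<mu>). sol \<alpha> e \<mu> x)"
  unfolding sol_def by (rule tame_continuous[OF tame_ode_coeff])

lemma continuous_dsol: "continuous_on UNIV (\<lambda>(x, e, \<mu>). dsol \<alpha> e \<mu> x)"
  unfolding dsol_def by (rule tame_continuous[OF tame_diffs[OF tame_ode_coeff]])

lemma sol_has_deriv: "(sol \<alpha> e \<mu> has_real_derivative dsol \<alpha> e \<mu> x) (at x)"
  unfolding sol_def[abs_def] dsol_def
  by (rule termdiffs_strong_converges_everywhere) (rule tame_summable[OF tame_ode_coeff])

lemma dsol_has_deriv: "(dsol \<alpha> e \<mu> has_real_derivative (pot \<mu> x - e) * sol \<alpha> e \<mu> x) (at x)"
proof -
  let ?c = "ode_coeff \<alpha> e \<mu>"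
  have S: "(\<lambda>n. ?c n * x ^ n) sums sol \<alpha> e \<mu> x"
    unfolding sol_def using tame_summable[OF tame_ode_coeff] by (rule summable_sums)
  have sh: "(\<lambda>n. (if n < k then 0 else ?c (n - k)) * x ^ n) sums (x ^ k * sol \<alpha> e \<mu> x)" for k
  proof -
    have "(\<lambda>n. x ^ k * (?c n * x ^ n)) sums (x ^ k * sol \<alpha> e \<mu> x)" using S by (rule sums_mult)
    then have "(\<lambda>n. (if n + k < k then 0 else ?c (n + k - k)) * x ^ (n + k)) sums (x ^ k * sol \<alpha> e \<mu> x)"
      by (simp add: power_add algebra_simps)
    then show ?thesis by (subst (asm) sums_iff_shift) simp
  qed
  have "(\<lambda>n. (\<mu>\<^sup>2 - e) * (?c n * x ^ n) - \<mu> * ((if n < 2 then 0 else ?c (n - 2)) * x ^ n)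
        + ((if n < 4 then 0 else ?c (n - 4)) * x ^ n) / 4)
      sums ((\<mu>\<^sup>2 - e) * sol \<alpha> e \<mu> x - \<mu> * (x ^ 2 * sol \<alpha> e \<mu> x) + (x ^ 4 * sol \<alpha> e \<mu> x) / 4)"
    by (intro sums_add sums_diff sums_mult sums_divide S sh)
  also have "(\<lambda>n. (\<mu>\<^sup>2 - e) * (?c n * x ^ n) - \<mu> * ((if n < 2 then 0 else ?c (n - 2)) * x ^ n)
        + ((if n < 4 then 0 else ?c (n - 4)) * x ^ n) / 4) = (\<lambda>n. diffs (diffs ?c) n * x ^ n)"
  proof
    fix n
    have "diffs (diffs ?c) n = (\<mu>\<^sup>2 - e) * ?c n - \<mu> * (if n < 2 then 0 else ?c (n - 2))
        + (if n < 4 then 0 else ?c (n - 4)) / 4"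
      unfolding diffs_def ode_coeff.simps by (simp add: field_simps del: of_nat_Suc)
    then show "(\<mu>\<^sup>2 - e) * (?c n * x ^ n) - \<mu> * ((if n < 2 then 0 else ?c (n - 2)) * x ^ n)
        + ((if n < 4 then 0 else ?c (n - 4)) * x ^ n) / 4 = diffs (diffs ?c) n * x ^ n"
      by (simp only:) (simp add: algebra_simps)
  qed
  also have "(\<mu>\<^sup>2 - e) * sol \<alpha> e \<mu> x - \<mu> * (x ^ 2 * sol \<alpha> e \<mu> x) + (x ^ 4 * sol \<alpha> e \<mu> x) / 4
      = (pot \<mu> x - e) * sol \<alpha> e \<mu> x"
    by (simp add: pot_def power2_eq_square power4_eq_xxxx field_simps)
  finally have "(\<Sum>n. diffs (diffs ?c) n * x ^ n) = (pot \<mu> x - e) * sol \<alpha> e \<mu> x"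
    by (simp add: sums_iff)
  moreover have "(dsol \<alpha> e \<mu> has_real_derivative (\<Sum>n. diffs (diffs ?c) n * x ^ n)) (at x)"
    unfolding dsol_def[abs_def]
    by (rule termdiffs_strong_converges_everywhere) (rule tame_summable[OF tame_diffs[OF tame_ode_coeff]])
  ultimately show ?thesis by simp
qed

lemma sol_0 [simp]: "sol \<alpha> e \<mu> 0 = sin \<alpha>"
  unfolding sol_def by (simp add: powser_zero)

lemma dsol_0 [simp]: "dsol \<alpha> e \<mu> 0 = cos \<alpha>"
  unfolding dsol_def by (simp add: powser_zero diffs_def)

text \<open>The two choices \<open>\<alpha> = \<pi> / 2\<close> and \<open>\<alpha> = 0\<close> give the even and the odd solution, which form a basis.\<close>

lemma sol_even: "sol (pi / 2) e \<mu> (- x) = sol (pi / 2) e \<mu> x"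
proof -
  have "odd n \<longrightarrow> ode_coeff (pi / 2) e \<mu> n = 0" for n
    by (induction "pi / 2" e \<mu> n rule: ode_coeff.induct) auto
  then have "ode_coeff (pi / 2) e \<mu> n * (- x) ^ n = ode_coeff (pi / 2) e \<mu> n * x ^ n" for n
    by (cases "odd n") auto
  then show ?thesis unfolding sol_def by presburger
qed

lemma sol_odd: "sol 0 e \<mu> (- x) = - sol 0 e \<mu> x"
proof -
  have "even n \<longrightarrow> ode_coeff 0 e \<mu> n = 0" for n
    by (induction "0::real" e \<mu> n rule: ode_coeff.induct) auto
  then have "ode_coeff 0 e \<mu> n * (- x) ^ n = - (ode_coeff 0 e \<mu> n * x ^ n)" for n
    by (cases "odd n") auto
  then show ?thesis unfolding sol_def
    by (simp add: suminf_minus[OF tame_summable[OF tame_ode_coeff]])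
qed

lemma wronskian_solutions: "sol (pi / 2) e \<mu> x * dsol 0 e \<mu> x - dsol (pi / 2) e \<mu> x * sol 0 e \<mu> x = 1"
proof -
  let ?W = "\<lambda>x. sol (pi / 2) e \<mu> x * dsol 0 e \<mu> x - dsol (pi / 2) e \<mu> x * sol 0 e \<mu> x"
  have "(?W has_real_derivative 0) (at x)" for x
    by (auto intro!: derivative_eq_intros sol_has_deriv dsol_has_deriv)
  then have "?W x = ?W 0" by (intro DERIV_isconst_all) auto
  then show ?thesis by simp
qed

section \<open>The Pruefer angle\<close>

text \<open>Differential inequality that confines a function below \<open>0\<close>, where the derivative is only controlled
when the function is positive.  Behind the last zero the function \<open>d x * exp (- L * x)\<close> decreases.\<close>

lemma barrier:
  fixes d d' :: "real \<Rightarrow> real"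
  assumes ab: "a \<le> b" and da: "d a \<le> 0"
    and der: "\<And>x. a \<le> x \<Longrightarrow> x \<le> b \<Longrightarrow> (d has_real_derivative d' x) (at x)"
    and le: "\<And>x. a \<le> x \<Longrightarrow> x \<le> b \<Longrightarrow> 0 < d x \<Longrightarrow> d' x \<le> L * d x"
  shows "d b \<le> 0"
proof (rule ccontr)
  assume "\<not> d b \<le> 0"
  then have db: "0 < d b" by simp
  have cont: "continuous_on {a..b} d"
    using der by (intro DERIV_continuous_on[of _ d d']) (auto intro: has_field_derivative_at_within)
  define S where "S = {a..b} \<inter> d -` {..0}"
  have "closed S" unfolding S_def
    by (rule continuous_closed_preimage[OF cont]) auto
  moreover have "a \<in> S" using da ab by (auto simp: S_def)
  moreover have bdd: "bdd_above S" unfolding S_def by (auto intro!: bdd_aboveI[of _ b])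
  ultimately have cS: "Sup S \<in> S" by (intro closed_contains_Sup) auto
  define c where "c = Sup S"
  have c: "a \<le> c" "c \<le> b" "d c \<le> 0" using cS unfolding c_def S_def by auto
  have pos: "0 < d x" if "c < x" "x \<le> b" for x
    using cSup_upper[OF _ bdd, of x] that c unfolding c_def S_def by force
  let ?g = "\<lambda>x. d x * exp (- L * x)"
  have g: "(?g has_real_derivative (d' x - L * d x) * exp (- L * x)) (at x)" if "a \<le> x" "x \<le> b" for x
    by (auto intro!: derivative_eq_intros der that simp: algebra_simps)
  have "?g b \<le> ?g c"
  proof (rule DERIV_nonpos_imp_decreasing_open[OF c(2)])
    fix x assume x: "c < x" "x < b"
    have "(d' x - L * d x) * exp (- L * x) \<le> 0"
      using le[of x] pos[of x] x c by (intro mult_nonpos_nonneg) auto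
    then show "\<exists>y. (?g has_real_derivative y) (at x) \<and> y \<le> 0"
      using g[of x] x c by auto
  next
    show "continuous_on {c..b} ?g"
      using c by (intro continuous_intros continuous_on_subset[OF cont]) auto
  qed
  also have "\<dots> \<le> 0" using c by (simp add: mult_nonpos_nonneg)
  finally show False using db by (simp add: mult_le_0_iff)
qed

text \<open>Polar coordinates of the curve \<open>(v, u)\<close>: the angle is measured from the axis of \<open>v = u'\<close>, so zeros of
\<open>u\<close> sit at the multiples of \<open>\<pi>\<close>.\<close>

definition is_angle :: "(real \<Rightarrow> real) \<Rightarrow> (real \<Rightarrow> real) \<Rightarrow> (real \<Rightarrow> real) \<Rightarrow> bool" where
  "is_angle \<theta> u v \<longleftrightarrow> continuous_on UNIV \<theta> \<and>
     (\<forall>x. (u x)\<^sup>2 + (v x)\<^sup>2 > 0 \<and> u x = sqrt ((u x)\<^sup>2 + (v x)\<^sup>2) * sin (\<theta> x) \<and> v x = sqrt ((u x)\<^sup>2 + (v x)\<^sup>2) * cos (\<theta> x))"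

text \<open>A curve or surface that avoids the origin has a continuous complex logarithm over a contractible
parameter space; its imaginary part is the angle.\<close>

lemma angle_lift:
  fixes u v :: "'a::real_normed_vector \<Rightarrow> real"
  assumes u: "continuous_on UNIV u" and v: "continuous_on UNIV v"
    and nz: "\<And>z. u z \<noteq> 0 \<or> v z \<noteq> 0"
  shows "\<exists>\<theta>. continuous_on UNIV \<theta> \<and>
    (\<forall>x. (u x)\<^sup>2 + (v x)\<^sup>2 > 0 \<and> u x = sqrt ((u x)\<^sup>2 + (v x)\<^sup>2) * sin (\<theta> x) \<and> v x = sqrt ((u x)\<^sup>2 + (v x)\<^sup>2) * cos (\<theta> x))"
proof -
  have "\<exists>g. continuous_on UNIV g \<and> (\<forall>z\<in>UNIV. Complex (v z) (u z) = exp (g z))"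
  proof (rule continuous_logarithm_on_contractible[of UNIV "\<lambda>z. Complex (v z) (u z)"])
    show "continuous_on UNIV (\<lambda>z. Complex (v z) (u z))"
      unfolding complex_eq by (intro continuous_intros u v)
    show "Complex (v z) (u z) \<noteq> 0" for z using nz[of z] by (auto simp: complex_eq_iff)
    show "contractible (UNIV :: 'a set)" by (simp add: convex_imp_contractible)
  qed blast
  then obtain g where g: "continuous_on UNIV g" "\<And>z. Complex (v z) (u z) = exp (g z)"
    by auto
  have n: "exp (Re (g z)) = sqrt ((u z)\<^sup>2 + (v z)\<^sup>2)" for z
    using arg_cong[OF g(2)[of z], of cmod] by (simp add: complex_norm add.commute)
  show ?thesis
  proof (intro exI[of _ "\<lambda>z. Im (g z)"] conjI allI)
    show "continuous_on UNIV (\<lambda>z. Im (g z))" using g(1) by (intro continuous_intros)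
    fix x
    show "(u x)\<^sup>2 + (v x)\<^sup>2 > 0" using nz[of x] by (auto simp: sum_power2_gt_zero_iff)
    show "u x = sqrt ((u x)\<^sup>2 + (v x)\<^sup>2) * sin (Im (g x))"
      using arg_cong[OF g(2)[of x], of Im] by (simp add: Im_exp n)
    show "v x = sqrt ((u x)\<^sup>2 + (v x)\<^sup>2) * cos (Im (g x))"
      using arg_cong[OF g(2)[of x], of Re] by (simp add: Re_exp n)
  qed
qed

lemma deriv_quot:
  fixes f g :: "real \<Rightarrow> real"
  assumes "(f has_real_derivative D) (at x)" "(g has_real_derivative E) (at x)" "f x = 0" "g x \<noteq> 0"
  shows "((\<lambda>y. f y / g y) has_real_derivative D / g x) (at x)"
  using DERIV_divide[OF assms(1,2,4)] assms(3,4) by simp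

text \<open>Near \<open>x\<close> the increment of the angle is the arctangent of the ratio of cross product and inner
product, because a continuous angle cannot jump.\<close>

lemma is_angle_deriv:
  assumes A: "is_angle \<theta> u v"
    and u: "(u has_real_derivative u') (at x)" and v: "(v has_real_derivative v') (at x)"
  shows "(\<theta> has_real_derivative (u' * v x - u x * v') / ((u x)\<^sup>2 + (v x)\<^sup>2)) (at x)"
proof -
  define r where "r y = sqrt ((u y)\<^sup>2 + (v y)\<^sup>2)" for y
  have r: "0 < r y" "u y = r y * sin (\<theta> y)" "v y = r y * cos (\<theta> y)" for y
    using A unfolding is_angle_def r_def by auto
  let ?N = "\<lambda>y. u y * v x - v y * u x" and ?M = "\<lambda>y. u y * u x + v y * v x"
  have Mx: "?M x > 0" using A unfolding is_angle_def by (simp add: power2_eq_square)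
  have "(?N has_real_derivative u' * v x - v' * u x) (at x)"
    by (auto intro!: derivative_eq_intros u v)
  moreover have "(?M has_real_derivative u' * u x + v' * v x) (at x)"
    by (auto intro!: derivative_eq_intros u v)
  ultimately have q: "((\<lambda>y. ?N y / ?M y) has_real_derivative (u' * v x - v' * u x) / ?M x) (at x)"
    using Mx by (intro deriv_quot) auto
  have "((\<lambda>y. \<theta> x + arctan (?N y / ?M y)) has_real_derivative (u' * v x - v' * u x) / ?M x) (at x)"
    using DERIV_add[OF DERIV_const[of "\<theta> x"] DERIV_chain2[OF DERIV_arctan q]] by simp
  moreover have "\<forall>\<^sub>F y in nhds x. \<theta> x + arctan (?N y / ?M y) = \<theta> y"
  proof -
    have "isCont \<theta> x" using A unfolding is_angle_def by (simp add: continuous_on_eq_continuous_at)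
    then have "\<forall>\<^sub>F y in nhds x. dist (\<theta> y) (\<theta> x) < pi / 2"
      unfolding isCont_def tendsto_at_iff_tendsto_nhds by (rule tendstoD) simp
    then show ?thesis
    proof eventually_elim
      case (elim y)
      have ratio: "?N y / ?M y = tan (\<theta> y - \<theta> x)"
      proof -
        have "?N y = (r x * r y) * sin (\<theta> y - \<theta> x)"
          unfolding r(2,3)[of x] r(2,3)[of y] by (simp add: sin_diff algebra_simps)
        moreover have "?M y = (r x * r y) * cos (\<theta> y - \<theta> x)"
          unfolding r(2,3)[of x] r(2,3)[of y] by (simp add: cos_diff algebra_simps)
        ultimately show ?thesis using r(1)[of x] r(1)[of y] by (simp add: tan_def)
      qed
      have "arctan (tan (\<theta> y - \<theta> x)) = \<theta> y - \<theta> x"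
        using elim by (intro arctan_tan) (auto simp: dist_real_def abs_if split: if_splits)
      then show ?case unfolding ratio by simp
    qed
  qed
  ultimately have "(\<theta> has_real_derivative (u' * v x - v' * u x) / ?M x) (at x)"
    by (subst (asm) DERIV_cong_ev[OF refl _ refl, of _ \<theta>]) auto
  then show ?thesis by (simp add: power2_eq_square mult.commute)
qed

text \<open>Otherwise the constant Wronskians with the even and the odd solution vanish, and these are
\<open>sin \<alpha>\<close> and \<open>- cos \<alpha>\<close>.\<close>

lemma sol_nonzero: "sol \<alpha> e \<mu> x \<noteq> 0 \<or> dsol \<alpha> e \<mu> x \<noteq> 0"
proof (rule ccontr)
  assume "\<not> ?thesis"
  then have z: "sol \<alpha> e \<mu> x = 0" "dsol \<alpha> e \<mu> x = 0" by auto
  have "sol \<alpha> e \<mu> x * dsol \<beta> e \<mu> x - dsol \<alpha> e \<mu> x * sol \<beta> e \<mu> x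
      = sol \<alpha> e \<mu> 0 * dsol \<beta> e \<mu> 0 - dsol \<alpha> e \<mu> 0 * sol \<beta> e \<mu> 0" for \<beta>
  proof (rule DERIV_isconst_all[of "\<lambda>x. sol \<alpha> e \<mu> x * dsol \<beta> e \<mu> x - dsol \<alpha> e \<mu> x * sol \<beta> e \<mu> x"], intro allI)
    show "((\<lambda>x. sol \<alpha> e \<mu> x * dsol \<beta> e \<mu> x - dsol \<alpha> e \<mu> x * sol \<beta> e \<mu> x) has_real_derivative 0) (at x)" for x
      by (auto intro!: derivative_eq_intros sol_has_deriv dsol_has_deriv)
  qed
  from this[of 0] this[of "pi / 2"] have "sin \<alpha> = 0" "cos \<alpha> = 0" using z by auto
  then show False using sin_cos_squared_add[of \<alpha>] by simp
qed

lemma sin_cos_shift: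
  fixes a b t :: real
  assumes "sin a = sin b" "cos a = cos b"
  shows "sin (t - (a - b)) = sin t" "cos (t - (a - b)) = cos t"
proof -
  have "sin (a - b) = 0" unfolding sin_diff assms by (simp add: mult.commute)
  moreover have "cos (a - b) = 1"
    unfolding cos_diff assms using sin_cos_squared_add2[of b] by (simp add: power2_eq_square)
  ultimately show "sin (t - (a - b)) = sin t" "cos (t - (a - b)) = cos t"
    by (subst sin_diff cos_diff, simp)+
qed

text \<open>Continuity in all three variables at once is what later makes the set of energies that reach a given
angle open.\<close>

lemma ex_joint_angle:
  "\<exists>\<Theta>. continuous_on UNIV (\<lambda>(x, e, \<mu>). \<Theta> e \<mu> x) \<and>
     (\<forall>e \<mu>. \<Theta> e \<mu> 0 = \<alpha> \<and> is_angle (\<Theta> e \<mu>) (sol \<alpha> e \<mu>) (dsol \<alpha> e \<mu>))"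
proof -
  let ?u = "\<lambda>(x, e, \<mu>). sol \<alpha> e \<mu> x" and ?v = "\<lambda>(x, e, \<mu>). dsol \<alpha> e \<mu> x"
  obtain \<theta> where c: "continuous_on UNIV \<theta>"
    and t: "\<And>x e \<mu>. (sol \<alpha> e \<mu> x)\<^sup>2 + (dsol \<alpha> e \<mu> x)\<^sup>2 > 0
      \<and> sol \<alpha> e \<mu> x = sqrt ((sol \<alpha> e \<mu> x)\<^sup>2 + (dsol \<alpha> e \<mu> x)\<^sup>2) * sin (\<theta> (x, e, \<mu>))
      \<and> dsol \<alpha> e \<mu> x = sqrt ((sol \<alpha> e \<mu> x)\<^sup>2 + (dsol \<alpha> e \<mu> x)\<^sup>2) * cos (\<theta> (x, e, \<mu>))"
    using angle_lift[OF continuous_sol[of \<alpha>] continuous_dsol[of \<alpha>]] sol_nonzero by (auto simp: case_prod_unfold)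
  define \<Theta> where "\<Theta> e \<mu> x = \<theta> (x, e, \<mu>) - (\<theta> (0, e, \<mu>) - \<alpha>)" for e \<mu> x
  have c3: "continuous_on UNIV (\<lambda>(x, e, \<mu>). \<Theta> e \<mu> x)"
    unfolding \<Theta>_def case_prod_unfold
    by (intro continuous_intros continuous_on_compose2[OF c]) auto
  have "sin (\<theta> (0, e, \<mu>)) = sin \<alpha>" "cos (\<theta> (0, e, \<mu>)) = cos \<alpha>" for e \<mu>
    using t[of e \<mu> 0] by auto
  then have per: "sin (\<Theta> e \<mu> x) = sin (\<theta> (x, e, \<mu>))" "cos (\<Theta> e \<mu> x) = cos (\<theta> (x, e, \<mu>))" for e \<mu> x
    unfolding \<Theta>_def by (intro sin_cos_shift; simp)+
  have "continuous_on UNIV (\<Theta> e \<mu>)" for e \<mu>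
  proof -
    have "continuous_on UNIV (\<lambda>x::real. (x, e, \<mu>))" by (intro continuous_intros)
    from continuous_on_compose2[OF c3 this] show ?thesis by simp
  qed
  then have "is_angle (\<Theta> e \<mu>) (sol \<alpha> e \<mu>) (dsol \<alpha> e \<mu>)" for e \<mu>
    unfolding is_angle_def per using t by blast
  then show ?thesis using c3 by (intro exI[of _ \<Theta>]) (auto simp: \<Theta>_def)
qed

definition angle :: "real \<Rightarrow> real \<Rightarrow> real \<Rightarrow> real \<Rightarrow> real" where
  "angle \<alpha> = (SOME \<Theta>. continuous_on UNIV (\<lambda>(x, e, \<mu>). \<Theta> e \<mu> x) \<and>
     (\<forall>e \<mu>. \<Theta> e \<mu> 0 = \<alpha> \<and> is_angle (\<Theta> e \<mu>) (sol \<alpha> e \<mu>) (dsol \<alpha> e \<mu>)))"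

lemma continuous_angle: "continuous_on UNIV (\<lambda>(x, e, \<mu>). angle \<alpha> e \<mu> x)"
  and angle_0 [simp]: "angle \<alpha> e \<mu> 0 = \<alpha>"
  and is_angle_angle: "is_angle (angle \<alpha> e \<mu>) (sol \<alpha> e \<mu>) (dsol \<alpha> e \<mu>)"
  using someI_ex[OF ex_joint_angle[of \<alpha>]] unfolding angle_def by blast+

definition radius :: "real \<Rightarrow> real \<Rightarrow> real \<Rightarrow> real \<Rightarrow> real" where
  "radius \<alpha> e \<mu> x = sqrt ((sol \<alpha> e \<mu> x)\<^sup>2 + (dsol \<alpha> e \<mu> x)\<^sup>2)"

lemma radius_pos: "0 < radius \<alpha> e \<mu> x"
  and sol_angle: "sol \<alpha> e \<mu> x = radius \<alpha> e \<mu> x * sin (angle \<alpha> e \<mu> x)"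
  and dsol_angle: "dsol \<alpha> e \<mu> x = radius \<alpha> e \<mu> x * cos (angle \<alpha> e \<mu> x)"
  using is_angle_angle[of \<alpha> e \<mu>] unfolding is_angle_def radius_def by auto

text \<open>The Pruefer equation.  At a multiple of \<open>\<pi>\<close> the speed is \<open>1\<close>; at the odd multiples of \<open>\<pi> / 2\<close> it
is \<open>e - V\<close>.\<close>

lemma angle_deriv:
  "(angle \<alpha> e \<mu> has_real_derivative
     (cos (angle \<alpha> e \<mu> x))\<^sup>2 - (pot \<mu> x - e) * (sin (angle \<alpha> e \<mu> x))\<^sup>2) (at x)"
proof -
  let ?u = "sol \<alpha> e \<mu> x" and ?v = "dsol \<alpha> e \<mu> x"
  have D: "(angle \<alpha> e \<mu> has_real_derivative
      (?v * ?v - ?u * ((pot \<mu> x - e) * ?u)) / (?u\<^sup>2 + ?v\<^sup>2)) (at x)"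
    by (rule is_angle_deriv[OF is_angle_angle sol_has_deriv dsol_has_deriv])
  have "?u\<^sup>2 + ?v\<^sup>2 = (radius \<alpha> e \<mu> x)\<^sup>2" unfolding radius_def by simp
  then have "(?v * ?v - ?u * ((pot \<mu> x - e) * ?u)) / (?u\<^sup>2 + ?v\<^sup>2)
      = (cos (angle \<alpha> e \<mu> x))\<^sup>2 - (pot \<mu> x - e) * (sin (angle \<alpha> e \<mu> x))\<^sup>2"
    using radius_pos[of \<alpha> e \<mu> x] unfolding sol_angle dsol_angle
    by (simp add: field_simps power2_eq_square)
  with D show ?thesis by simp
qed

lemma isCont_angle: "isCont (angle \<alpha> e \<mu>) x"
  using angle_deriv DERIV_isCont by blast

lemma sin_sq_diff_le: "\<bar>(sin a)\<^sup>2 - (sin b)\<^sup>2\<bar> \<le> \<bar>a - b\<bar>" for a b :: real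
proof -
  have "(sin a)\<^sup>2 - (sin b)\<^sup>2 = sin (a - b) * sin (a + b)"
  proof -
    have "sin (a - b) * sin (a + b) = (sin a)\<^sup>2 * (cos b)\<^sup>2 - (cos a)\<^sup>2 * (sin b)\<^sup>2"
      by (simp add: sin_diff sin_add algebra_simps power2_eq_square)
    then show ?thesis by (simp add: cos_squared_eq algebra_simps)
  qed
  also have "\<bar>\<dots>\<bar> \<le> \<bar>a - b\<bar> * 1"
    unfolding abs_mult using abs_sin_x_le_abs_x by (intro mult_mono) auto
  finally show ?thesis by simp
qed

lemma sin_sq_le: "(sin x)\<^sup>2 \<le> \<bar>x\<bar>" for x :: real
proof -
  have "\<bar>sin x\<bar> * \<bar>sin x\<bar> \<le> 1 * \<bar>x\<bar>" by (intro mult_mono abs_sin_x_le_abs_x) auto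
  then show ?thesis by (simp add: power2_eq_square)
qed

lemma pot_bound: "\<exists>L\<ge>0. \<forall>x\<in>{a..b}. \<bar>pot \<mu> x - e\<bar> \<le> L"
proof -
  have "compact ((\<lambda>x. pot \<mu> x - e) ` {a..b})"
    unfolding pot_def by (intro compact_continuous_image continuous_intros) auto
  then obtain L where "\<forall>y\<in>(\<lambda>x. pot \<mu> x - e) ` {a..b}. norm y \<le> L"
    using compact_imp_bounded bounded_iff by metis
  then show ?thesis by (intro exI[of _ "max 0 L"]) auto
qed

lemma sin_npi_sq: "(sin (real k * pi - t))\<^sup>2 = (sin t)\<^sup>2" "(sin (t - real k * pi))\<^sup>2 = (sin t)\<^sup>2"
  by (cases "even k"; simp add: sin_diff)+

text \<open>Each zero of the solution makes the angle pass a multiple of \<open>\<pi>\<close> upwards.\<close>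

lemma angle_no_return:
  assumes "real k * pi \<le> angle \<alpha> e \<mu> a" "a \<le> b"
  shows "real k * pi \<le> angle \<alpha> e \<mu> b"
proof -
  obtain L where L: "0 \<le> L" "\<And>x. a \<le> x \<Longrightarrow> x \<le> b \<Longrightarrow> \<bar>pot \<mu> x - e\<bar> \<le> L"
    using pot_bound[of a b \<mu> e] by auto
  let ?d = "\<lambda>x. real k * pi - angle \<alpha> e \<mu> x"
  have "?d b \<le> 0"
  proof (rule barrier[OF assms(2), of ?d "\<lambda>x. - ((cos (angle \<alpha> e \<mu> x))\<^sup>2 - (pot \<mu> x - e) * (sin (angle \<alpha> e \<mu> x))\<^sup>2)" L])
    fix x assume x: "a \<le> x" "x \<le> b" "0 < ?d x"
    have s: "(sin (angle \<alpha> e \<mu> x))\<^sup>2 \<le> ?d x"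
      using sin_sq_le[of "?d x"] x(3) by (simp add: sin_npi_sq)
    have "(pot \<mu> x - e) * (sin (angle \<alpha> e \<mu> x))\<^sup>2 \<le> L * ?d x"
      using L(2)[OF x(1,2)] s L(1) by (intro mult_mono) auto
    then show "- ((cos (angle \<alpha> e \<mu> x))\<^sup>2 - (pot \<mu> x - e) * (sin (angle \<alpha> e \<mu> x))\<^sup>2) \<le> L * ?d x"
      by (smt (verit) zero_le_power2)
  qed (use assms(1) in \<open>auto intro!: derivative_eq_intros angle_deriv\<close>)
  then show ?thesis by simp
qed

text \<open>Sturm comparison: the right hand side of the Pruefer equation increases with the energy.\<close>

lemma angle_mono_e:
  assumes "e1 \<le> e2" "0 \<le> b"
  shows "angle \<alpha> e1 \<mu> b \<le> angle \<alpha> e2 \<mu> b"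
proof -
  obtain L where L: "0 \<le> L" "\<And>x. 0 \<le> x \<Longrightarrow> x \<le> b \<Longrightarrow> \<bar>pot \<mu> x - (e2 - 1)\<bar> \<le> L"
    using pot_bound[of 0 b \<mu> "e2 - 1"] by auto
  let ?d = "\<lambda>x. angle \<alpha> e1 \<mu> x - angle \<alpha> e2 \<mu> x"
  let ?f = "\<lambda>e x. (cos (angle \<alpha> e \<mu> x))\<^sup>2 - (pot \<mu> x - e) * (sin (angle \<alpha> e \<mu> x))\<^sup>2"
  have "?d b \<le> 0"
  proof (rule barrier[OF assms(2), of ?d "\<lambda>x. ?f e1 x - ?f e2 x" L])
    fix x assume x: "0 \<le> x" "x \<le> b" "0 < ?d x"
    let ?s = "angle \<alpha> e1 \<mu> x" and ?t = "angle \<alpha> e2 \<mu> x"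
    have "?f e1 x - ?f e2 x = (pot \<mu> x - (e2 - 1)) * ((sin ?t)\<^sup>2 - (sin ?s)\<^sup>2) - (e2 - e1) * (sin ?s)\<^sup>2"
      by (simp add: cos_squared_eq algebra_simps)
    also have "\<dots> \<le> (pot \<mu> x - (e2 - 1)) * ((sin ?t)\<^sup>2 - (sin ?s)\<^sup>2)"
      using assms(1) by simp
    also have "\<dots> \<le> \<bar>pot \<mu> x - (e2 - 1)\<bar> * \<bar>(sin ?t)\<^sup>2 - (sin ?s)\<^sup>2\<bar>"
      by (metis abs_ge_self abs_mult)
    also have "\<dots> \<le> L * ?d x"
      using L(2)[OF x(1,2)] L(1) sin_sq_diff_le[of ?t ?s] x(3) by (intro mult_mono) auto
    finally show "?f e1 x - ?f e2 x \<le> L * ?d x" .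
  qed (auto intro!: derivative_eq_intros angle_deriv)
  then show ?thesis by simp
qed

section \<open>Threshold energies\<close>

text \<open>Pairs of energy and parameter whose solution has at least \<open>k\<close> zeros on the half line, not
counting a zero at the origin.\<close>

definition reach :: "real \<Rightarrow> nat \<Rightarrow> (real \<times> real) set" where
  "reach \<alpha> k = {(e, \<mu>). \<exists>x\<ge>0. real k * pi < angle \<alpha> e \<mu> x}"

lemma open_reach: "open (reach \<alpha> k)"
proof -
  have "reach \<alpha> k = (\<Union>x\<in>{0..}. {p. real k * pi < angle \<alpha> (fst p) (snd p) x})"
    unfolding reach_def by auto
  moreover have "open {p. real k * pi < angle \<alpha> (fst p) (snd p) x}" for x
  proof -
    have "continuous_on UNIV (\<lambda>p. angle \<alpha> (fst p) (snd p) x)"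
    proof -
      have "continuous_on UNIV (\<lambda>p::real \<times> real. (x, p))" by (intro continuous_intros)
      from continuous_on_compose2[OF continuous_angle this] show ?thesis by (simp add: case_prod_unfold)
    qed
    then show ?thesis by (intro open_Collect_less continuous_intros)
  qed
  ultimately show ?thesis by auto
qed

lemma reach_up: "(e, \<mu>) \<in> reach \<alpha> k \<Longrightarrow> e \<le> e' \<Longrightarrow> (e', \<mu>) \<in> reach \<alpha> k"
  unfolding reach_def by (auto intro: less_le_trans angle_mono_e)

lemma pot_nonneg: "0 \<le> pot \<mu> x" unfolding pot_def by simp

text \<open>Where \<open>V \<ge> e\<close> the angle cannot pass the odd multiples of \<open>\<pi> / 2\<close> upwards.\<close>

lemma angle_trap:
  assumes "angle \<alpha> e \<mu> a \<le> (real k + 1 / 2) * pi" "a \<le> b" "\<And>x. a \<le> x \<Longrightarrow> x \<le> b \<Longrightarrow> e \<le> pot \<mu> x"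
  shows "angle \<alpha> e \<mu> b \<le> (real k + 1 / 2) * pi"
proof -
  let ?d = "\<lambda>x. angle \<alpha> e \<mu> x - (real k + 1 / 2) * pi"
  have "?d b \<le> 0"
  proof (rule barrier[OF assms(2), of ?d "\<lambda>x. (cos (angle \<alpha> e \<mu> x))\<^sup>2 - (pot \<mu> x - e) * (sin (angle \<alpha> e \<mu> x))\<^sup>2" 1])
    fix x assume x: "a \<le> x" "x \<le> b" "0 < ?d x"
    have "(cos (angle \<alpha> e \<mu> x))\<^sup>2 = (sin (?d x))\<^sup>2"
      by (cases "even k") (simp_all add: sin_diff sin_add cos_add distrib_right)
    also have "\<dots> \<le> ?d x" using sin_sq_le[of "?d x"] x(3) by simp
    finally have "(cos (angle \<alpha> e \<mu> x))\<^sup>2 \<le> ?d x" .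
    moreover have "0 \<le> (pot \<mu> x - e) * (sin (angle \<alpha> e \<mu> x))\<^sup>2" using assms(3)[OF x(1,2)] by simp
    ultimately show "(cos (angle \<alpha> e \<mu> x))\<^sup>2 - (pot \<mu> x - e) * (sin (angle \<alpha> e \<mu> x))\<^sup>2 \<le> 1 * ?d x" by simp
  qed (use assms(1) in \<open>auto intro!: derivative_eq_intros angle_deriv\<close>)
  then show ?thesis by simp
qed

lemma reach_pos:
  assumes "(e, \<mu>) \<in> reach \<alpha> k" "1 \<le> k" "\<alpha> \<le> pi / 2"
  shows "0 < e"
proof (rule ccontr)
  assume "\<not> 0 < e"
  then have e: "e \<le> pot \<mu> x" for x using pot_nonneg[of \<mu> x] by linarith
  obtain x where x: "0 \<le> x" "real k * pi < angle \<alpha> e \<mu> x" using assms(1) unfolding reach_def by auto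
  have "angle \<alpha> e \<mu> x \<le> (real 0 + 1 / 2) * pi"
    by (rule angle_trap[OF _ x(1) e]) (use assms in simp)
  then have "angle \<alpha> e \<mu> x \<le> pi / 2" by simp
  moreover have "1 * pi \<le> real k * pi" using assms(2) by (intro mult_right_mono) auto
  ultimately show False using x pi_gt_zero by linarith
qed

text \<open>An energy that exceeds the potential by \<open>1\<close> on a long interval rotates the angle with speed at
least \<open>1\<close>.\<close>

lemma reach_nonempty:
  assumes "0 \<le> \<alpha>" shows "\<exists>e. (e, \<mu>) \<in> reach \<alpha> k"
proof -
  define R where "R = (real k + 1) * pi"
  have R: "0 \<le> R" unfolding R_def by simp
  obtain L where L: "0 \<le> L" "\<And>x. 0 \<le> x \<Longrightarrow> x \<le> R \<Longrightarrow> \<bar>pot \<mu> x - 0\<bar> \<le> L"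
    using pot_bound[of 0 R \<mu> 0] by auto
  let ?e = "L + 1"
  have "angle \<alpha> ?e \<mu> 0 - 0 \<le> angle \<alpha> ?e \<mu> R - R"
  proof (rule DERIV_nonneg_imp_nondecreasing[OF R])
    fix x assume x: "0 \<le> x" "x \<le> R"
    have "1 * (sin (angle \<alpha> ?e \<mu> x))\<^sup>2 \<le> (?e - pot \<mu> x) * (sin (angle \<alpha> ?e \<mu> x))\<^sup>2"
      using L(2)[OF x] by (intro mult_right_mono) auto
    then have "0 \<le> (cos (angle \<alpha> ?e \<mu> x))\<^sup>2 - (pot \<mu> x - ?e) * (sin (angle \<alpha> ?e \<mu> x))\<^sup>2 - 1"
      by (simp add: cos_squared_eq algebra_simps)
    moreover have "((\<lambda>x. angle \<alpha> ?e \<mu> x - x) has_real_derivative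
      (cos (angle \<alpha> ?e \<mu> x))\<^sup>2 - (pot \<mu> x - ?e) * (sin (angle \<alpha> ?e \<mu> x))\<^sup>2 - 1) (at x)"
      by (auto intro!: derivative_eq_intros angle_deriv)
    ultimately show "\<exists>y. ((\<lambda>x. angle \<alpha> ?e \<mu> x - x) has_real_derivative y) (at x) \<and> 0 \<le> y" by blast
  qed
  then have "real k * pi < angle \<alpha> ?e \<mu> R"
    using assms pi_gt_zero unfolding R_def distrib_right mult_1 angle_0 by linarith
  then show ?thesis using R unfolding reach_def by auto
qed

definition level :: "real \<Rightarrow> nat \<Rightarrow> real \<Rightarrow> real" where
  "level \<alpha> k \<mu> = Inf {e. (e, \<mu>) \<in> reach \<alpha> k}"

text \<open>The set of energies is upward closed by Sturm comparison, and the infimum does not belong to it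
because it is open.\<close>

lemma reach_iff:
  assumes "0 \<le> \<alpha>" "\<alpha> \<le> pi / 2" "1 \<le> k"
  shows "(e, \<mu>) \<in> reach \<alpha> k \<longleftrightarrow> level \<alpha> k \<mu> < e"
proof -
  let ?S = "{e. (e, \<mu>) \<in> reach \<alpha> k}"
  have ne: "?S \<noteq> {}" using reach_nonempty[OF assms(1)] by auto
  have bdd: "bdd_below ?S" using reach_pos assms by (intro bdd_belowI[of _ 0]) force
  show ?thesis
  proof
    assume e: "(e, \<mu>) \<in> reach \<alpha> k"
    have "open ?S"
    proof -
      have "?S = (\<lambda>e. (e, \<mu>)) -` reach \<alpha> k" by auto
      moreover have "continuous_on UNIV (\<lambda>e. (e, \<mu>))" by (intro continuous_intros)
      ultimately show ?thesis using open_reach by (metis open_vimage)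
    qed
    then obtain d where d: "0 < d" "ball e d \<subseteq> ?S" using e by (metis mem_Collect_eq open_contains_ball)
    then have "e - d / 2 \<in> ?S" by (intro subsetD[OF d(2)]) (simp add: dist_real_def)
    then have "level \<alpha> k \<mu> \<le> e - d / 2" unfolding level_def using bdd by (intro cInf_lower)
    then show "level \<alpha> k \<mu> < e" using d by simp
  next
    assume "level \<alpha> k \<mu> < e"
    then obtain e' where "e' \<in> ?S" "e' < e" unfolding level_def using cInf_less_iff[OF ne bdd] by blast
    then show "(e, \<mu>) \<in> reach \<alpha> k" using reach_up[of e'] by simp
  qed
qed

lemma borel_level:
  assumes "0 \<le> \<alpha>" "\<alpha> \<le> pi / 2" "1 \<le> k"
  shows "level \<alpha> k \<in> borel_measurable borel"
proof (rule borel_measurableI_less)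
  fix y
  have "{\<mu> \<in> space borel. level \<alpha> k \<mu> < y} = (\<lambda>\<mu>. (y, \<mu>)) -` reach \<alpha> k"
    using reach_iff[OF assms] by auto
  moreover have "open \<dots>"
    using open_reach by (rule open_vimage) (intro continuous_intros)
  ultimately show "{\<mu> \<in> space borel. level \<alpha> k \<mu> < y} \<in> sets borel" by simp
qed

section \<open>Decaying solutions and their energies\<close>

text \<open>Beyond \<open>R\<close> lies the classically forbidden region, where the potential exceeds the energy.\<close>

definition forbidden :: "real \<Rightarrow> real \<Rightarrow> real \<Rightarrow> bool" where
  "forbidden e \<mu> R \<longleftrightarrow> 0 \<le> R \<and> (\<forall>x\<ge>R. e + 1 \<le> pot \<mu> x)"

lemma ex_forbidden: "\<exists>R. forbidden e \<mu> R"
proof -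
  define s where "s = 1 + \<bar>\<mu>\<bar> + \<bar>e\<bar>"
  have s: "1 \<le> s" unfolding s_def by simp
  have "e + 1 \<le> pot \<mu> x" if "2 * s \<le> x" for x
  proof -
    have "(2 * s) * 2 \<le> x * x" using that s by (intro mult_mono) auto
    then have "1 + \<bar>e\<bar> \<le> x\<^sup>2 / 2 - \<mu>" unfolding power2_eq_square s_def by (simp add: algebra_simps)
    then have "(1 + \<bar>e\<bar>) * 1 \<le> (x\<^sup>2 / 2 - \<mu>) * (x\<^sup>2 / 2 - \<mu>)" by (intro mult_mono) auto
    then have "1 + \<bar>e\<bar> \<le> (x\<^sup>2 / 2 - \<mu>) * (x\<^sup>2 / 2 - \<mu>)" by simp
    then show ?thesis unfolding pot_def power2_eq_square[of "x\<^sup>2 / 2 - \<mu>"]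
      using abs_ge_self[of e] by linarith
  qed
  then show ?thesis using s unfolding forbidden_def by (intro exI[of _ "2 * s"]) auto
qed

text \<open>The angle finally stays where \<open>u u' < 0\<close>, in the sector that belongs to the \<open>k\<close>-th level.\<close>

definition sector :: "real \<Rightarrow> nat \<Rightarrow> real \<Rightarrow> real \<Rightarrow> bool" where
  "sector \<alpha> k e \<mu> \<longleftrightarrow> (\<exists>R. forbidden e \<mu> R \<and>
     (\<forall>x\<ge>R. (real k - 1 / 2) * pi < angle \<alpha> e \<mu> x \<and> angle \<alpha> e \<mu> x < real k * pi))"

text \<open>At the threshold energy the angle never gets to \<open>k \<pi>\<close>.  If it fell below \<open>(k - 1/2) \<pi>\<close> in the
forbidden region, it would do so for slightly larger energies as well and be trapped there, yet
those energies reach \<open>k \<pi>\<close>.\<close>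

lemma level_sector:
  assumes a: "0 \<le> \<alpha>" "\<alpha> \<le> pi / 2" and k: "1 \<le> k"
  shows "sector \<alpha> k (level \<alpha> k \<mu>) \<mu>"
proof -
  define e0 where "e0 = level \<alpha> k \<mu>"
  note riff = reach_iff[OF a k, of _ \<mu>, folded e0_def]
  have e0: "(e0, \<mu>) \<notin> reach \<alpha> k" using riff by simp
  obtain R where R: "forbidden (e0 + 1) \<mu> R" using ex_forbidden by blast
  have forbidden: "forbidden e0 \<mu> R" using R unfolding forbidden_def by force
  have le: "angle \<alpha> e0 \<mu> x \<le> real k * pi" if "0 \<le> x" for x
    using e0 that unfolding reach_def by force
  have lt: "angle \<alpha> e0 \<mu> x < real k * pi" if "0 \<le> x" for x
  proof (rule ccontr)
    assume "\<not> ?thesis"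
    then have eq: "angle \<alpha> e0 \<mu> x = real k * pi" using le[OF that] by simp
    have "(angle \<alpha> e0 \<mu> has_real_derivative 1) (at x)"
      using angle_deriv[of \<alpha> e0 \<mu> x] unfolding eq by (cases "even k") simp_all
    from DERIV_pos_inc_right[OF this]
    obtain d where d: "0 < d" "\<And>h. 0 < h \<Longrightarrow> h < d \<Longrightarrow> angle \<alpha> e0 \<mu> x < angle \<alpha> e0 \<mu> (x + h)" by auto
    have "angle \<alpha> e0 \<mu> x < angle \<alpha> e0 \<mu> (x + d / 2)" using d by (intro d(2)) auto
    then show False using le[of "x + d / 2"] eq that d by auto
  qed
  have k1: "real (k - 1) + 1 / 2 = real k - 1 / 2" using k by simp
  have no: "\<not> angle \<alpha> e0 \<mu> x1 < (real k - 1 / 2) * pi" if x1: "R \<le> x1" for x1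
  proof
    assume less: "angle \<alpha> e0 \<mu> x1 < (real k - 1 / 2) * pi"
    have "continuous_on UNIV (\<lambda>e::real. (x1, e, \<mu>))" by (intro continuous_intros)
    from continuous_on_compose2[OF continuous_angle this]
    have "continuous_on UNIV (\<lambda>e. angle \<alpha> e \<mu> x1)" by simp
    then have "open {e. angle \<alpha> e \<mu> x1 < (real k - 1 / 2) * pi}" by (intro open_Collect_less continuous_intros)
    then obtain d where d: "0 < d" "ball e0 d \<subseteq> {e. angle \<alpha> e \<mu> x1 < (real k - 1 / 2) * pi}"
      using less by (metis mem_Collect_eq open_contains_ball)
    \<comment> \<open>Above the threshold, but still within reach of the continuity and of the choice of \<open>R\<close>.\<close>
    define e where "e = e0 + min 1 (d / 2)"
    have e: "e0 < e" "e \<le> e0 + 1" "e \<in> ball e0 d" using d unfolding e_def by (auto simp: dist_real_def)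
    have e1: "angle \<alpha> e \<mu> x1 < (real k - 1 / 2) * pi" using e(3) d(2) by auto
    have "(e, \<mu>) \<in> reach \<alpha> k" using riff e by simp
    then obtain x where x: "0 \<le> x" "real k * pi < angle \<alpha> e \<mu> x" unfolding reach_def by auto
    have kk: "(real k - 1 / 2) * pi < real k * pi" by simp
    show False
    proof (cases "x \<le> x1")
      case True
      from angle_no_return[OF less_imp_le[OF x(2)] this] show False using e1 kk by linarith
    next
      case False
      have "angle \<alpha> e \<mu> x \<le> (real (k - 1) + 1 / 2) * pi"
      proof (rule angle_trap[of \<alpha> e \<mu> x1 "k - 1" x])
        fix y assume "x1 \<le> y" "y \<le> x"
        then have "e0 + 1 + 1 \<le> pot \<mu> y" using R x1 unfolding forbidden_def by auto
        then show "e \<le> pot \<mu> y" using e by linarith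
      qed (use e1 False k1 in auto)
      then show False using x(2) kk unfolding k1 by linarith
    qed
  qed
  have gt: "(real k - 1 / 2) * pi < angle \<alpha> e0 \<mu> x" if x: "R \<le> x" for x
  proof (rule ccontr)
    assume "\<not> ?thesis"
    then have eq: "angle \<alpha> e0 \<mu> x = (real k - 1 / 2) * pi" using no[OF x] by simp
    have "cos ((real k - 1 / 2) * pi) = 0" by (simp add: left_diff_distrib cos_diff)
    then have "(angle \<alpha> e0 \<mu> has_real_derivative - (pot \<mu> x - e0)) (at x)"
      using angle_deriv[of \<alpha> e0 \<mu> x] unfolding eq by (simp add: sin_squared_eq)
    moreover have "- (pot \<mu> x - e0) < 0" using forbidden x unfolding forbidden_def by force
    ultimately obtain d where d: "0 < d" "\<And>h. 0 < h \<Longrightarrow> h < d \<Longrightarrow> angle \<alpha> e0 \<mu> (x + h) < angle \<alpha> e0 \<mu> x"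
      using DERIV_neg_dec_right by blast
    have "angle \<alpha> e0 \<mu> (x + d / 2) < angle \<alpha> e0 \<mu> x" using d by (intro d(2)) auto
    then show False using no[of "x + d / 2"] eq x d by auto
  qed
  show ?thesis unfolding sector_def e0_def[symmetric]
    using forbidden gt lt unfolding forbidden_def by (intro exI[of _ R]) auto
qed

text \<open>Written this way the sign condition \<open>u u' < 0\<close> singles out the sectors between \<open>(k - 1/2) \<pi>\<close> and
\<open>k \<pi>\<close>, for any \<open>k\<close>.\<close>

lemma sin_cos_neg_iff:
  "sin t * cos t < 0 \<longleftrightarrow> sin (2 * (real k * pi - t)) > 0" for t :: real
proof -
  have "sin (2 * (real k * pi - t)) = sin (real (2 * k) * pi - 2 * t)" by (simp add: algebra_simps)
  also have "\<dots> = - sin (2 * t)" unfolding sin_diff sin_npi cos_npi by simp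
  also have "sin (2 * t) = 2 * (sin t * cos t)" by (simp add: sin_double)
  finally have eq: "sin (2 * (real k * pi - t)) = - (2 * (sin t * cos t))" .
  show ?thesis unfolding eq by linarith
qed

lemma sol_mult_angle: "sol \<alpha> e \<mu> x * dsol \<alpha> e \<mu> x = (radius \<alpha> e \<mu> x)\<^sup>2 * (sin (angle \<alpha> e \<mu> x) * cos (angle \<alpha> e \<mu> x))"
  by (simp add: sol_angle dsol_angle power2_eq_square)

lemma sol_mult_neg: "sol \<alpha> e \<mu> x * dsol \<alpha> e \<mu> x < 0 \<longleftrightarrow> sin (angle \<alpha> e \<mu> x) * cos (angle \<alpha> e \<mu> x) < 0"
  unfolding sol_mult_angle using radius_pos[of \<alpha> e \<mu> x] by (simp add: mult_less_0_iff)

lemma sector_neg: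
  assumes "(real k - 1 / 2) * pi < angle \<alpha> e \<mu> x" "angle \<alpha> e \<mu> x < real k * pi"
  shows "sol \<alpha> e \<mu> x * dsol \<alpha> e \<mu> x < 0"
  unfolding sol_mult_neg sin_cos_neg_iff[of _ k] using assms
  by (intro sin_gt_zero) (auto simp: algebra_simps)

lemma continuous_on_sol: "continuous_on A (sol \<alpha> e \<mu>)"
  by (rule DERIV_continuous_on[OF has_field_derivative_at_within[OF sol_has_deriv]])

lemma continuous_on_dsol: "continuous_on A (dsol \<alpha> e \<mu>)"
  by (rule DERIV_continuous_on[OF has_field_derivative_at_within[OF dsol_has_deriv]])

lemma borel_sol [measurable]: "sol \<alpha> e \<mu> \<in> borel_measurable borel"
  by (intro borel_measurable_continuous_onI continuous_on_sol)

lemma borel_dsol [measurable]: "dsol \<alpha> e \<mu> \<in> borel_measurable borel"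
  by (intro borel_measurable_continuous_onI continuous_on_dsol)

lemma borel_pot [measurable]: "pot \<mu> \<in> borel_measurable borel"
  unfolding pot_def[abs_def] by measurable

text \<open>In the forbidden region this derivative dominates \<open>u\<^sup>2 + u'\<^sup>2\<close>; this drives the dichotomy between
decay and growth.\<close>

lemma sol_mult_dsol_deriv:
  "((\<lambda>x. sol \<alpha> e \<mu> x * dsol \<alpha> e \<mu> x) has_real_derivative
      (dsol \<alpha> e \<mu> x)\<^sup>2 + (pot \<mu> x - e) * (sol \<alpha> e \<mu> x)\<^sup>2) (at x)"
  by (auto intro!: derivative_eq_intros sol_has_deriv dsol_has_deriv simp: power2_eq_square)

lemma energy_lower:
  assumes "forbidden e \<mu> R" "R \<le> x"
  shows "(sol \<alpha> e \<mu> x)\<^sup>2 + (dsol \<alpha> e \<mu> x)\<^sup>2 \<le> (dsol \<alpha> e \<mu> x)\<^sup>2 + (pot \<mu> x - e) * (sol \<alpha> e \<mu> x)\<^sup>2"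
proof -
  have "1 * (sol \<alpha> e \<mu> x)\<^sup>2 \<le> (pot \<mu> x - e) * (sol \<alpha> e \<mu> x)\<^sup>2"
    using assms unfolding forbidden_def by (intro mult_right_mono) force+
  then show ?thesis by simp
qed

lemma abs_mult_le_squares: "\<bar>a * b\<bar> \<le> a\<^sup>2 + b\<^sup>2" for a b :: real
proof -
  have "0 \<le> \<bar>a\<bar> * \<bar>b\<bar>" by simp
  moreover have "2 * (\<bar>a\<bar> * \<bar>b\<bar>) \<le> a\<^sup>2 + b\<^sup>2"
    using sum_squares_bound[of "\<bar>a\<bar>" "\<bar>b\<bar>"] by simp
  ultimately show ?thesis unfolding abs_mult by linarith
qed

text \<open>As long as \<open>u u' < 0\<close>, the sum \<open>h = u\<^sup>2 + u'\<^sup>2\<close> decreases, and the integral of \<open>h\<close> is bounded by the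
total increase of \<open>u u' \<le> 0\<close>.  A decreasing integrable function tends to \<open>0\<close>.\<close>

lemma decay:
  assumes forbidden: "forbidden e \<mu> R" and neg: "\<And>x. R \<le> x \<Longrightarrow> sol \<alpha> e \<mu> x * dsol \<alpha> e \<mu> x < 0"
  shows "((\<lambda>x. (sol \<alpha> e \<mu> x)\<^sup>2 + (dsol \<alpha> e \<mu> x)\<^sup>2) \<longlongrightarrow> 0) at_top"
    and "(\<integral>\<^sup>+x. ennreal ((sol \<alpha> e \<mu> x)\<^sup>2) * indicator {0..} x \<partial>lborel) < \<infinity>"
proof -
  let ?u = "sol \<alpha> e \<mu>" and ?v = "dsol \<alpha> e \<mu>"
  let ?h = "\<lambda>x. (?u x)\<^sup>2 + (?v x)\<^sup>2" and ?F = "\<lambda>x. ?u x * ?v x"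
  let ?f = "\<lambda>x. (?v x)\<^sup>2 + (pot \<mu> x - e) * (?u x)\<^sup>2"
  have h_anti: "?h x \<le> ?h y" if "R \<le> y" "y \<le> x" for x y
  proof (rule DERIV_nonpos_imp_nonincreasing[OF that(2)])
    fix t assume t: "y \<le> t" "t \<le> x"
    have "(?h has_real_derivative 2 * (1 + (pot \<mu> t - e)) * ?F t) (at t)"
      by (auto intro!: derivative_eq_intros sol_has_deriv dsol_has_deriv simp: algebra_simps)
    moreover have "0 \<le> 2 * (1 + (pot \<mu> t - e))" 
    proof -
      have "e + 1 \<le> pot \<mu> t" using forbidden that t unfolding forbidden_def by auto
      then show ?thesis by simp
    qed
    then have "2 * (1 + (pot \<mu> t - e)) * ?F t \<le> 0"
      using neg[of t] that t by (intro mult_nonneg_nonpos[of _ "?F t"]) auto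
    ultimately show "\<exists>d. (?h has_real_derivative d) (at t) \<and> d \<le> 0" by blast
  qed
  have hb: "?h x \<le> - ?F R / (x - R)" if x: "R < x" for x
  proof -
    \<comment> \<open>On the way from \<open>R\<close> to \<open>x\<close> the derivative of \<open>u u'\<close> is at least \<open>h x\<close>.\<close>
    have "?F R - ?h x * R \<le> ?F x - ?h x * x"
    proof (rule DERIV_nonneg_imp_nondecreasing[of R x "\<lambda>t. ?F t - ?h x * t"])
      fix t assume t: "R \<le> t" "t \<le> x"
      have "((\<lambda>t. ?F t - ?h x * t) has_real_derivative ?f t - ?h x) (at t)"
        by (auto intro!: derivative_eq_intros sol_has_deriv dsol_has_deriv simp: power2_eq_square)
      moreover have "0 \<le> ?f t - ?h x"
        using energy_lower[OF forbidden t(1), of \<alpha>] h_anti[OF t] by linarith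
      ultimately show "\<exists>y. ((\<lambda>t. ?F t - ?h x * t) has_real_derivative y) (at t) \<and> 0 \<le> y" by blast
    qed (use x in simp)
    then have "?h x * (x - R) \<le> - ?F R" using neg[of x] x by (simp add: algebra_simps)
    then show ?thesis using x by (subst pos_le_divide_eq) auto
  qed
  have "((\<lambda>x. - ?F R / (x - R)) \<longlongrightarrow> 0) at_top"
    by (intro tendsto_divide_0[OF tendsto_const] filterlim_at_top_imp_at_infinity
        filterlim_tendsto_add_at_top[of "\<lambda>_. - R" "- R" at_top "\<lambda>x. x", simplified] filterlim_ident)
  then show h0: "(?h \<longlongrightarrow> 0) at_top"
  proof (rule tendsto_sandwich[rotated 2, OF tendsto_const])
    show "\<forall>\<^sub>F x in at_top. ?h x \<le> - ?F R / (x - R)"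
      using eventually_gt_at_top[of R] by eventually_elim (rule hb)
  qed auto
  have F0: "(?F \<longlongrightarrow> 0) at_top"
  proof (rule Lim_null_comparison[OF _ h0])
    show "\<forall>\<^sub>F x in at_top. norm (?F x) \<le> ?h x"
      using abs_mult_le_squares by simp
  qed
  have tail: "(\<integral>\<^sup>+x. ennreal (?f x) * indicator {R..} x \<partial>lborel) = ennreal (0 - ?F R)"
  proof (rule nn_integral_FTC_atLeast[OF _ sol_mult_dsol_deriv _ F0])
    show "0 \<le> ?f x" if "R \<le> x" for x using energy_lower[OF forbidden that, of \<alpha>] by (smt (verit) zero_le_power2)
  qed measurable
  have "compact (?u ` {0..R})" by (intro compact_continuous_image continuous_on_sol) auto
  then obtain B where B: "\<And>x. 0 \<le> x \<Longrightarrow> x \<le> R \<Longrightarrow> \<bar>?u x\<bar> \<le> B"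
    using compact_imp_bounded bounded_iff by (metis atLeastAtMost_iff image_eqI real_norm_def)
  have "(\<integral>\<^sup>+x. ennreal ((?u x)\<^sup>2) * indicator {0..} x \<partial>lborel)
     \<le> (\<integral>\<^sup>+x. ennreal (B\<^sup>2) * indicator {0..R} x + ennreal (?f x) * indicator {R..} x \<partial>lborel)"
  proof (intro nn_integral_mono)
    fix x
    show "ennreal ((?u x)\<^sup>2) * indicator {0..} x \<le> ennreal (B\<^sup>2) * indicator {0..R} x + ennreal (?f x) * indicator {R..} x"
    proof (cases "R \<le> x")
      case True
      then have "ennreal ((?u x)\<^sup>2) \<le> ennreal (?f x)"
        using energy_lower[OF forbidden True, of \<alpha>] by (intro ennreal_leI) (smt (verit) zero_le_power2)
      then show ?thesis using True by (auto split: split_indicator intro: add_increasing)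
    next
      case False
      have "ennreal ((?u x)\<^sup>2) \<le> ennreal (B\<^sup>2)" if "0 \<le> x"
        using B[OF that] False by (intro ennreal_leI) (metis abs_ge_zero linear not_le power2_abs power_mono)
      then show ?thesis using False by (auto split: split_indicator)
    qed
  qed
  also have "\<dots> = (\<integral>\<^sup>+x. ennreal (B\<^sup>2) * indicator {0..R} x \<partial>lborel) + ennreal (0 - ?F R)"
    by (subst nn_integral_add) (auto simp: tail)
  also have "\<dots> < \<infinity>"
    using forbidden by (auto simp: nn_integral_cmult_indicator ennreal_mult_less_top forbidden_def)
  finally show "(\<integral>\<^sup>+x. ennreal ((?u x)\<^sup>2) * indicator {0..} x \<partial>lborel) < \<infinity>" .
qed

lemma sector_decay:
  assumes "sector \<alpha> k e \<mu>"
  shows "((\<lambda>x. (sol \<alpha> e \<mu> x)\<^sup>2 + (dsol \<alpha> e \<mu> x)\<^sup>2) \<longlongrightarrow> 0) at_top"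
    and "(\<integral>\<^sup>+x. ennreal ((sol \<alpha> e \<mu> x)\<^sup>2) * indicator {0..} x \<partial>lborel) < \<infinity>"
  using assms decay sector_neg unfolding sector_def by meson+

lemma wronskian_tendsto_0:
  assumes "sector \<alpha> k e \<mu>" "sector \<beta> l e' \<mu>"
  shows "((\<lambda>x. sol \<alpha> e \<mu> x * dsol \<beta> e' \<mu> x - dsol \<alpha> e \<mu> x * sol \<beta> e' \<mu> x) \<longlongrightarrow> 0) at_top"
proof (rule Lim_null_comparison)
  let ?a = "sol \<alpha> e \<mu>" and ?b = "dsol \<alpha> e \<mu>" and ?c = "sol \<beta> e' \<mu>" and ?d = "dsol \<beta> e' \<mu>"
  show "((\<lambda>x. ((?a x)\<^sup>2 + (?b x)\<^sup>2) + ((?c x)\<^sup>2 + (?d x)\<^sup>2)) \<longlongrightarrow> 0) at_top"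
    using tendsto_add[OF sector_decay(1)[OF assms(1)] sector_decay(1)[OF assms(2)]] by simp
  have "\<bar>a * d - b * c\<bar> \<le> (a\<^sup>2 + b\<^sup>2) + (c\<^sup>2 + d\<^sup>2)" for a b c d :: real
    using abs_triangle_ineq4[of "a * d" "b * c"] abs_mult_le_squares[of a d] abs_mult_le_squares[of b c]
    by linarith
  then show "\<forall>\<^sub>F x in at_top. norm (?a x * ?d x - ?b x * ?c x) \<le> ((?a x)\<^sup>2 + (?b x)\<^sup>2) + ((?c x)\<^sup>2 + (?d x)\<^sup>2)"
    by simp
qed

lemma wronskian_deriv:
  "((\<lambda>x. sol \<alpha> e \<mu> x * dsol \<beta> e' \<mu> x - dsol \<alpha> e \<mu> x * sol \<beta> e' \<mu> x)
     has_real_derivative (e - e') * (sol \<alpha> e \<mu> x * sol \<beta> e' \<mu> x)) (at x)"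
  by (auto intro!: derivative_eq_intros sol_has_deriv dsol_has_deriv simp: algebra_simps)

lemma wronskian_angle:
  "sol \<alpha> e \<mu> x * dsol \<beta> e' \<mu> x - dsol \<alpha> e \<mu> x * sol \<beta> e' \<mu> x
     = radius \<alpha> e \<mu> x * radius \<beta> e' \<mu> x * sin (angle \<alpha> e \<mu> x - angle \<beta> e' \<mu> x)"
  by (simp add: sol_angle dsol_angle sin_diff algebra_simps)

text \<open>Of two different energies in the same sector, the larger has the larger angle, so the Wronskian of
the two solutions is at most \<open>0\<close> far out.  But it is strictly decreasing there, since both solutions
have the same sign, and it tends to \<open>0\<close>, so it is positive.\<close>

lemma sector_unique:
  assumes a: "0 \<le> \<alpha>" "\<alpha> \<le> pi / 2" and k: "1 \<le> k" and s: "sector \<alpha> k e \<mu>"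
  shows "e = level \<alpha> k \<mu>"
proof -
  obtain R where R: "forbidden e \<mu> R" "\<And>x. R \<le> x \<Longrightarrow> (real k - 1 / 2) * pi < angle \<alpha> e \<mu> x"
      "\<And>x. R \<le> x \<Longrightarrow> angle \<alpha> e \<mu> x < real k * pi"
    using s unfolding sector_def by auto
  have "(e, \<mu>) \<notin> reach \<alpha> k"
  proof
    assume "(e, \<mu>) \<in> reach \<alpha> k"
    then obtain x where x: "0 \<le> x" "real k * pi < angle \<alpha> e \<mu> x" unfolding reach_def by auto
    have "real k * pi \<le> angle \<alpha> e \<mu> (max x R)" by (rule angle_no_return[of k \<alpha> e \<mu> x]) (use x in auto)
    then show False using R(3)[of "max x R"] by auto
  qed
  then have le: "e \<le> level \<alpha> k \<mu>" using reach_iff[OF a k] by force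
  moreover have "\<not> e < level \<alpha> k \<mu>"
  proof
    define e' where "e' = level \<alpha> k \<mu>"
    assume "e < level \<alpha> k \<mu>"
    then have ee: "e < e'" unfolding e'_def .
    have s': "sector \<alpha> k e' \<mu>" unfolding e'_def by (rule level_sector[OF a k])
    then obtain R' where R': "forbidden e' \<mu> R'" "\<And>x. R' \<le> x \<Longrightarrow> (real k - 1 / 2) * pi < angle \<alpha> e' \<mu> x"
      "\<And>x. R' \<le> x \<Longrightarrow> angle \<alpha> e' \<mu> x < real k * pi"
      unfolding sector_def by auto
    define T where "T = max R R'"
    have T: "R \<le> T" "R' \<le> T" "0 \<le> T" using R(1) unfolding T_def forbidden_def by auto
    let ?W = "\<lambda>x. sol \<alpha> e \<mu> x * dsol \<alpha> e' \<mu> x - dsol \<alpha> e \<mu> x * sol \<alpha> e' \<mu> x"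
    have W': "(e - e') * (sol \<alpha> e \<mu> x * sol \<alpha> e' \<mu> x) < 0" if x: "T \<le> x" for x
    proof -
      have s1: "0 < sin (real k * pi - angle \<alpha> e \<mu> x)" "0 < sin (real k * pi - angle \<alpha> e' \<mu> x)"
        using R(2,3)[of x] R'(2,3)[of x] x T by (auto intro!: sin_gt_zero simp: algebra_simps)
      have "sin (real k * pi - angle \<alpha> e \<mu> x) * sin (real k * pi - angle \<alpha> e' \<mu> x)
          = sin (angle \<alpha> e \<mu> x) * sin (angle \<alpha> e' \<mu> x)"
        by (cases "even k") (simp_all add: sin_diff)
      then have "0 < sin (angle \<alpha> e \<mu> x) * sin (angle \<alpha> e' \<mu> x)" using s1 by (metis mult_pos_pos)
      then have "0 < sol \<alpha> e \<mu> x * sol \<alpha> e' \<mu> x"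
        using mult_pos_pos[OF mult_pos_pos[OF radius_pos[of \<alpha> e \<mu> x] radius_pos[of \<alpha> e' \<mu> x]], of "sin (angle \<alpha> e \<mu> x) * sin (angle \<alpha> e' \<mu> x)"]
        unfolding sol_angle by (simp add: mult_ac)
      then show ?thesis using ee by (simp add: mult_neg_pos)
    qed
    have dec: "?W y < ?W x" if "T \<le> x" "x < y" for x y
      using that W' wronskian_deriv by (intro DERIV_neg_imp_decreasing[OF that(2)]) force
    have "0 \<le> ?W (T + 1)"
    proof (rule tendsto_upperbound[OF wronskian_tendsto_0[OF s s']])
      show "\<forall>\<^sub>F x in at_top. ?W x \<le> ?W (T + 1)"
        using eventually_gt_at_top[of "T + 1"] by eventually_elim (rule less_imp_le, rule dec, auto)
    qed simp
    moreover have "?W (T + 1) < ?W T" by (rule dec) auto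
    moreover have "?W T \<le> 0"
    proof -
      have "angle \<alpha> e \<mu> T \<le> angle \<alpha> e' \<mu> T" by (rule angle_mono_e) (use ee T in auto)
      moreover have "angle \<alpha> e' \<mu> T - angle \<alpha> e \<mu> T \<le> pi"
        using R(2)[of T] R'(3)[of T] T pi_gt_zero unfolding left_diff_distrib by linarith
      ultimately have "0 \<le> sin (angle \<alpha> e' \<mu> T - angle \<alpha> e \<mu> T)" by (intro sin_ge_zero) auto
      then have "sin (angle \<alpha> e \<mu> T - angle \<alpha> e' \<mu> T) \<le> 0" by (simp add: sin_diff mult.commute)
      then show ?thesis unfolding wronskian_angle
        using radius_pos[of \<alpha> e \<mu> T] radius_pos[of \<alpha> e' \<mu> T] by (intro mult_nonneg_nonpos) auto
    qed
    ultimately show False by linarith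
  qed
  ultimately show ?thesis by simp
qed

lemma emeasure_lborel_atLeast: "emeasure lborel {a::real..} = \<infinity>"
proof (rule ccontr)
  assume "\<not> ?thesis"
  then obtain r where r: "0 \<le> r" "emeasure lborel {a..} = ennreal r"
    by (cases "emeasure lborel {a..}") auto
  have "ennreal (r + 1) = emeasure lborel {a..a + (r + 1)}" using r by simp
  also have "\<dots> \<le> emeasure lborel {a..}" by (intro emeasure_mono) auto
  also have "\<dots> = ennreal r" by (rule r)
  finally show False using r by (simp add: ennreal_le_iff)
qed

text \<open>Once \<open>u u'\<close> is nonnegative in the forbidden region it becomes positive and \<open>u\<^sup>2\<close> stays above a
positive constant.\<close>

lemma growth:
  assumes forbidden: "forbidden e \<mu> R" and x1: "R \<le> x1" "0 \<le> sol \<alpha> e \<mu> x1 * dsol \<alpha> e \<mu> x1"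
  shows "(\<integral>\<^sup>+x. ennreal ((sol \<alpha> e \<mu> x)\<^sup>2) * indicator {0..} x \<partial>lborel) = \<infinity>"
proof -
  let ?u = "sol \<alpha> e \<mu>" and ?v = "dsol \<alpha> e \<mu>"
  let ?F = "\<lambda>x. ?u x * ?v x"
  have F: "0 < ?F x" if x: "x1 < x" for x
  proof -
    have "?F x1 < ?F x"
    proof (rule DERIV_pos_imp_increasing[OF x])
      fix t assume "x1 \<le> t" "t \<le> x"
      moreover have "0 < (?u t)\<^sup>2 + (?v t)\<^sup>2" using sol_nonzero[of \<alpha> e \<mu> t] by (auto simp: sum_power2_gt_zero_iff)
      ultimately have "0 < (?v t)\<^sup>2 + (pot \<mu> t - e) * (?u t)\<^sup>2"
        using energy_lower[OF forbidden, of t \<alpha>] x1 by force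
      then show "\<exists>y. (?F has_real_derivative y) (at t) \<and> 0 < y" using sol_mult_dsol_deriv by blast
    qed
    then show ?thesis using x1 by simp
  qed
  define c where "c = (?u (x1 + 1))\<^sup>2"
  have "?u (x1 + 1) \<noteq> 0" using F[of "x1 + 1"] by auto
  then have c: "0 < c" unfolding c_def by simp
  have mono: "c \<le> (?u x)\<^sup>2" if "x1 + 1 \<le> x" for x
    unfolding c_def
  proof (rule DERIV_nonneg_imp_nondecreasing[OF that])
    fix t assume t: "x1 + 1 \<le> t" "t \<le> x"
    have "((\<lambda>x. (?u x)\<^sup>2) has_real_derivative 2 * ?F t) (at t)"
      by (auto intro!: derivative_eq_intros sol_has_deriv)
    then show "\<exists>y. ((\<lambda>x. (?u x)\<^sup>2) has_real_derivative y) (at t) \<and> 0 \<le> y"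
      using F[of t] t by force
  qed
  have "\<infinity> = ennreal c * emeasure lborel {x1 + 1..}"
    using c by (simp add: ennreal_mult_top emeasure_lborel_atLeast)
  also have "\<dots> = (\<integral>\<^sup>+x. ennreal c * indicator {x1 + 1..} x \<partial>lborel)"
    by (simp add: nn_integral_cmult_indicator)
  also have "\<dots> \<le> (\<integral>\<^sup>+x. ennreal ((?u x)\<^sup>2) * indicator {0..} x \<partial>lborel)"
    using mono forbidden x1 by (intro nn_integral_mono) (auto split: split_indicator simp: forbidden_def intro!: ennreal_leI)
  finally show ?thesis by (simp add: top_unique)
qed

text \<open>A square integrable solution satisfies \<open>u u' < 0\<close> throughout the forbidden region, and by continuity
its angle stays within a single sector.\<close>

lemma sq_int_iff:
  assumes a: "0 \<le> \<alpha>" "\<alpha> \<le> pi / 2"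
  shows "(\<integral>\<^sup>+x. ennreal ((sol \<alpha> e \<mu> x)\<^sup>2) * indicator {0..} x \<partial>lborel) < \<infinity>
     \<longleftrightarrow> (\<exists>k\<ge>1. e = level \<alpha> k \<mu>)"
proof
  assume fin: "(\<integral>\<^sup>+x. ennreal ((sol \<alpha> e \<mu> x)\<^sup>2) * indicator {0..} x \<partial>lborel) < \<infinity>"
  obtain R where R: "forbidden e \<mu> R" using ex_forbidden by blast
  let ?t = "angle \<alpha> e \<mu>"
  have neg: "sin (?t x) * cos (?t x) < 0" if "R \<le> x" for x
    using growth[OF R that, of \<alpha>] fin unfolding sol_mult_neg[symmetric] by force
  \<comment> \<open>The sector is determined by the angle at the beginning of the forbidden region.\<close>
  define k where "k = Suc (nat \<lfloor>?t R / pi\<rfloor>)"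
  have tR: "0 \<le> ?t R" using angle_no_return[of 0 \<alpha> e \<mu> 0 R] a R unfolding forbidden_def by auto
  have rk: "real k = of_int \<lfloor>?t R / pi\<rfloor> + 1" using tR unfolding k_def by simp
  have "?t R / pi < real k" "real k - 1 \<le> ?t R / pi" unfolding rk by linarith+
  then have kR: "?t R < real k * pi" "(real k - 1) * pi \<le> ?t R" by (simp_all add: field_simps)
  have sp: "0 < sin (2 * (real k * pi - ?t x))" if "R \<le> x" for x
    using neg[OF that] sin_cos_neg_iff by blast
  have half: "(real k - 1 / 2) * pi < ?t R"
  proof (rule ccontr)
    assume "\<not> ?thesis"
    then have "sin (2 * (real k * pi - ?t R) - pi) \<ge> 0"
      using kR by (intro sin_ge_zero) (auto simp: algebra_simps)
    then have "sin (2 * (real k * pi - ?t R)) \<le> 0" by (simp add: sin_diff)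
    then show False using sp[of R] by simp
  qed
  have lo: "(real k - 1 / 2) * pi < ?t x" if x: "R \<le> x" for x
  proof (rule ccontr)
    assume "\<not> ?thesis"
    then obtain y where y: "R \<le> y" "?t y = (real k - 1 / 2) * pi"
      using IVT2[of ?t x "(real k - 1 / 2) * pi" R] half x isCont_angle by auto
    have "sin (2 * (real k * pi - ?t y)) = sin pi" unfolding y(2) by (simp add: algebra_simps)
    then show False using sp[OF y(1)] by simp
  qed
  have hi: "?t x < real k * pi" if x: "R \<le> x" for x
  proof (rule ccontr)
    assume "\<not> ?thesis"
    then obtain y where y: "R \<le> y" "?t y = real k * pi"
      using IVT[of ?t R "real k * pi" x] kR x isCont_angle by auto
    show False using sp[OF y(1)] y(2) by simp
  qed
  have "sector \<alpha> k e \<mu>" unfolding sector_def using R lo hi by blast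
  then have "e = level \<alpha> k \<mu>" by (intro sector_unique[OF a]) (auto simp: k_def)
  then show "\<exists>k\<ge>1. e = level \<alpha> k \<mu>" by (intro exI[of _ k]) (auto simp: k_def)
next
  assume "\<exists>k\<ge>1. e = level \<alpha> k \<mu>"
  then show "(\<integral>\<^sup>+x. ennreal ((sol \<alpha> e \<mu> x)\<^sup>2) * indicator {0..} x \<partial>lborel) < \<infinity>"
    using sector_decay(2) level_sector[OF a] by blast
qed

text \<open>The Wronskian of the even and the odd solution is \<open>1\<close>, so the difference of their angles never
meets a multiple of \<open>\<pi>\<close>; it starts at \<open>\<pi> / 2\<close>.\<close>

lemma angle_interlace:
  assumes "0 \<le> x"
  shows "angle 0 e \<mu> x < angle (pi / 2) e \<mu> x" "angle (pi / 2) e \<mu> x < angle 0 e \<mu> x + pi"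
proof -
  let ?D = "\<lambda>x. angle (pi / 2) e \<mu> x - angle 0 e \<mu> x"
  have s: "sin (?D y) \<noteq> 0" for y
    using wronskian_solutions[of e \<mu> y] unfolding wronskian_angle by force
  have c: "isCont ?D y" for y by (intro continuous_intros isCont_angle)
  show "angle 0 e \<mu> x < angle (pi / 2) e \<mu> x"
  proof (rule ccontr)
    assume "\<not> ?thesis"
    then obtain y where "?D y = 0" using IVT2[of ?D x 0 0] assms c by auto
    then show False using s[of y] by simp
  qed
  show "angle (pi / 2) e \<mu> x < angle 0 e \<mu> x + pi"
  proof (rule ccontr)
    assume "\<not> ?thesis"
    then obtain y where "?D y = pi" using IVT[of ?D 0 pi x] assms c by auto
    then show False using s[of y] by simp
  qed
qed

lemma level_le:
  assumes "0 \<le> \<alpha>" "\<alpha> \<le> pi / 2" "1 \<le> k" "0 \<le> \<beta>" "\<beta> \<le> pi / 2" "1 \<le> l"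
    and "\<And>e. (e, \<mu>) \<in> reach \<beta> l \<Longrightarrow> (e, \<mu>) \<in> reach \<alpha> k"
  shows "level \<alpha> k \<mu> \<le> level \<beta> l \<mu>"
  using assms reach_iff[OF assms(1-3), of _ \<mu>] reach_iff[OF assms(4-6), of _ \<mu>]
  by (meson linorder_not_less order_less_irrefl)

text \<open>Two decaying solutions would have a Wronskian that tends to \<open>0\<close> instead of being \<open>1\<close>.\<close>

lemma level_even_odd_neq:
  assumes "1 \<le> k" "1 \<le> l" shows "level (pi / 2) k \<mu> \<noteq> level 0 l \<mu>"
proof
  assume eq: "level (pi / 2) k \<mu> = level 0 l \<mu>"
  let ?e = "level 0 l \<mu>"
  have "sector (pi / 2) k ?e \<mu>" "sector 0 l ?e \<mu>"
    using level_sector[of "pi / 2" k \<mu>] level_sector[of 0 l \<mu>] assms eq by auto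
  from wronskian_tendsto_0[OF this] have "((\<lambda>x. 1::real) \<longlongrightarrow> 0) (at_top :: real filter)"
    unfolding wronskian_solutions .
  then show False by (simp add: tendsto_const_iff)
qed

section \<open>The increasing sequence of levels\<close>

definition energy :: "nat \<Rightarrow> real \<Rightarrow> real" where
  "energy m \<mu> = (if even m then level (pi / 2) (Suc (m div 2)) \<mu> else level 0 (Suc (m div 2)) \<mu>)"

lemma strict_mono_energy: "strict_mono (\<lambda>m. energy m \<mu>)"
  unfolding strict_mono_Suc_iff
proof
  fix m
  show "energy m \<mu> < energy (Suc m) \<mu>"
  proof (cases "even m")
    case True
    let ?k = "Suc (m div 2)"
    have "level (pi / 2) ?k \<mu> \<le> level 0 ?k \<mu>"
      by (rule level_le) (auto simp: reach_def intro: less_trans[OF _ angle_interlace(1)])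
    moreover have "level (pi / 2) ?k \<mu> \<noteq> level 0 ?k \<mu>" by (rule level_even_odd_neq) auto
    ultimately show ?thesis using True by (simp add: energy_def)
  next
    case False
    let ?k = "Suc (m div 2)"
    have "(e, \<mu>) \<in> reach 0 ?k" if "(e, \<mu>) \<in> reach (pi / 2) (Suc ?k)" for e
    proof -
      obtain x where x: "0 \<le> x" "real (Suc ?k) * pi < angle (pi / 2) e \<mu> x"
        using \<open>(e, \<mu>) \<in> reach (pi / 2) (Suc ?k)\<close> unfolding reach_def by auto
      have "real (Suc ?k) * pi = real ?k * pi + pi" by (simp add: algebra_simps)
      then have "real ?k * pi < angle 0 e \<mu> x"
        using angle_interlace(2)[OF x(1), of e \<mu>] x(2) by linarith
      then show ?thesis using x(1) unfolding reach_def by auto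
    qed
    then have "level 0 ?k \<mu> \<le> level (pi / 2) (Suc ?k) \<mu>"
      by (intro level_le) auto
    moreover have "level (pi / 2) (Suc ?k) \<mu> \<noteq> level 0 ?k \<mu>" by (rule level_even_odd_neq) auto
    moreover have "Suc m div 2 = Suc (m div 2)" using False by (elim oddE) simp
    ultimately show ?thesis using False by (simp add: energy_def)
  qed
qed

lemma range_energy:
  "range (\<lambda>m. energy m \<mu>) = {e. (\<exists>k\<ge>1. e = level (pi / 2) k \<mu>) \<or> (\<exists>k\<ge>1. e = level 0 k \<mu>)}"
proof (intro equalityI subsetI)
  fix e assume "e \<in> range (\<lambda>m. energy m \<mu>)"
  then obtain m where m: "e = energy m \<mu>" by auto
  have "1 \<le> Suc (m div 2)" by simp
  then show "e \<in> {e. (\<exists>k\<ge>1. e = level (pi / 2) k \<mu>) \<or> (\<exists>k\<ge>1. e = level 0 k \<mu>)}"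
    unfolding m energy_def by (cases "even m") (simp only: if_True if_False simp_thms mem_Collect_eq, blast)+
next
  fix e assume "e \<in> {e. (\<exists>k\<ge>1. e = level (pi / 2) k \<mu>) \<or> (\<exists>k\<ge>1. e = level 0 k \<mu>)}"
  then consider k where "1 \<le> k" "e = level (pi / 2) k \<mu>" | k where "1 \<le> k" "e = level 0 k \<mu>" by auto
  then show "e \<in> range (\<lambda>m. energy m \<mu>)"
  proof cases
    case 1
    then have "e = energy (2 * (k - 1)) \<mu>" by (simp add: energy_def)
    then show ?thesis by blast
  next
    case 2
    then have "e = energy (Suc (2 * (k - 1))) \<mu>" by (simp add: energy_def)
    then show ?thesis by blast
  qed
qed

lemma borel_energy: "energy m \<in> borel_measurable borel"
  unfolding energy_def[abs_def] by (cases "even m") (auto intro!: borel_level)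

text \<open>This makes the enumeration of the spectrum in increasing order well defined.\<close>

lemma strict_mono_range_unique:
  fixes f g :: "nat \<Rightarrow> 'a::linorder"
  assumes f: "strict_mono f" and g: "strict_mono g" and r: "range f = range g"
  shows "f = g"
proof
  fix n
  show "f n = g n"
  proof (induction n rule: less_induct)
    case (less n)
    have ge: "g' n \<le> f' n" if f': "strict_mono f'" and g': "strict_mono g'"
      and r': "range f' = range g'" and eq: "\<And>i. i < n \<Longrightarrow> f' i = g' i"
      for f' g' :: "nat \<Rightarrow> 'a"
    proof -
      obtain j where j: "f' n = g' j" using r' by (metis rangeE rangeI)
      have "\<not> j < n"
      proof
        assume "j < n"
        then have "f' n = f' j" using eq j by simp
        then show False using \<open>j < n\<close> strict_mono_eq[OF f'] by simp
      qed
      then show ?thesis using j strict_mono_less_eq[OF g'] by simp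
    qed
    show ?case using ge[OF f g r] ge[OF g f r[symmetric]] less by force
  qed
qed

section \<open>Smooth functions and test functions\<close>

definition smooth :: "(real \<Rightarrow> real) \<Rightarrow> bool" where
  "smooth f \<longleftrightarrow> (\<forall>n x. ((deriv ^^ n) f) differentiable (at x))"

text \<open>The function algebra generated by \<open>B\<close>.  If each generator has its derivative in the algebra, then
the algebra is closed under differentiation; this is how all smoothness claims are proved.\<close>

inductive gen_alg :: "(real \<Rightarrow> real) set \<Rightarrow> (real \<Rightarrow> real) \<Rightarrow> bool" for B where
  base: "f \<in> B \<Longrightarrow> gen_alg B f"
| const: "gen_alg B (\<lambda>x. c)"
| add: "gen_alg B f \<Longrightarrow> gen_alg B g \<Longrightarrow> gen_alg B (\<lambda>x. f x + g x)"
| mult: "gen_alg B f \<Longrightarrow> gen_alg B g \<Longrightarrow> gen_alg B (\<lambda>x. f x * g x)"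

lemma gen_alg_smooth:
  assumes B: "\<And>f. f \<in> B \<Longrightarrow> \<exists>f'. gen_alg B f' \<and> (\<forall>x. (f has_real_derivative f' x) (at x))"
    and f: "gen_alg B f"
  shows "smooth f"
proof -
  have D: "\<exists>f'. gen_alg B f' \<and> (\<forall>x. (f has_real_derivative f' x) (at x))" if "gen_alg B f" for f
    using that
  proof induction
    case (base f)
    then show ?case by (rule B)
  next
    case (const c)
    show ?case by (rule exI[of _ "\<lambda>x. 0"]) (auto intro: gen_alg.const)
  next
    case (add f g)
    then obtain f' g' where "gen_alg B f'" "gen_alg B g'" "\<And>x. (f has_real_derivative f' x) (at x)"
      "\<And>x. (g has_real_derivative g' x) (at x)" by blast
    then show ?case by (intro exI[of _ "\<lambda>x. f' x + g' x"]) (auto intro: gen_alg.add DERIV_add)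
  next
    case (mult f g)
    then obtain f' g' where "gen_alg B f'" "gen_alg B g'" "\<And>x. (f has_real_derivative f' x) (at x)"
      "\<And>x. (g has_real_derivative g' x) (at x)" by blast
    then show ?case using mult.hyps
      by (intro exI[of _ "\<lambda>x. f' x * g x + g' x * f x"]) (auto intro!: gen_alg.add gen_alg.mult DERIV_mult)
  qed
  have dalg: "gen_alg B (deriv g)" if "gen_alg B g" for g
  proof -
    obtain g' where g': "gen_alg B g'" "\<And>x. (g has_real_derivative g' x) (at x)" using D[OF \<open>gen_alg B g\<close>] by blast
    then have "deriv g = g'" by (intro ext DERIV_imp_deriv)
    then show ?thesis using g' by simp
  qed
  have "gen_alg B ((deriv ^^ n) f)" for n
    by (induction n) (auto intro: f dalg)
  then show ?thesis unfolding smooth_def using D by (meson real_differentiable_def)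
qed

lemma smooth_deriv: assumes "smooth f" shows "smooth (deriv f)" "(f has_real_derivative deriv f x) (at x)"
proof -
  have "((deriv ^^ n) (deriv f)) differentiable (at x)" for n x
    using assms unfolding smooth_def by (metis funpow_simps_right(2) comp_apply)
  then show "smooth (deriv f)" unfolding smooth_def by blast
  have "((deriv ^^ 0) f) differentiable (at x)" using assms unfolding smooth_def by blast
  then show "(f has_real_derivative deriv f x) (at x)"
    by (simp add: DERIV_deriv_iff_real_differentiable)
qed

lemma smooth_gen_alg: "gen_alg {f. smooth f} f \<Longrightarrow> smooth f"
  by (rule gen_alg_smooth[of "{f. smooth f}"]) (auto intro: gen_alg.base smooth_deriv)

lemma smooth_const: "smooth (\<lambda>x. c)"
  by (intro smooth_gen_alg gen_alg.const)

lemma smooth_mult: "smooth f \<Longrightarrow> smooth g \<Longrightarrow> smooth (\<lambda>x. f x * g x)"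
  by (intro smooth_gen_alg gen_alg.mult gen_alg.base) auto

lemma smooth_add: "smooth f \<Longrightarrow> smooth g \<Longrightarrow> smooth (\<lambda>x. f x + g x)"
  by (intro smooth_gen_alg gen_alg.add gen_alg.base) auto

lemma smooth_affine:
  assumes "smooth f" shows "smooth (\<lambda>x. f (a * x + b))"
proof (rule gen_alg_smooth)
  let ?B = "{g. \<exists>f. smooth f \<and> g = (\<lambda>x. f (a * x + b))}"
  show "gen_alg ?B (\<lambda>x. f (a * x + b))" using assms by (intro gen_alg.base) auto
  fix g assume "g \<in> ?B"
  then obtain f where f: "smooth f" "g = (\<lambda>x. f (a * x + b))" by auto
  show "\<exists>g'. gen_alg ?B g' \<and> (\<forall>x. (g has_real_derivative g' x) (at x))"
  proof (intro exI conjI allI)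
    show "gen_alg ?B (\<lambda>x. deriv f (a * x + b) * a)"
      using smooth_deriv(1)[OF f(1)] by (intro gen_alg.mult gen_alg.base gen_alg.const) auto
    show "(g has_real_derivative deriv f (a * x + b) * a) (at x)" for x
      unfolding f(2) by (rule DERIV_chain2[OF smooth_deriv(2)[OF f(1)]]) (auto intro!: derivative_eq_intros)
  qed
qed

lemma smooth_continuous: "smooth f \<Longrightarrow> continuous_on A f"
  by (rule DERIV_continuous_on[OF has_field_derivative_at_within[OF smooth_deriv(2)]])

lemma gen_alg_pow: "(\<lambda>x. x) \<in> B \<Longrightarrow> gen_alg B (\<lambda>x. x ^ n)"
proof (induction n)
  case 0
  show ?case using gen_alg.const[of B 1] by simp
next
  case (Suc n)
  then show ?case using gen_alg.mult[OF gen_alg.base[of "\<lambda>x. x" B] Suc.IH] by simp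
qed

lemma gen_alg_pot:
  assumes "(\<lambda>x. x) \<in> B" shows "gen_alg B (\<lambda>x. pot \<mu> x - e)"
proof -
  have "gen_alg B (\<lambda>x. (x ^ 4 * (1 / 4) + x ^ 2 * (- \<mu>)) + (\<mu>\<^sup>2 - e))"
    by (intro gen_alg.add gen_alg.mult gen_alg.const gen_alg_pow assms)
  also have "(\<lambda>x. (x ^ 4 * (1 / 4) + x ^ 2 * (- \<mu>)) + (\<mu>\<^sup>2 - e)) = (\<lambda>x. pot \<mu> x - e)"
    by (simp add: fun_eq_iff pot_def power2_eq_square power4_eq_xxxx field_simps)
  finally show ?thesis .
qed

lemma smooth_sol: "smooth (sol \<alpha> e \<mu>)"
proof (rule gen_alg_smooth)
  let ?B = "{sol \<alpha> e \<mu>, dsol \<alpha> e \<mu>, \<lambda>x. x}"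
  show "gen_alg ?B (sol \<alpha> e \<mu>)" by (rule gen_alg.base) simp
  fix f assume "f \<in> ?B"
  then consider "f = sol \<alpha> e \<mu>" | "f = dsol \<alpha> e \<mu>" | "f = (\<lambda>x. x)" by auto
  then show "\<exists>f'. gen_alg ?B f' \<and> (\<forall>x. (f has_real_derivative f' x) (at x))"
  proof cases
    case 1
    then show ?thesis by (intro exI[of _ "dsol \<alpha> e \<mu>"]) (auto intro: gen_alg.base sol_has_deriv)
  next
    case 2
    then show ?thesis
      by (intro exI[of _ "\<lambda>x. (pot \<mu> x - e) * sol \<alpha> e \<mu> x"])
        (auto intro!: gen_alg.mult gen_alg_pot intro: gen_alg.base dsol_has_deriv)
  next
    case 3
    then show ?thesis by (intro exI[of _ "\<lambda>x. 1"]) (auto intro: gen_alg.const)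
  qed
qed

text \<open>For \<open>k = 0\<close> this is the standard smooth function that vanishes exactly on the negative half line;
the powers of \<open>inverse x\<close> appear in its derivatives.\<close>

definition flat_exp :: "nat \<Rightarrow> real \<Rightarrow> real" where
  "flat_exp k x = (if x \<le> 0 then 0 else inverse x ^ k * exp (- inverse x))"

lemma flat_exp_deriv:
  "(flat_exp k has_real_derivative flat_exp (k + 2) x - real k * flat_exp (k + 1) x) (at x)"
proof -
  consider "x < 0" | "x = 0" | "0 < x" by linarith
  then show ?thesis
  proof cases
    case 1
    have "((\<lambda>x. 0) has_real_derivative 0) (at x)" by simp
    then have "(flat_exp k has_real_derivative 0) (at x)"
      by (rule has_field_derivative_transform_within_open[of _ _ _ "{..<0}"]) (use 1 in \<open>auto simp: flat_exp_def\<close>)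
    then show ?thesis using 1 by (simp add: flat_exp_def)
  next
    case 3
    have "((\<lambda>x. inverse x ^ k * exp (- inverse x)) has_real_derivative flat_exp (k + 2) x - real k * flat_exp (k + 1) x) (at x)"
    proof -
      define y where "y = inverse x"
      have i: "(inverse has_real_derivative - (y ^ 2)) (at x)"
        using DERIV_inverse[of x] 3 by (simp add: y_def numeral_2_eq_2)
      have "((\<lambda>x. exp (- inverse x)) has_real_derivative exp (- y) * - (- (y ^ 2))) (at x)"
        unfolding y_def by (rule DERIV_chain2[OF DERIV_exp DERIV_minus[OF i[unfolded y_def]]])
      from DERIV_mult[OF DERIV_power[OF i, of k] this]
      have "((\<lambda>x. inverse x ^ k * exp (- inverse x)) has_real_derivative
        real k * (- (y ^ 2) * y ^ (k - 1)) * exp (- y) + exp (- y) * y ^ 2 * y ^ k) (at x)"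
        by (simp add: y_def)
      also have "real k * (- (y ^ 2) * y ^ (k - 1)) * exp (- y) + exp (- y) * y ^ 2 * y ^ k
          = flat_exp (k + 2) x - real k * flat_exp (k + 1) x"
        using 3 by (cases k) (simp_all add: flat_exp_def y_def[symmetric] power_add power2_eq_square algebra_simps)
      finally show ?thesis .
    qed
    then show ?thesis
      by (rule has_field_derivative_transform_within_open[of _ _ _ "{0<..}"]) (use 3 in \<open>auto simp: flat_exp_def\<close>)
  next
    case 2
    have "((\<lambda>y. (flat_exp k y - flat_exp k 0) / (y - 0)) \<longlongrightarrow> 0) (at 0)"
    proof (rule filterlim_split_at)
      have "((\<lambda>y. 0) \<longlongrightarrow> (0::real)) (at_left 0)" by simp
      then show "((\<lambda>y. (flat_exp k y - flat_exp k 0) / (y - 0)) \<longlongrightarrow> 0) (at_left 0)"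
        by (rule Lim_transform_eventually)
          (auto simp: flat_exp_def eventually_at_filter)
      have "((\<lambda>y. inverse y ^ (k + 1) / exp (inverse y)) \<longlongrightarrow> (0::real)) (at_right 0)"
        by (rule filterlim_compose[OF tendsto_power_div_exp_0 filterlim_inverse_at_top_right])
      then show "((\<lambda>y. (flat_exp k y - flat_exp k 0) / (y - 0)) \<longlongrightarrow> 0) (at_right 0)"
        by (rule Lim_transform_eventually)
          (auto simp: flat_exp_def eventually_at_filter exp_minus field_simps)
    qed
    then show ?thesis using 2 by (simp add: has_field_derivative_iff flat_exp_def)
  qed
qed

lemma smooth_flat_exp: "smooth (flat_exp k)"
proof (rule gen_alg_smooth)
  show "gen_alg (range flat_exp) (flat_exp k)" by (rule gen_alg.base) simp
  fix f assume "f \<in> range flat_exp"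
  then obtain j where f: "f = flat_exp j" by auto
  have "gen_alg (range flat_exp) (\<lambda>x. flat_exp (j + 2) x + (- real j) * flat_exp (j + 1) x)"
    by (intro gen_alg.add gen_alg.mult gen_alg.base gen_alg.const) auto
  then show "\<exists>f'. gen_alg (range flat_exp) f' \<and> (\<forall>x. (f has_real_derivative f' x) (at x))"
    unfolding f using flat_exp_deriv[of j] by (intro exI[of _ "\<lambda>x. flat_exp (j + 2) x + (- real j) * flat_exp (j + 1) x"]) auto
qed

lemma test_function_iff:
  "test_function f \<longleftrightarrow> smooth f \<and> (\<exists>R. \<forall>x. R < \<bar>x\<bar> \<longrightarrow> f x = 0)"
proof -
  have "compact (closure {x. f x \<noteq> 0}) \<longleftrightarrow> (\<exists>R. \<forall>x. R < \<bar>x\<bar> \<longrightarrow> f x = 0)"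
  proof
    assume "compact (closure {x. f x \<noteq> 0})"
    then have "bounded (closure {x. f x \<noteq> 0})" by (rule compact_imp_bounded)
    then obtain R where "\<And>x. x \<in> closure {x. f x \<noteq> 0} \<Longrightarrow> norm x \<le> R" unfolding bounded_iff by blast
    then have "f x = 0" if "R < \<bar>x\<bar>" for x using closure_subset[of "{x. f x \<noteq> 0}"] that by force
    then show "\<exists>R. \<forall>x. R < \<bar>x\<bar> \<longrightarrow> f x = 0" by blast
  next
    assume "\<exists>R. \<forall>x. R < \<bar>x\<bar> \<longrightarrow> f x = 0"
    then obtain R where R: "\<And>x. R < \<bar>x\<bar> \<Longrightarrow> f x = 0" by blast
    have "{x. f x \<noteq> 0} \<subseteq> {- R..R}" using R by force
    then show "compact (closure {x. f x \<noteq> 0})"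
      by (simp add: bounded_subset[OF bounded_closed_interval[of "-R" R]] compact_closure)
  qed
  then show ?thesis unfolding test_function_def smooth_def by simp
qed

definition compact_supp :: "(real \<Rightarrow> real) \<Rightarrow> bool" where
  "compact_supp g \<longleftrightarrow> continuous_on UNIV g \<and> (\<exists>R. \<forall>x. R < \<bar>x\<bar> \<longrightarrow> g x = 0)"

lemma compact_supp_test: "test_function f \<Longrightarrow> compact_supp f"
  unfolding test_function_iff compact_supp_def using smooth_continuous by blast

lemma compact_supp_mult: "compact_supp f \<Longrightarrow> continuous_on UNIV g \<Longrightarrow> compact_supp (\<lambda>x. f x * g x)"
  "compact_supp f \<Longrightarrow> continuous_on UNIV g \<Longrightarrow> compact_supp (\<lambda>x. g x * f x)"
  unfolding compact_supp_def by (auto intro!: continuous_intros)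

lemma compact_supp_add: assumes "compact_supp f" "compact_supp g" shows "compact_supp (\<lambda>x. f x + g x)"
proof -
  obtain R S where "\<forall>x. R < \<bar>x\<bar> \<longrightarrow> f x = 0" "\<forall>x. S < \<bar>x\<bar> \<longrightarrow> g x = 0" using assms unfolding compact_supp_def by blast
  then have "\<exists>T. \<forall>x. T < \<bar>x\<bar> \<longrightarrow> f x + g x = 0" by (intro exI[of _ "max R S"]) auto
  moreover have "continuous_on UNIV (\<lambda>x. f x + g x)"
    using assms unfolding compact_supp_def by (intro continuous_on_add) auto
  ultimately show ?thesis unfolding compact_supp_def by blast
qed

lemma compact_supp_bound:
  assumes "compact_supp g"
  shows "\<exists>R B. 0 < R \<and> (\<forall>x. \<bar>g x\<bar> \<le> B * indicator {- R..R} x) \<and> (\<forall>x. R \<le> \<bar>x\<bar> \<longrightarrow> g x = 0)"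
proof -
  obtain R' where R': "\<And>x. R' < \<bar>x\<bar> \<Longrightarrow> g x = 0" using assms unfolding compact_supp_def by blast
  define R where "R = max 0 R' + 1"
  have "0 < R" unfolding R_def by simp
  have "R' < R" unfolding R_def by linarith
  then have "g x = 0" if "R \<le> \<bar>x\<bar>" for x
    by (intro R' less_le_trans[OF _ that])
  note R = \<open>0 < R\<close> this
  have "compact (g ` {-R..R})" using assms unfolding compact_supp_def
    by (intro compact_continuous_image) (auto intro: continuous_on_subset)
  then have "bounded (g ` {-R..R})" by (rule compact_imp_bounded)
  then obtain B where "\<forall>y\<in>g ` {-R..R}. norm y \<le> B" unfolding bounded_iff by (elim exE)
  then have B: "\<And>y. y \<in> g ` {-R..R} \<Longrightarrow> norm y \<le> B" by (rule bspec)
  have "\<bar>g x\<bar> \<le> B * indicator {- R..R} x" for x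
  proof (cases "x \<in> {-R..R}")
    case True
    then show ?thesis using B[of "g x"] by auto
  next
    case False
    then have "g x = 0" by (intro R(2)) auto
    then show ?thesis using False by simp
  qed
  then show ?thesis using R by blast
qed

lemma compact_supp_borel: "compact_supp g \<Longrightarrow> g \<in> borel_measurable borel"
  unfolding compact_supp_def by (intro borel_measurable_continuous_onI) auto

lemma integrable_Icc: "integrable lborel (indicator {a..b::real} :: real \<Rightarrow> real)"
  by (rule integrable_real_indicator) (auto simp: emeasure_lborel_Icc_eq)

lemma borel_imp_lebesgue:
  fixes f :: "real \<Rightarrow> 'a::topological_space"
  shows "f \<in> borel_measurable borel \<Longrightarrow> f \<in> borel_measurable lebesgue"
  by (intro measurable_completion) simp

text \<open>From \<open>\<bar>u g\<bar> \<le> \<bar>u\<bar>\<^sup>2 + g\<^sup>2\<close>.\<close>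

lemma L2_mult_integrable:
  assumes u: "u \<in> L2" and g: "g \<in> borel_measurable borel" and b: "\<And>x. \<bar>g x\<bar> \<le> B * indicator {- R..R} x"
  shows "integrable lebesgue (\<lambda>x. u x * complex_of_real (g x))"
proof (rule Bochner_Integration.integrable_bound)
  have "integrable lebesgue (\<lambda>x. B\<^sup>2 * indicator {- R..R} x)"
    by (subst integrable_completion) (auto intro: integrable_Icc)
  then show "integrable lebesgue (\<lambda>x. (cmod (u x))\<^sup>2 + B\<^sup>2 * indicator {- R..R} x)"
    using u unfolding L2_def by (intro Bochner_Integration.integrable_add) auto
  have "g \<in> borel_measurable lebesgue" using g by (intro measurable_completion) simp
  then show "(\<lambda>x. u x * complex_of_real (g x)) \<in> borel_measurable lebesgue"
    using u unfolding L2_def by (intro borel_measurable_times borel_measurable_of_real) auto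
  show "AE x in lebesgue. norm (u x * complex_of_real (g x)) \<le> norm ((cmod (u x))\<^sup>2 + B\<^sup>2 * indicator {- R..R} x)"
  proof (intro always_eventually allI)
    fix x
    have "\<bar>cmod (u x) * g x\<bar> \<le> (cmod (u x))\<^sup>2 + (g x)\<^sup>2" by (rule abs_mult_le_squares)
    also have "(g x)\<^sup>2 \<le> (B * indicator {- R..R} x)\<^sup>2"
      using b[of x] power_mono[of "\<bar>g x\<bar>" _ 2] by simp
    also have "(B * indicator {- R..R} x)\<^sup>2 = B\<^sup>2 * indicator {- R..R} x" by (auto split: split_indicator)
    finally show "norm (u x * complex_of_real (g x)) \<le> norm ((cmod (u x))\<^sup>2 + B\<^sup>2 * indicator {- R..R} x)"
      by (simp add: norm_mult abs_mult)
  qed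
qed

lemma L2_compact_supp_integrable:
  assumes "u \<in> L2" "compact_supp g" shows "integrable lebesgue (\<lambda>x. u x * complex_of_real (g x))"
proof -
  obtain R B where "\<forall>x. \<bar>g x\<bar> \<le> B * indicator {- R..R} x" using compact_supp_bound[OF assms(2)] by (elim exE conjE)
  then have "\<And>x. \<bar>g x\<bar> \<le> B * indicator {- R..R} x" by (rule spec)
  then show ?thesis by (rule L2_mult_integrable[OF assms(1) compact_supp_borel[OF assms(2)]])
qed

lemma compact_supp_integrable: assumes "compact_supp g" shows "integrable lborel g"
proof -
  obtain R B where R: "0 < R" "\<And>x. \<bar>g x\<bar> \<le> B * indicator {- R..R} x" using compact_supp_bound[OF assms] by blast
  have "integrable lborel (\<lambda>x. B * indicator {- R..R} x :: real)"
    by (intro integrable_mult_right integrable_Icc)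
  then show ?thesis
    by (rule Bochner_Integration.integrable_bound) (use R compact_supp_borel[OF assms] in \<open>auto intro: order_trans abs_ge_self\<close>)
qed

lemma compact_supp_integral_FTC:
  assumes g: "compact_supp g" and R: "0 \<le> R" "\<And>x. R \<le> \<bar>x\<bar> \<Longrightarrow> g x = 0"
    and F: "\<And>x. (F has_real_derivative g x) (at x)"
  shows "(LINT x|lborel. g x) = F R - F (- R)"
proof -
  have "(LINT x|lborel. g x) = (LINT x|lborel. g x * indicator {- R..R} x)"
  proof (intro Bochner_Integration.integral_cong refl)
    fix x show "g x = g x * indicator {- R..R} x"
      using R(2)[of x] by (cases "x \<in> {-R..R}") auto
  qed
  also have "\<dots> = F R - F (- R)"
    using g R F unfolding compact_supp_def by (intro integral_FTC_Icc_real) (auto simp: continuous_on_eq_continuous_at)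
  finally show ?thesis .
qed

text \<open>Integrating from the left of the support; the vanishing total integral makes the antiderivative
vanish on the right of it.\<close>

lemma compact_supp_antideriv:
  assumes g: "compact_supp g" and z: "(LINT x|lborel. g x) = 0"
  shows "\<exists>F. (\<forall>x. (F has_real_derivative g x) (at x)) \<and> (\<exists>R. \<forall>x. R < \<bar>x\<bar> \<longrightarrow> F x = 0)"
proof -
  obtain R B where R: "0 < R" "\<And>x. R \<le> \<bar>x\<bar> \<Longrightarrow> g x = 0" using compact_supp_bound[OF g] by blast
  define F where "F x = integral {- R - 1..x} g" for x
  have Fz: "F x = 0" if "x \<le> - R" for x
  proof -
    have "integral {- R - 1..x} g = integral {- R - 1..x} (\<lambda>x. 0)"
      using that R by (intro integral_cong) auto
    then show ?thesis unfolding F_def by simp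
  qed
  have D: "(F has_real_derivative g x) (at x)" for x
  proof (cases "x < - R")
    case True
    have "((\<lambda>x. 0) has_real_derivative 0) (at x)" by simp
    then have "(F has_real_derivative 0) (at x)"
      by (rule has_field_derivative_transform_within_open[of _ _ _ "{..<- R}"]) (use True Fz in auto)
    moreover have "g x = 0" by (intro R(2)) (use True R in auto)
    ultimately show ?thesis by simp
  next
    case False
    have "(F has_real_derivative g x) (at x within {- R - 1..x + 1})"
      unfolding F_def using g False unfolding compact_supp_def
      by (intro integral_has_real_derivative) (auto intro: continuous_on_subset)
    moreover have "at x within {- R - 1..x + 1} = at x"
      using False by (intro at_within_interior) auto
    ultimately show ?thesis by simp
  qed
  have "F x = 0" if x: "R < \<bar>x\<bar>" for x
  proof (cases "x \<le> - R")
    case False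
    then have x: "R < x" using x by linarith
    have "(LINT x|lborel. g x) = F x - F (- x)"
      using x R by (intro compact_supp_integral_FTC[OF g _ _ D]) auto
    then show ?thesis using z Fz[of "- x"] x by simp
  qed (rule Fz)
  then show ?thesis using D by blast
qed

section \<open>Weak solutions are classical\<close>

text \<open>Variation of constants.  The two orthogonality conditions are exactly what makes the coefficient
functions, hence the solution, compactly supported.\<close>

lemma solve_test:
  assumes t: "test_function \<eta>"
    and z: "(LINT x|lborel. \<eta> x * sol (pi / 2) e \<mu> x) = 0" "(LINT x|lborel. \<eta> x * sol 0 e \<mu> x) = 0"
  shows "\<exists>\<xi>. test_function \<xi> \<and> (\<forall>x. (deriv ^^ 2) \<xi> x = (pot \<mu> x - e) * \<xi> x + \<eta> x)"
proof -
  let ?a = "sol (pi / 2) e \<mu>" and ?b = "sol 0 e \<mu>" and ?a' = "dsol (pi / 2) e \<mu>" and ?b' = "dsol 0 e \<mu>"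
  have c: "compact_supp (\<lambda>x. \<eta> x * ?a x)" "compact_supp (\<lambda>x. \<eta> x * ?b x)"
    using compact_supp_test[OF t] by (auto intro!: compact_supp_mult(1) continuous_on_sol)
  obtain A where A: "\<And>x. (A has_real_derivative \<eta> x * ?a x) (at x)" "\<exists>R. \<forall>x. R < \<bar>x\<bar> \<longrightarrow> A x = 0"
    using compact_supp_antideriv[OF c(1) z(1)] by blast
  obtain B where B: "\<And>x. (B has_real_derivative \<eta> x * ?b x) (at x)" "\<exists>R. \<forall>x. R < \<bar>x\<bar> \<longrightarrow> B x = 0"
    using compact_supp_antideriv[OF c(2) z(2)] by blast
  define X where "X x = ?b x * A x - ?a x * B x" for x
  define Y where "Y x = ?b' x * A x - ?a' x * B x" for x
  have X: "(X has_real_derivative Y x) (at x)" for x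
    unfolding X_def[abs_def] Y_def
    by (auto intro!: derivative_eq_intros sol_has_deriv A(1) B(1) simp: algebra_simps)
  have Y: "(Y has_real_derivative (pot \<mu> x - e) * X x + \<eta> x) (at x)" for x
  proof -
    have "(Y has_real_derivative (pot \<mu> x - e) * X x + (?a x * ?b' x - ?a' x * ?b x) * \<eta> x) (at x)"
      unfolding X_def Y_def[abs_def]
      by (auto intro!: derivative_eq_intros dsol_has_deriv A(1) B(1) simp: algebra_simps)
    then show ?thesis unfolding wronskian_solutions by simp
  qed
  have sm: "smooth \<eta>" using t unfolding test_function_iff by simp
  have "smooth X"
  proof (rule gen_alg_smooth)
    let ?B = "{X, Y, \<lambda>x. x} \<union> {f. smooth f}"
    show "gen_alg ?B X" by (rule gen_alg.base) simp
    fix f assume "f \<in> ?B"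
    then consider "f = X" | "f = Y" | "f = (\<lambda>x. x)" | "smooth f" by auto
    then show "\<exists>f'. gen_alg ?B f' \<and> (\<forall>x. (f has_real_derivative f' x) (at x))"
    proof cases
      case 1
      then show ?thesis by (intro exI[of _ Y]) (auto intro: gen_alg.base X)
    next
      case 2
      have "gen_alg ?B (\<lambda>x. (pot \<mu> x - e) * X x + \<eta> x)"
        by (intro gen_alg.add gen_alg.mult gen_alg_pot gen_alg.base) (use sm in auto)
      then show ?thesis using 2 Y by blast
    next
      case 3
      then show ?thesis by (intro exI[of _ "\<lambda>x. 1"]) (auto intro: gen_alg.const)
    next
      case 4
      then show ?thesis by (intro exI[of _ "deriv f"]) (auto intro: gen_alg.base smooth_deriv)
    qed
  qed
  moreover have "\<exists>R. \<forall>x. R < \<bar>x\<bar> \<longrightarrow> X x = 0"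
  proof -
    obtain R S where "\<forall>x. R < \<bar>x\<bar> \<longrightarrow> A x = 0" "\<forall>x. S < \<bar>x\<bar> \<longrightarrow> B x = 0" using A(2) B(2) by blast
    then show ?thesis by (intro exI[of _ "max R S"]) (auto simp: X_def)
  qed
  ultimately have "test_function X" unfolding test_function_iff by blast
  moreover have "(deriv ^^ 2) X x = (pot \<mu> x - e) * X x + \<eta> x" for x
  proof -
    have "deriv X = Y" by (intro ext DERIV_imp_deriv X)
    then show ?thesis using DERIV_imp_deriv[OF Y] by (simp add: numeral_2_eq_2)
  qed
  ultimately show ?thesis by blast
qed

text \<open>Test the weak equation with the solution of \<open>- \<xi>'' + (V - e) \<xi> = - \<eta>\<close>.\<close>

lemma eigen_annihilates:
  assumes u: "u \<in> L2" and P: "P_maps \<mu> u (\<lambda>\<theta>. complex_of_real e * u \<theta>)" and t: "test_function \<eta>"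
    and z: "(LINT x|lborel. \<eta> x * sol (pi / 2) e \<mu> x) = 0" "(LINT x|lborel. \<eta> x * sol 0 e \<mu> x) = 0"
  shows "(LINT x|lebesgue. u x * complex_of_real (\<eta> x)) = 0"
proof -
  obtain \<xi> where \<xi>: "test_function \<xi>" "\<And>x. (deriv ^^ 2) \<xi> x = (pot \<mu> x - e) * \<xi> x + \<eta> x"
    using solve_test[OF t z] by blast
  have "(LINT \<theta>|lebesgue. u \<theta> * complex_of_real (- (deriv ^^ 2) \<xi> \<theta> + (\<theta>\<^sup>2 / 2 - \<mu>)\<^sup>2 * \<xi> \<theta>))
     = (LINT \<theta>|lebesgue. (complex_of_real e * u \<theta>) * complex_of_real (\<xi> \<theta>))"
    using P \<xi>(1) unfolding P_maps_def by blast
  also have "(\<lambda>\<theta>. u \<theta> * complex_of_real (- (deriv ^^ 2) \<xi> \<theta> + (\<theta>\<^sup>2 / 2 - \<mu>)\<^sup>2 * \<xi> \<theta>))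
     = (\<lambda>\<theta>. complex_of_real e * (u \<theta> * complex_of_real (\<xi> \<theta>)) - u \<theta> * complex_of_real (\<eta> \<theta>))"
    unfolding \<xi>(2) by (simp add: fun_eq_iff pot_def algebra_simps)
  also have "(LINT \<theta>|lebesgue. complex_of_real e * (u \<theta> * complex_of_real (\<xi> \<theta>)) - u \<theta> * complex_of_real (\<eta> \<theta>))
    = (LINT \<theta>|lebesgue. complex_of_real e * (u \<theta> * complex_of_real (\<xi> \<theta>))) - (LINT \<theta>|lebesgue. u \<theta> * complex_of_real (\<eta> \<theta>))"
    using u t \<xi>(1) by (intro Bochner_Integration.integral_diff integrable_mult_right L2_compact_supp_integrable compact_supp_test)
  finally show ?thesis by (simp add: mult.assoc)
qed

text \<open>The densities given by the positive and the negative part agree on a generator that is stable under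
intersection.\<close>

lemma AE_zero_half_lines:
  fixes g :: "real \<Rightarrow> real"
  assumes g: "integrable lborel g" and z: "\<And>a. (LINT x|lborel. indicator {a<..} x * g x) = 0"
  shows "AE x in lborel. g x = 0"
proof -
  have [measurable]: "g \<in> borel_measurable borel" using g by auto
  let ?p = "\<lambda>x. ennreal (g x)" and ?n = "\<lambda>x. ennreal (- g x)"
  have fin: "(\<integral>\<^sup>+x. ?p x \<partial>lborel) < \<infinity>" "(\<integral>\<^sup>+x. ?n x \<partial>lborel) < \<infinity>"
    using g unfolding real_integrable_def by (auto simp: top.not_eq_extremum)
  have eq: "(\<integral>\<^sup>+x. ?p x * indicator {a<..} x \<partial>lborel) = (\<integral>\<^sup>+x. ?n x * indicator {a<..} x \<partial>lborel)" for a
  proof -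
    have i: "integrable lborel (\<lambda>x. indicator {a<..} x * g x)" using integrable_mult_indicator[OF _ g, of "{a<..}"] by simp
    have p: "(\<integral>\<^sup>+x. ?p x * indicator {a<..} x \<partial>lborel) = (\<integral>\<^sup>+x. ennreal (indicator {a<..} x * g x) \<partial>lborel)"
      by (intro nn_integral_cong) (auto split: split_indicator)
    have n: "(\<integral>\<^sup>+x. ?n x * indicator {a<..} x \<partial>lborel) = (\<integral>\<^sup>+x. ennreal (- (indicator {a<..} x * g x)) \<partial>lborel)"
      by (intro nn_integral_cong) (auto split: split_indicator)
    have f: "(\<integral>\<^sup>+x. ?p x * indicator {a<..} x \<partial>lborel) < \<infinity>" "(\<integral>\<^sup>+x. ?n x * indicator {a<..} x \<partial>lborel) < \<infinity>"
      using i unfolding p n real_integrable_def by (auto simp: top.not_eq_extremum)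
    have "enn2real (\<integral>\<^sup>+x. ?p x * indicator {a<..} x \<partial>lborel) = enn2real (\<integral>\<^sup>+x. ?n x * indicator {a<..} x \<partial>lborel)"
      using z[of a] unfolding real_lebesgue_integral_def[OF i] p n by simp
    then show ?thesis using f by (metis ennreal_enn2real infinity_ennreal_def)
  qed
  have "density lborel ?p = density lborel ?n"
  proof (rule measure_eqI_lessThan)
    show "emeasure (density lborel ?p) {x<..} < \<infinity>" for x
    proof -
      have "(\<integral>\<^sup>+y. ?p y * indicator {x<..} y \<partial>lborel) \<le> (\<integral>\<^sup>+y. ?p y \<partial>lborel)"
        by (intro nn_integral_mono) (auto split: split_indicator)
      then show ?thesis using fin(1) by (subst emeasure_density) auto
    qed
    show "emeasure (density lborel ?p) {x<..} = emeasure (density lborel ?n) {x<..}" for x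
      by (subst (1 2) emeasure_density) (auto simp: eq)
  qed auto
  then have "AE x in lborel. ?p x = ?n x" by (subst (asm) sigma_finite_measure.density_unique_iff[OF lborel.sigma_finite_measure_axioms]) auto
  then show ?thesis
  proof eventually_elim
    case (elim x)
    then show ?case by (cases "0 \<le> g x") (auto simp: ennreal_neg)
  qed
qed

lemma AE_zero_intervals:
  fixes w :: "real \<Rightarrow> real"
  assumes m: "w \<in> borel_measurable lebesgue"
    and i: "\<And>p q. integrable lebesgue (\<lambda>x. indicator {p..q} x * w x)"
    and z: "\<And>p q. p < q \<Longrightarrow> (LINT x|lebesgue. indicator {p<..<q} x * w x) = 0"
  shows "AE x in lebesgue. w x = 0"
proof -
  obtain g where g[measurable]: "g \<in> borel_measurable lborel" and wg: "AE x in lborel. w x = g x"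
    using completion_ex_borel_measurable_real[OF m] by blast
  have wg': "AE x in lebesgue. w x = g x" using wg by (rule AE_completion)
  have gm: "g \<in> borel_measurable lebesgue" using g by (rule measurable_completion)
  have ae: "AE x in lborel. indicator {- N<..<N} x * g x = 0" for N :: real
  proof (rule AE_zero_half_lines)
    have "integrable lebesgue (\<lambda>x. indicator {-N..N} x * g x)"
      by (rule integrable_cong_AE_imp[OF i[of "-N" N]]) (use gm wg' in \<open>auto elim!: eventually_mono intro!: borel_measurable_times borel_imp_lebesgue\<close>)
    then have "integrable lborel (\<lambda>x. indicator {-N..N} x * g x)"
      by (subst (asm) integrable_completion) auto
    then show "integrable lborel (\<lambda>x. indicator {- N<..<N} x * g x)"
      by (rule Bochner_Integration.integrable_bound) (auto split: split_indicator)
    fix a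
    have "(LINT x|lborel. indicator {a<..} x * (indicator {- N<..<N} x * g x))
        = (LINT x|lebesgue. indicator {a<..} x * (indicator {- N<..<N} x * g x))"
      by (rule integral_completion[symmetric]) measurable
    also have "\<dots> = (LINT x|lebesgue. indicator {max a (- N)<..<N} x * w x)"
    proof (intro integral_cong_AE)
      show "(\<lambda>x. indicator {a<..} x * (indicator {- N<..<N} x * g x)) \<in> borel_measurable lebesgue"
        by (intro borel_imp_lebesgue) measurable
      show "(\<lambda>x. indicator {max a (- N)<..<N} x * w x) \<in> borel_measurable lebesgue"
        by (intro borel_measurable_times borel_imp_lebesgue[of "indicator _"] m) measurable
    qed (use wg' in \<open>auto elim!: eventually_mono split: split_indicator\<close>)
    also have "\<dots> = 0"
      using z[of "max a (- N)" N] by (cases "max a (- N) < N") auto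
    finally show "(LINT x|lborel. indicator {a<..} x * (indicator {- N<..<N} x * g x)) = 0" .
  qed
  have "AE x in lborel. \<forall>N::nat. indicator {- real N<..<real N} x * g x = 0"
    by (subst AE_all_countable) (intro allI ae)
  then have "AE x in lborel. g x = 0"
  proof eventually_elim
    case (elim x)
    obtain N where "\<bar>x\<bar> < real N" using reals_Archimedean2 by blast
    then show ?case using elim[rule_format, of N] by (auto simp: indicator_def split: if_splits)
  qed
  then have "AE x in lebesgue. g x = 0" by (rule AE_completion)
  with wg' show ?thesis by eventually_elim simp
qed

text \<open>The test functions \<open>exp (- 1 / (n (x - p)) - 1 / (n (q - x)))\<close> on \<open>(p, q)\<close> increase to the indicator of
the interval, so all integrals over intervals vanish by dominated convergence.\<close>

lemma fundamental_lemma: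
  fixes w :: "real \<Rightarrow> complex"
  assumes m: "w \<in> borel_measurable lebesgue"
    and i: "\<And>p q. integrable lebesgue (\<lambda>x. w x * complex_of_real (indicator {p..q} x))"
    and z: "\<And>\<eta>. test_function \<eta> \<Longrightarrow> (LINT x|lebesgue. w x * complex_of_real (\<eta> x)) = 0"
  shows "AE x in lebesgue. w x = 0"
proof -
  have int: "(LINT x|lebesgue. w x * complex_of_real (indicator {p<..<q} x)) = 0" if "p < q" for p q
  proof -
    define \<eta> where "\<eta> n x = flat_exp 0 (real (Suc n) * x + (- real (Suc n) * p)) * flat_exp 0 (- real (Suc n) * x + real (Suc n) * q)" for n x
    have \<eta>: "\<eta> n x = indicator {p<..<q} x * exp (- inverse (real (Suc n) * (x - p)) - inverse (real (Suc n) * (q - x)))" for n x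
    proof -
      have "flat_exp 0 (real (Suc n) * x + (- real (Suc n) * p)) = (if x \<le> p then 0 else exp (- inverse (real (Suc n) * (x - p))))"
        unfolding flat_exp_def by (simp add: algebra_simps mult_le_cancel_left_pos del: of_nat_Suc)
      moreover have "flat_exp 0 (- real (Suc n) * x + real (Suc n) * q) = (if q \<le> x then 0 else exp (- inverse (real (Suc n) * (q - x))))"
        unfolding flat_exp_def by (simp add: algebra_simps mult_le_cancel_left_pos del: of_nat_Suc)
      ultimately show ?thesis unfolding \<eta>_def by (auto simp: mult_exp_exp split: split_indicator)
    qed
    have t: "test_function (\<eta> n)" for n
      unfolding test_function_iff
    proof
      show "smooth (\<eta> n)" unfolding \<eta>_def[abs_def] by (intro smooth_mult smooth_affine smooth_flat_exp)
      show "\<exists>R. \<forall>x. R < \<bar>x\<bar> \<longrightarrow> \<eta> n x = 0"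
        by (intro exI[of _ "max \<bar>p\<bar> \<bar>q\<bar>"]) (auto simp: \<eta> split: split_indicator)
    qed
    have "(\<lambda>n. LINT x|lebesgue. w x * complex_of_real (\<eta> n x)) \<longlonglongrightarrow> (LINT x|lebesgue. w x * complex_of_real (indicator {p<..<q} x))"
    proof (rule integral_dominated_convergence[where w = "\<lambda>x. norm (w x * complex_of_real (indicator {p..q} x))"])
      show "integrable lebesgue (\<lambda>x. norm (w x * complex_of_real (indicator {p..q} x)))" using i by (rule integrable_norm)
      have "\<eta> n \<in> borel_measurable lebesgue" for n using compact_supp_borel[OF compact_supp_test[OF t]] by (intro measurable_completion) simp
      then show "(\<lambda>x. w x * complex_of_real (\<eta> n x)) \<in> borel_measurable lebesgue" for n
        using m by (intro borel_measurable_times borel_measurable_of_real) auto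
      show "(\<lambda>x. w x * complex_of_real (indicator {p<..<q} x)) \<in> borel_measurable lebesgue"
        using m by (intro borel_measurable_times borel_imp_lebesgue[of "\<lambda>x. complex_of_real (indicator {p<..<q} x)"]) auto
      show "AE x in lebesgue. norm (w x * complex_of_real (\<eta> n x)) \<le> norm (w x * complex_of_real (indicator {p..q} x))" for n
      proof (intro always_eventually allI)
        fix x
        have "\<bar>\<eta> n x\<bar> \<le> indicator {p..q} x"
        proof (cases "x \<in> {p<..<q}")
          case True
          then have "0 \<le> inverse (real (Suc n) * (x - p))" "0 \<le> inverse (real (Suc n) * (q - x))" by auto
          then have "- inverse (real (Suc n) * (x - p)) - inverse (real (Suc n) * (q - x)) \<le> 0" by linarith
          then show ?thesis unfolding \<eta> using True by (simp del: of_nat_Suc inverse_mult_distrib)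
        qed (simp add: \<eta>)
        then show "norm (w x * complex_of_real (\<eta> n x)) \<le> norm (w x * complex_of_real (indicator {p..q} x))"
          by (simp add: norm_mult mult_left_mono)
      qed
      show "AE x in lebesgue. (\<lambda>n. w x * complex_of_real (\<eta> n x)) \<longlonglongrightarrow> w x * complex_of_real (indicator {p<..<q} x)"
      proof (intro always_eventually allI tendsto_intros)
        fix x
        have l: "(\<lambda>n. inverse (real (Suc n) * c)) \<longlonglongrightarrow> 0" for c :: real
          using tendsto_mult[OF LIMSEQ_inverse_real_of_nat tendsto_const[of "inverse c"]]
          by (simp add: inverse_mult_distrib)
        have "(\<lambda>n. indicator {p<..<q} x * exp (- inverse (real (Suc n) * (x - p)) - inverse (real (Suc n) * (q - x))))
           \<longlonglongrightarrow> indicator {p<..<q} x * exp (- 0 - 0)"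
          by (intro tendsto_intros l)
        then show "(\<lambda>n. \<eta> n x) \<longlonglongrightarrow> indicator {p<..<q} x" unfolding \<eta> by simp
      qed
    qed
    moreover have "(LINT x|lebesgue. w x * complex_of_real (\<eta> n x)) = 0" for n by (rule z[OF t])
    ultimately show ?thesis by (simp add: LIMSEQ_const_iff)
  qed
  have ii: "integrable lebesgue (\<lambda>x. w x * complex_of_real (indicator {p<..<q} x))" for p q
    using i[of p q] by (rule Bochner_Integration.integrable_bound)
      (use m in \<open>auto intro!: borel_measurable_times borel_imp_lebesgue[of "\<lambda>x. complex_of_real (indicator {p<..<q} x)"] split: split_indicator\<close>)
  have "AE x in lebesgue. Re (w x) = 0"
  proof (rule AE_zero_intervals)
    show "(\<lambda>x. Re (w x)) \<in> borel_measurable lebesgue" using m by measurable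
    show "integrable lebesgue (\<lambda>x. indicator {p..q} x * Re (w x))" for p q
      using integrable_Re[OF i[of p q]] by (simp add: mult.commute)
    show "(LINT x|lebesgue. indicator {p<..<q} x * Re (w x)) = 0" if "p < q" for p q
      using integral_Re[OF ii[of p q]] int[OF that] by (simp add: mult.commute)
  qed
  moreover have "AE x in lebesgue. Im (w x) = 0"
  proof (rule AE_zero_intervals)
    show "(\<lambda>x. Im (w x)) \<in> borel_measurable lebesgue" using m by measurable
    show "integrable lebesgue (\<lambda>x. indicator {p..q} x * Im (w x))" for p q
      using integrable_Im[OF i[of p q]] by (simp add: mult.commute)
    show "(LINT x|lebesgue. indicator {p<..<q} x * Im (w x)) = 0" if "p < q" for p q
      using integral_Im[OF ii[of p q]] int[OF that] by (simp add: mult.commute)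
  qed
  ultimately show ?thesis by eventually_elim (simp add: complex_eq_iff)
qed

text \<open>A nonempty open set is not a null set.\<close>

lemma AE_zero_continuous:
  fixes f :: "real \<Rightarrow> real"
  assumes c: "continuous_on UNIV f" and z: "AE x in lborel. f x = 0"
  shows "f x = 0"
proof (rule ccontr)
  assume "f x \<noteq> 0"
  let ?S = "{x. f x \<noteq> 0}"
  have o: "open ?S" using c by (intro open_Collect_neq continuous_intros)
  have "{x \<in> space lborel. \<not> f x = 0} \<in> null_sets lborel"
    using z o by (subst AE_iff_null[symmetric]) auto
  then have "negligible ?S" by (simp add: negligible_iff_null_sets null_sets_completionI)
  then show False using open_not_negligible[OF o] \<open>f x \<noteq> 0\<close> by blast
qed

lemma test_mult_smooth: "test_function f \<Longrightarrow> smooth g \<Longrightarrow> test_function (\<lambda>x. f x * g x)"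
  unfolding test_function_iff by (auto intro!: smooth_mult)

lemma test_add:
  assumes "test_function f" "test_function g" shows "test_function (\<lambda>x. f x + g x)"
  using assms compact_supp_add[OF compact_supp_test compact_supp_test, of f g] unfolding test_function_iff compact_supp_def by (auto intro!: smooth_add)

text \<open>The two functions \<open>b * sol (\<pi> / 2)\<close> and \<open>b * sol 0\<close>, with an even bump \<open>b\<close>, are orthogonal by
parity to the respective other solution.  Subtracting suitable multiples of them makes any test
function orthogonal to both solutions, and the eigenfunction annihilates the difference.  So, on
test functions, it acts like a combination of the solutions.\<close>

lemma eigenfunction_form:
  assumes u: "u \<in> L2" and P: "P_maps \<mu> u (\<lambda>\<theta>. complex_of_real e * u \<theta>)"
  shows "\<exists>C D. AE x in lebesgue. u x = C * complex_of_real (sol (pi / 2) e \<mu> x) + D * complex_of_real (sol 0 e \<mu> x)"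
proof -
  let ?a = "sol (pi / 2) e \<mu>" and ?b = "sol 0 e \<mu>"
  define b where "b x = flat_exp 0 (1 * x + 1) * flat_exp 0 (- 1 * x + 1)" for x
  have b_pos: "0 < b x" if "\<bar>x\<bar> < 1" for x using that unfolding b_def flat_exp_def by auto
  have b_even: "b (- x) = b x" for x unfolding b_def by (simp add: mult.commute add.commute)
  have b_nonneg: "0 \<le> b x" for x unfolding b_def flat_exp_def by auto
  have tb: "test_function b"
    unfolding test_function_iff
  proof
    show "smooth b" unfolding b_def[abs_def] by (intro smooth_mult smooth_affine smooth_flat_exp)
    show "\<exists>R. \<forall>x. R < \<bar>x\<bar> \<longrightarrow> b x = 0" by (intro exI[of _ 1]) (auto simp: b_def flat_exp_def)
  qed
  define \<eta>0 where "\<eta>0 x = b x * ?a x" for x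
  define \<eta>1 where "\<eta>1 x = b x * ?b x" for x
  have t0: "test_function \<eta>0" and t1: "test_function \<eta>1"
    unfolding \<eta>0_def[abs_def] \<eta>1_def[abs_def] by (intro test_mult_smooth tb smooth_sol)+
  have csm: "compact_supp (\<lambda>x. \<eta> x * sol \<alpha> e \<mu> x)" if "test_function \<eta>" for \<eta> \<alpha>
    using compact_supp_mult(1)[OF compact_supp_test[OF that] continuous_on_sol] .
  note csi = compact_supp_integrable[OF csm]
  have cross: "(LINT x|lborel. \<eta>0 x * ?b x) = 0" "(LINT x|lborel. \<eta>1 x * ?a x) = 0"
  proof -
    have "(LINT x|lborel. \<eta>0 x * ?b x) = (LINT x|lborel. \<eta>0 (- x) * ?b (- x))"
      using lborel_integral_real_affine[of "- 1" "\<lambda>x. \<eta>0 x * ?b x" 0] by simp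
    also have "\<dots> = - (LINT x|lborel. \<eta>0 x * ?b x)"
      unfolding \<eta>0_def b_even sol_even sol_odd by simp
    finally show "(LINT x|lborel. \<eta>0 x * ?b x) = 0" by simp
    moreover have "(\<lambda>x. \<eta>1 x * ?a x) = (\<lambda>x. \<eta>0 x * ?b x)" by (simp add: \<eta>0_def \<eta>1_def mult_ac)
    ultimately show "(LINT x|lborel. \<eta>1 x * ?a x) = 0" by simp
  qed
  have nz: "(LINT x|lborel. (b x * sol \<alpha> e \<mu> x) * sol \<alpha> e \<mu> x) \<noteq> 0"
    if x: "\<bar>x\<bar> < 1" "sol \<alpha> e \<mu> x \<noteq> 0" for \<alpha> x
  proof
    assume z: "(LINT x|lborel. (b x * sol \<alpha> e \<mu> x) * sol \<alpha> e \<mu> x) = 0"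
    have c: "compact_supp (\<lambda>x. (b x * sol \<alpha> e \<mu> x) * sol \<alpha> e \<mu> x)" by (intro csm test_mult_smooth tb smooth_sol)
    have "AE x in lborel. (b x * sol \<alpha> e \<mu> x) * sol \<alpha> e \<mu> x = 0"
      using z b_nonneg by (subst (asm) integral_nonneg_eq_0_iff_AE[OF compact_supp_integrable[OF c]]) (auto simp: mult.assoc)
    then have "(b x * sol \<alpha> e \<mu> x) * sol \<alpha> e \<mu> x = 0"
      using c unfolding compact_supp_def by (intro AE_zero_continuous[of "\<lambda>x. (b x * sol \<alpha> e \<mu> x) * sol \<alpha> e \<mu> x"]) auto
    then show False using x b_pos[of x] by auto
  qed
  \<comment> \<open>By parity the Gram matrix of the two solutions with weight \<open>b\<close> is diagonal.\<close>
  define m0 where "m0 = (LINT x|lborel. \<eta>0 x * ?a x)"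
  define m1 where "m1 = (LINT x|lborel. \<eta>1 x * ?b x)"
  have m0: "m0 \<noteq> 0" unfolding m0_def \<eta>0_def by (rule nz[of 0]) auto
  have m1: "m1 \<noteq> 0"
  proof -
    have "(?b has_real_derivative 1) (at 0)" using sol_has_deriv[of 0 e \<mu> 0] by simp
    then obtain d where d: "0 < d" "\<And>h. 0 < h \<Longrightarrow> h < d \<Longrightarrow> ?b 0 < ?b (0 + h)"
      using DERIV_pos_inc_right[of ?b 1 0] by auto
    have "?b 0 < ?b (0 + min (d / 2) (1 / 2))" using d(1) by (intro d(2)) auto
    then show ?thesis unfolding m1_def \<eta>1_def using d(1) by (intro nz[of "min (d / 2) (1 / 2)"]) auto
  qed
  define C where "C = (LINT x|lebesgue. u x * complex_of_real (\<eta>0 x)) / complex_of_real m0"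
  define D where "D = (LINT x|lebesgue. u x * complex_of_real (\<eta>1 x)) / complex_of_real m1"
  define v where "v x = C * complex_of_real (?a x) + D * complex_of_real (?b x)" for x
  have vb: "v \<in> borel_measurable borel" unfolding v_def[abs_def] by measurable
  have vm: "v \<in> borel_measurable lebesgue" by (rule borel_imp_lebesgue[OF vb])
  have um: "u \<in> borel_measurable lebesgue" using u unfolding L2_def by simp
  have li: "integrable lebesgue (\<lambda>x. complex_of_real (f x)) " "(LINT x|lebesgue. complex_of_real (f x)) = complex_of_real (LINT x|lborel. f x)"
    if "integrable lborel f" for f
  proof -
    have m: "(\<lambda>x. complex_of_real (f x)) \<in> borel_measurable lborel" using that by auto
    show "integrable lebesgue (\<lambda>x. complex_of_real (f x))"
      using that by (subst integrable_completion[OF m]) (rule integrable_of_real)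
    show "(LINT x|lebesgue. complex_of_real (f x)) = complex_of_real (LINT x|lborel. f x)"
      by (subst integral_completion[OF m]) (rule integral_complex_of_real)
  qed
  have "AE x in lebesgue. u x - v x = 0"
  proof (rule fundamental_lemma)
    show "(\<lambda>x. u x - v x) \<in> borel_measurable lebesgue" using um vm by (rule borel_measurable_diff)
  next
    fix p q
    have "integrable lebesgue (\<lambda>x. u x * complex_of_real (indicator {p..q} x))"
      by (rule L2_mult_integrable[OF u, of _ 1 "max \<bar>p\<bar> \<bar>q\<bar>"]) (auto split: split_indicator)
    moreover have "integrable lebesgue (\<lambda>x. v x * complex_of_real (indicator {p..q} x))"
    proof -
      have *: "integrable lebesgue (\<lambda>x. complex_of_real (sol \<alpha> e \<mu> x * indicator {p..q} x))" for \<alpha>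
        by (intro li(1) borel_integrable_atLeastAtMost) (auto intro: DERIV_isCont[OF sol_has_deriv])
      have "integrable lebesgue (\<lambda>x. C * complex_of_real (?a x * indicator {p..q} x) + D * complex_of_real (?b x * indicator {p..q} x))"
        by (intro Bochner_Integration.integrable_add integrable_mult_right *)
      then show ?thesis unfolding v_def by (simp add: algebra_simps)
    qed
    ultimately show "integrable lebesgue (\<lambda>x. (u x - v x) * complex_of_real (indicator {p..q} x))"
      unfolding left_diff_distrib by (rule Bochner_Integration.integrable_diff)
  next
    fix \<eta> assume t: "test_function \<eta>"
    define s0 where "s0 = (LINT x|lborel. \<eta> x * ?a x)"
    define s1 where "s1 = (LINT x|lborel. \<eta> x * ?b x)"
    \<comment> \<open>The part of \<open>\<eta>\<close> that is orthogonal to both solutions.\<close>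
    define h where "h x = \<eta> x + (\<eta>0 x * (- s0 / m0) + \<eta>1 x * (- s1 / m1))" for x
    have th: "test_function h" unfolding h_def[abs_def]
      by (intro test_add t test_mult_smooth t0 t1 smooth_const)
    have "(LINT x|lborel. h x * ?a x) = 0"
    proof -
      have eq: "(\<lambda>x. h x * ?a x) = (\<lambda>x. \<eta> x * ?a x + ((\<eta>0 x * ?a x) * (- s0 / m0) + (\<eta>1 x * ?a x) * (- s1 / m1)))"
        unfolding h_def by (simp add: algebra_simps)
      have "(LINT x|lborel. h x * ?a x) = s0 + (m0 * (- s0 / m0) + 0 * (- s1 / m1))"
        unfolding eq by (simp only: Bochner_Integration.integral_add integral_mult_left_zero csi t t0 t1
            integrable_mult_left Bochner_Integration.integrable_add cross s0_def m0_def)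
      then show ?thesis using m0 by simp
    qed
    moreover have "(LINT x|lborel. h x * ?b x) = 0"
    proof -
      have eq: "(\<lambda>x. h x * ?b x) = (\<lambda>x. \<eta> x * ?b x + ((\<eta>0 x * ?b x) * (- s0 / m0) + (\<eta>1 x * ?b x) * (- s1 / m1)))"
        unfolding h_def by (simp add: algebra_simps)
      have "(LINT x|lborel. h x * ?b x) = s1 + (0 * (- s0 / m0) + m1 * (- s1 / m1))"
        unfolding eq by (simp only: Bochner_Integration.integral_add integral_mult_left_zero csi t t0 t1
            integrable_mult_left Bochner_Integration.integrable_add cross s1_def m1_def)
      then show ?thesis using m1 by simp
    qed
    ultimately have z: "(LINT x|lebesgue. u x * complex_of_real (h x)) = 0"
      by (rule eigen_annihilates[OF u P th])
    let ?U = "\<lambda>f. LINT x|lebesgue. u x * complex_of_real (f x)"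
    note ui = L2_compact_supp_integrable[OF u compact_supp_test]
    have "(\<lambda>x. u x * complex_of_real (h x)) = (\<lambda>x. u x * complex_of_real (\<eta> x)
        + ((u x * complex_of_real (\<eta>0 x)) * complex_of_real (- s0 / m0) + (u x * complex_of_real (\<eta>1 x)) * complex_of_real (- s1 / m1)))"
      unfolding h_def by (simp add: algebra_simps)
    then have "?U h = ?U \<eta> + (?U \<eta>0 * complex_of_real (- s0 / m0) + ?U \<eta>1 * complex_of_real (- s1 / m1))"
      by (simp only: Bochner_Integration.integral_add integral_mult_left_zero ui t t0 t1 integrable_mult_left Bochner_Integration.integrable_add)
    then have U: "?U \<eta> = C * complex_of_real s0 + D * complex_of_real s1"
      unfolding z C_def D_def by (simp add: field_simps eq_neg_iff_add_eq_0)
    have vi: "integrable lebesgue (\<lambda>x. C * complex_of_real (\<eta> x * ?a x))" "integrable lebesgue (\<lambda>x. D * complex_of_real (\<eta> x * ?b x))"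
      by (intro integrable_mult_right li(1) csi t)+
    have veq: "(\<lambda>x. v x * complex_of_real (\<eta> x)) = (\<lambda>x. C * complex_of_real (\<eta> x * ?a x) + D * complex_of_real (\<eta> x * ?b x))"
      unfolding v_def by (simp add: algebra_simps)
    have V: "(LINT x|lebesgue. v x * complex_of_real (\<eta> x)) = C * complex_of_real s0 + D * complex_of_real s1"
      unfolding veq Bochner_Integration.integral_add[OF vi]
      by (simp only: integral_mult_right_zero li(2)[OF csi[OF t]] s0_def s1_def)
    have "integrable lebesgue (\<lambda>x. v x * complex_of_real (\<eta> x))"
      unfolding veq by (rule Bochner_Integration.integrable_add[OF vi])
    then have "(LINT x|lebesgue. u x * complex_of_real (\<eta> x) - v x * complex_of_real (\<eta> x)) = 0"
      using Bochner_Integration.integral_diff[OF ui[OF t]] U V by simp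
    then show "(LINT x|lebesgue. (u x - v x) * complex_of_real (\<eta> x)) = 0"
      by (simp add: left_diff_distrib)
  qed
  then have "AE x in lebesgue. u x = v x" by eventually_elim simp
  then show ?thesis unfolding v_def by blast
qed

section \<open>Identification of the spectrum\<close>

lemma nn_reflect:
  assumes "f \<in> borel_measurable borel"
  shows "(\<integral>\<^sup>+x. f (- x) \<partial>lborel) = (\<integral>\<^sup>+x. f (x::real) \<partial>lborel)"
  using nn_integral_real_affine[OF assms, of "- 1" 0] by simp

text \<open>Adding the square of a combination and of its reflection removes the mixed terms, by the
parallelogram identity, so each component with a nonzero coefficient is square integrable.\<close>

lemma eigen_sq_int:
  assumes "e \<in> P_eigenvalues \<mu>"
  shows "(\<integral>\<^sup>+x. ennreal ((sol (pi / 2) e \<mu> x)\<^sup>2) * indicator {0..} x \<partial>lborel) < \<infinity>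
    \<or> (\<integral>\<^sup>+x. ennreal ((sol 0 e \<mu> x)\<^sup>2) * indicator {0..} x \<partial>lborel) < \<infinity>"
proof -
  let ?a = "sol (pi / 2) e \<mu>" and ?b = "sol 0 e \<mu>"
  obtain u where u: "u \<in> L2" "\<not> (AE \<theta> in lebesgue. u \<theta> = 0)" "P_maps \<mu> u (\<lambda>\<theta>. complex_of_real e * u \<theta>)"
    using assms unfolding P_eigenvalues_def P_domain_def by auto
  obtain C D where cd: "AE x in lebesgue. u x = C * complex_of_real (?a x) + D * complex_of_real (?b x)"
    using eigenfunction_form[OF u(1,3)] by blast
  let ?f = "\<lambda>x. ennreal ((cmod (C * complex_of_real (?a x) + D * complex_of_real (?b x)))\<^sup>2)"
  have fm: "?f \<in> borel_measurable borel" by measurable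
  have "integrable lebesgue (\<lambda>x. (cmod (u x))\<^sup>2)" using u(1) unfolding L2_def by simp
  then have "(\<integral>\<^sup>+x. ennreal ((cmod (u x))\<^sup>2) \<partial>lebesgue) < \<infinity>"
    by (subst (asm) integrable_iff_bounded) simp
  also have "(\<integral>\<^sup>+x. ennreal ((cmod (u x))\<^sup>2) \<partial>lebesgue) = (\<integral>\<^sup>+x. ?f x \<partial>lebesgue)"
    using cd by (intro nn_integral_cong_AE) (auto elim!: eventually_mono)
  also have "\<dots> = (\<integral>\<^sup>+x. ?f x \<partial>lborel)" by (rule nn_integral_completion)
  finally have fin: "(\<integral>\<^sup>+x. ?f x \<partial>lborel) < \<infinity>" .
  then have fin': "(\<integral>\<^sup>+x. ?f (- x) \<partial>lborel) < \<infinity>" by (subst nn_reflect[OF fm])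
  have fm': "(\<lambda>x. ?f (- x)) \<in> borel_measurable borel" by measurable
  have "(\<integral>\<^sup>+x. ?f x + ?f (- x) \<partial>lborel) < \<infinity>"
    using fin fin' by (subst nn_integral_add) (use fm fm' in auto)
  also have "(\<lambda>x. ?f x + ?f (- x)) = (\<lambda>x. ennreal (2 * (cmod C)\<^sup>2 * (?a x)\<^sup>2 + 2 * (cmod D)\<^sup>2 * (?b x)\<^sup>2))"
  proof
    fix x
    have "(cmod (C * complex_of_real (?a x) + D * complex_of_real (?b x)))\<^sup>2 + (cmod (C * complex_of_real (?a x) - D * complex_of_real (?b x)))\<^sup>2
      = 2 * (cmod (C * complex_of_real (?a x)))\<^sup>2 + 2 * (cmod (D * complex_of_real (?b x)))\<^sup>2"
      by (simp only: cmod_power2) (simp add: power2_eq_square algebra_simps)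
    then show "?f x + ?f (- x) = ennreal (2 * (cmod C)\<^sup>2 * (?a x)\<^sup>2 + 2 * (cmod D)\<^sup>2 * (?b x)\<^sup>2)"
      unfolding sol_even sol_odd
      by (simp add: norm_mult power_mult_distrib mult.assoc flip: ennreal_plus)
  qed
  finally have sum: "(\<integral>\<^sup>+x. ennreal (2 * (cmod C)\<^sup>2 * (?a x)\<^sup>2 + 2 * (cmod D)\<^sup>2 * (?b x)\<^sup>2) \<partial>lborel) < \<infinity>" .
  have part: "(\<integral>\<^sup>+x. ennreal ((g x)\<^sup>2) * indicator {0..} x \<partial>lborel) < \<infinity>"
    if c: "0 < c" and g: "g \<in> borel_measurable borel"
      and le: "\<And>x. c * (g x)\<^sup>2 \<le> 2 * (cmod C)\<^sup>2 * (?a x)\<^sup>2 + 2 * (cmod D)\<^sup>2 * (?b x)\<^sup>2" for c g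
  proof -
    have "ennreal c * (\<integral>\<^sup>+x. ennreal ((g x)\<^sup>2) * indicator {0..} x \<partial>lborel)
       = (\<integral>\<^sup>+x. ennreal c * (ennreal ((g x)\<^sup>2) * indicator {0..} x) \<partial>lborel)"
    proof (rule nn_integral_cmult[symmetric])
      note [measurable] = g
      show "(\<lambda>x. ennreal ((g x)\<^sup>2) * indicator {0..} x) \<in> borel_measurable lborel" by measurable
    qed
    also have "\<dots> \<le> (\<integral>\<^sup>+x. ennreal (2 * (cmod C)\<^sup>2 * (?a x)\<^sup>2 + 2 * (cmod D)\<^sup>2 * (?b x)\<^sup>2) \<partial>lborel)"
    proof (intro nn_integral_mono)
      fix x
      have "ennreal c * ennreal ((g x)\<^sup>2) \<le> ennreal (2 * (cmod C)\<^sup>2 * (?a x)\<^sup>2 + 2 * (cmod D)\<^sup>2 * (?b x)\<^sup>2)"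
        using c le[of x] by (subst ennreal_mult[symmetric]) (auto intro!: ennreal_leI simp del: ennreal_plus)
      then show "ennreal c * (ennreal ((g x)\<^sup>2) * indicator {0..} x)
          \<le> ennreal (2 * (cmod C)\<^sup>2 * (?a x)\<^sup>2 + 2 * (cmod D)\<^sup>2 * (?b x)\<^sup>2)"
        by (simp split: split_indicator del: ennreal_plus)
    qed
    also have "\<dots> < \<infinity>" by (rule sum)
    finally show ?thesis using c by (auto simp: ennreal_mult_less_top)
  qed
  have "C \<noteq> 0 \<or> D \<noteq> 0"
  proof (rule ccontr)
    assume "\<not> ?thesis"
    then have "AE x in lebesgue. u x = 0" using cd by simp
    then show False using u(2) by simp
  qed
  then show ?thesis
  proof
    assume "C \<noteq> 0"
    then have "(\<integral>\<^sup>+x. ennreal ((?a x)\<^sup>2) * indicator {0..} x \<partial>lborel) < \<infinity>"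
      by (intro part[of "2 * (cmod C)\<^sup>2"]) auto
    then show ?thesis ..
  next
    assume "D \<noteq> 0"
    then have "(\<integral>\<^sup>+x. ennreal ((?b x)\<^sup>2) * indicator {0..} x \<partial>lborel) < \<infinity>"
      by (intro part[of "2 * (cmod D)\<^sup>2"]) auto
    then show ?thesis ..
  qed
qed

text \<open>The classical solution satisfies the weak equation after integration by parts, which produces no
boundary terms against test functions.\<close>

lemma sq_int_eigen:
  assumes a: "\<alpha> = 0 \<or> \<alpha> = pi / 2"
    and fin: "(\<integral>\<^sup>+x. ennreal ((sol \<alpha> e \<mu> x)\<^sup>2) * indicator {0..} x \<partial>lborel) < \<infinity>"
  shows "e \<in> P_eigenvalues \<mu>"
proof -
  let ?a = "sol \<alpha> e \<mu>"
  let ?u = "\<lambda>x. complex_of_real (?a x)"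
  let ?g = "\<lambda>x. ennreal ((?a x)\<^sup>2) * indicator {0..} x"
  have sq: "(?a (- x))\<^sup>2 = (?a x)\<^sup>2" for x
    by (rule disjE[OF a]) (simp_all only: sol_even sol_odd power2_minus)
  have gm: "?g \<in> borel_measurable borel" by measurable
  have "(\<integral>\<^sup>+x. ennreal ((?a x)\<^sup>2) \<partial>lborel) \<le> (\<integral>\<^sup>+x. ?g x + ?g (- x) \<partial>lborel)"
    by (intro nn_integral_mono) (auto simp: sq split: split_indicator)
  also have "\<dots> = (\<integral>\<^sup>+x. ?g x \<partial>lborel) + (\<integral>\<^sup>+x. ?g (- x) \<partial>lborel)"
    by (intro nn_integral_add) measurable
  also have "\<dots> < \<infinity>" unfolding nn_reflect[OF gm] using fin by simp
  finally have fin2: "(\<integral>\<^sup>+x. ennreal ((?a x)\<^sup>2) \<partial>lborel) < \<infinity>" .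
  have um: "?u \<in> borel_measurable borel" by measurable
  have "integrable lborel (\<lambda>x. (cmod (?u x))\<^sup>2)"
    using fin2 by (intro integrableI_bounded) auto
  then have "integrable lebesgue (\<lambda>x. (cmod (?u x))\<^sup>2)" by (subst integrable_completion) auto
  then have L: "?u \<in> L2" unfolding L2_def using borel_imp_lebesgue[OF um] by simp
  have L': "(\<lambda>x. complex_of_real e * ?u x) \<in> L2"
  proof -
    have "integrable lebesgue (\<lambda>x. e\<^sup>2 * (cmod (?u x))\<^sup>2)" using L unfolding L2_def by (intro integrable_mult_right) simp
    moreover have "(\<lambda>x. complex_of_real e * ?u x) \<in> borel_measurable lebesgue"
      by (intro borel_imp_lebesgue) measurable
    ultimately show ?thesis unfolding L2_def by (simp add: norm_mult power_mult_distrib)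
  qed
  have P: "P_maps \<mu> ?u (\<lambda>x. complex_of_real e * ?u x)"
    unfolding P_maps_def
  proof (intro allI impI)
    fix f assume t: "test_function f"
    have sm: "smooth f" using t unfolding test_function_iff by simp
    define f1 where "f1 = deriv f"
    define f2 where "f2 = deriv f1"
    have d: "(f has_real_derivative f1 x) (at x)" "(f1 has_real_derivative f2 x) (at x)" for x
      using smooth_deriv(2)[OF sm] smooth_deriv(2)[OF smooth_deriv(1)[OF sm]] unfolding f1_def f2_def by auto
    have c2: "continuous_on UNIV f2"
      unfolding f2_def f1_def by (intro smooth_continuous smooth_deriv sm)
    obtain R where R: "0 < R" "\<And>x. R \<le> \<bar>x\<bar> \<Longrightarrow> f x = 0" using compact_supp_bound[OF compact_supp_test[OF t]] by blast
    have z: "f1 x = 0" "f2 x = 0" if x: "R < \<bar>x\<bar>" for x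
    proof -
      have o: "open {x. R < \<bar>x\<bar>}" by (intro open_Collect_less continuous_intros)
      have z1: "f1 x = 0" if x: "R < \<bar>x\<bar>" for x
      proof -
        have "((\<lambda>x. 0) has_real_derivative 0) (at x)" by simp
        then have "(f has_real_derivative 0) (at x)"
          by (rule has_field_derivative_transform_within_open[OF _ o]) (use x R in auto)
        then show ?thesis using d(1) DERIV_unique by blast
      qed
      show "f1 x = 0" by (rule z1[OF x])
      have "((\<lambda>x. 0) has_real_derivative 0) (at x)" by simp
      then have "(f1 has_real_derivative 0) (at x)"
        by (rule has_field_derivative_transform_within_open[OF _ o]) (use x z1 in auto)
      then show "f2 x = 0" using d(2) DERIV_unique by blast
    qed
    let ?h = "\<lambda>x. ?a x * (- f2 x + (pot \<mu> x - e) * f x)"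
    let ?F = "\<lambda>x. dsol \<alpha> e \<mu> x * f x - ?a x * f1 x"
    have csf2: "compact_supp (\<lambda>x. ?a x * (- f2 x))"
      using c2 z(2) unfolding compact_supp_def by (auto intro!: continuous_intros continuous_on_sol exI[of _ R])
    have csf: "compact_supp (\<lambda>x. ?a x * (c x * f x))" if "continuous_on UNIV c" for c
      using compact_supp_test[OF t] that by (intro compact_supp_mult(2) continuous_on_sol)
    have cp: "continuous_on UNIV (\<lambda>x. pot \<mu> x - e)" "continuous_on UNIV (pot \<mu>)" "continuous_on UNIV (\<lambda>x. e)"
      unfolding pot_def[abs_def] by (auto intro!: continuous_intros)
    have csh: "compact_supp ?h"
      using compact_supp_add[OF csf2 csf[OF cp(1)]] by (simp add: algebra_simps)
    have "(LINT x|lborel. ?h x) = ?F (R + 1) - ?F (- (R + 1))"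
    proof (rule compact_supp_integral_FTC[OF csh])
      show "?h x = 0" if "R + 1 \<le> \<bar>x\<bar>" for x using z[of x] R(2)[of x] that by simp
      show "(?F has_real_derivative ?h x) (at x)" for x
        by (auto intro!: derivative_eq_intros sol_has_deriv dsol_has_deriv d simp: algebra_simps)
    qed (use R in auto)
    also have "\<dots> = 0" using R z by simp
    finally have h0: "(LINT x|lborel. ?h x) = 0" .
    have heq: "?h = (\<lambda>x. (?a x * (- f2 x) + ?a x * (pot \<mu> x * f x)) - ?a x * (e * f x))"
      by (simp add: fun_eq_iff algebra_simps)
    note i1 = compact_supp_integrable[OF compact_supp_add[OF csf2 csf[OF cp(2)]]] and i2 = compact_supp_integrable[OF csf[OF cp(3)]]
    have main: "(LINT x|lborel. ?a x * (- f2 x) + ?a x * (pot \<mu> x * f x)) = (LINT x|lborel. ?a x * (e * f x))"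
      using h0 Bochner_Integration.integral_diff[OF i1 i2] unfolding heq by simp
    have conv: "(LINT x|lebesgue. complex_of_real (k x)) = complex_of_real (LINT x|lborel. k x)"
      if "k \<in> borel_measurable borel" for k
      by (subst integral_completion) (use that in \<open>auto simp: integral_complex_of_real\<close>)
    have dd: "(deriv ^^ 2) f = f2" unfolding f2_def f1_def by (simp add: numeral_2_eq_2)
    have "(LINT \<theta>|lebesgue. ?u \<theta> * complex_of_real (- (deriv ^^ 2) f \<theta> + (\<theta>\<^sup>2 / 2 - \<mu>)\<^sup>2 * f \<theta>))
       = (LINT \<theta>|lebesgue. complex_of_real (?a \<theta> * (- f2 \<theta>) + ?a \<theta> * (pot \<mu> \<theta> * f \<theta>)))"
      unfolding dd pot_def by (simp add: algebra_simps)
    also have "\<dots> = complex_of_real (LINT x|lborel. ?a x * (- f2 x) + ?a x * (pot \<mu> x * f x))"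
      using i1 by (intro conv) auto
    also have "\<dots> = (LINT \<theta>|lebesgue. complex_of_real (?a \<theta> * (e * f \<theta>)))"
      unfolding main using i2 by (intro conv[symmetric]) auto
    also have "\<dots> = (LINT \<theta>|lebesgue. complex_of_real e * ?u \<theta> * complex_of_real (f \<theta>))"
      by (simp add: algebra_simps)
    finally show "(LINT \<theta>|lebesgue. ?u \<theta> * complex_of_real (- (deriv ^^ 2) f \<theta> + (\<theta>\<^sup>2 / 2 - \<mu>)\<^sup>2 * f \<theta>))
       = (LINT \<theta>|lebesgue. complex_of_real e * ?u \<theta> * complex_of_real (f \<theta>))" .
  qed
  have "\<not> (AE x in lebesgue. ?u x = 0)"
  proof
    assume "AE x in lebesgue. ?u x = 0"
    then have "AE x in lborel. ?a x = 0" by (simp add: AE_completion_iff)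
    then have z: "?a x = 0" for x by (rule AE_zero_continuous[OF continuous_on_sol])
    then have "dsol \<alpha> e \<mu> 0 = 0" using DERIV_unique[OF sol_has_deriv[of \<alpha> e \<mu> 0], of 0]
      by (metis (no_types, lifting) DERIV_const ext)
    then show False using sol_nonzero[of \<alpha> e \<mu> 0] z by blast
  qed
  moreover have "?u \<in> P_domain \<mu>" unfolding P_domain_def using L bexI[of "P_maps \<mu> ?u", OF P L'] by simp
  ultimately show ?thesis unfolding P_eigenvalues_def using P
    by (intro CollectI bexI[of _ ?u]) simp_all
qed

theorem P_eigenvalues_eq: "P_eigenvalues \<mu> = range (\<lambda>m. energy m \<mu>)"
proof -
  have "e \<in> P_eigenvalues \<mu> \<longleftrightarrow> (\<exists>k\<ge>1. e = level (pi / 2) k \<mu>) \<or> (\<exists>k\<ge>1. e = level 0 k \<mu>)" for e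
    using eigen_sq_int[of e \<mu>] sq_int_eigen[of "pi / 2" e \<mu>] sq_int_eigen[of 0 e \<mu>]
      sq_int_iff[of "pi / 2" e \<mu>] sq_int_iff[of 0 e \<mu>] by auto
  then show ?thesis unfolding range_energy by blast
qed

theorem eigval_eq: "eigval m \<mu> = energy m \<mu>"
proof -
  have "(THE e :: nat \<Rightarrow> real. strict_mono e \<and> range e = P_eigenvalues \<mu>) = (\<lambda>m. energy m \<mu>)"
    using strict_mono_energy P_eigenvalues_eq strict_mono_range_unique
    by (intro the_equality) (auto intro!: strict_mono_range_unique)
  then show ?thesis unfolding eigval_def by simp
qed

section \<open>Bounds for the eigenvalues\<close>

text \<open>Two angles of nearby directions whose sines have the same sign lie on the same side of each multiple
of \<open>\<pi>\<close>.\<close>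

lemma same_sign_angle:
  assumes "\<bar>s - t\<bar> < pi / 2" "sin t = K * sin s" "0 < K" "real k * pi < s"
  shows "real k * pi < t"
proof (rule ccontr)
  assume "\<not> ?thesis"
  then have t: "t \<le> real k * pi" by simp
  have "0 < sin (s - real k * pi)" using assms t by (intro sin_gt_zero) auto
  moreover have "0 \<le> sin (real k * pi - t)" using assms t by (intro sin_ge_zero) auto
  moreover have "sin (real k * pi - t) = - K * sin (s - real k * pi)"
    using assms(2) by (cases "even k") (simp_all add: sin_diff)
  ultimately show False using mult_pos_pos[OF assms(3), of "sin (s - real k * pi)"] by simp
qed

text \<open>Replacing \<open>u\<close> by \<open>s u\<close> adapts the angle to the energy scale.  The two vectors \<open>(u', u)\<close> and
\<open>(u', s u)\<close> have a positive inner product, so the angles differ by less than \<open>\<pi> / 2\<close>, and they pass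
the multiples of \<open>\<pi>\<close> simultaneously.\<close>

lemma scaled_angle:
  assumes a: "\<alpha> = 0 \<or> \<alpha> = pi / 2" and s: "0 < s"
  shows "\<exists>\<theta>. is_angle \<theta> (\<lambda>x. s * sol \<alpha> e \<mu> x) (dsol \<alpha> e \<mu>) \<and> \<theta> 0 = \<alpha> \<and>
     (\<forall>x. \<bar>\<theta> x - angle \<alpha> e \<mu> x\<bar> < pi / 2) \<and>
     (\<forall>x k. real k * pi < angle \<alpha> e \<mu> x \<longleftrightarrow> real k * pi < \<theta> x)"
proof -
  let ?u = "\<lambda>x. s * sol \<alpha> e \<mu> x" and ?v = "dsol \<alpha> e \<mu>"
  have nz: "?u x \<noteq> 0 \<or> ?v x \<noteq> 0" for x using sol_nonzero[of \<alpha> e \<mu> x] s by auto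
  have "continuous_on UNIV ?u" by (intro continuous_intros continuous_on_sol)
  then obtain \<theta>0 where t0: "is_angle \<theta>0 ?u ?v"
    using angle_lift[OF _ continuous_on_dsol nz] unfolding is_angle_def by blast
  define r where "r x = sqrt ((?u x)\<^sup>2 + (?v x)\<^sup>2)" for x
  have r: "0 < r x" "?u x = r x * sin (\<theta>0 x)" "?v x = r x * cos (\<theta>0 x)" for x
    using t0 unfolding is_angle_def r_def by auto
  have sc: "sin (\<theta>0 0) = sin \<alpha>" "cos (\<theta>0 0) = cos \<alpha>"
  proof -
    have "sin (\<theta>0 0) = sin \<alpha> \<and> cos (\<theta>0 0) = cos \<alpha>"
    proof (rule disjE[OF a])
      assume [simp]: "\<alpha> = 0"
      have z: "sin (\<theta>0 0) = 0" using r(1,2)[of 0] by auto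
      moreover have "0 < cos (\<theta>0 0)" using r(1,3)[of 0] by (metis \<open>\<alpha> = 0\<close> cos_zero dsol_0 zero_less_mult_pos zero_less_one)
      ultimately show ?thesis using cos_squared_eq[of "\<theta>0 0"] by (simp add: power2_eq_1_iff)
    next
      assume \<alpha>: "\<alpha> = pi / 2"
      have z: "cos (\<theta>0 0) = 0" using r(1,3)[of 0] \<alpha> by auto
      have "0 < r 0 * sin (\<theta>0 0)" using r(2)[of 0] \<alpha> s by simp
      then have "0 < sin (\<theta>0 0)" using r(1)[of 0] by (simp add: zero_less_mult_iff)
      then show ?thesis using z sin_squared_eq[of "\<theta>0 0"] unfolding \<alpha> by (simp add: power2_eq_1_iff)
    qed
    then show "sin (\<theta>0 0) = sin \<alpha>" "cos (\<theta>0 0) = cos \<alpha>" by auto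
  qed
  define \<theta> where "\<theta> x = \<theta>0 x - (\<theta>0 0 - \<alpha>)" for x
  have per: "sin (\<theta> x) = sin (\<theta>0 x)" "cos (\<theta> x) = cos (\<theta>0 x)" for x
    unfolding \<theta>_def using sin_cos_shift[OF sc] by auto
  have ia: "is_angle \<theta> ?u ?v"
    using t0 unfolding is_angle_def per by (auto simp: \<theta>_def[abs_def] intro!: continuous_intros)
  have c0: "cos (\<theta> x - angle \<alpha> e \<mu> x) \<noteq> 0" for x
  proof -
    have "s * (sol \<alpha> e \<mu> x)\<^sup>2 + (dsol \<alpha> e \<mu> x)\<^sup>2 = ?u x * sol \<alpha> e \<mu> x + ?v x * dsol \<alpha> e \<mu> x"
      by (simp add: power2_eq_square)
    also have "\<dots> = r x * radius \<alpha> e \<mu> x * cos (\<theta> x - angle \<alpha> e \<mu> x)"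
      using arg_cong2[OF r(2) sol_angle, of "(*)" x \<alpha> e \<mu> x] arg_cong2[OF r(3) dsol_angle, of "(*)" x \<alpha> e \<mu> x]
      unfolding cos_diff per by (simp only:) (simp add: algebra_simps)
    finally have eq: "s * (sol \<alpha> e \<mu> x)\<^sup>2 + (dsol \<alpha> e \<mu> x)\<^sup>2 = r x * radius \<alpha> e \<mu> x * cos (\<theta> x - angle \<alpha> e \<mu> x)" .
    have "0 < s * (sol \<alpha> e \<mu> x)\<^sup>2 + (dsol \<alpha> e \<mu> x)\<^sup>2"
      using s sol_nonzero[of \<alpha> e \<mu> x] by (auto intro: add_pos_nonneg add_nonneg_pos)
    then show ?thesis unfolding eq by auto
  qed
  let ?D = "\<lambda>x. \<theta> x - angle \<alpha> e \<mu> x"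
  have D0: "?D 0 = 0" by (simp add: \<theta>_def)
  have cD: "continuous_on UNIV ?D"
    using ia is_angle_angle unfolding is_angle_def by (intro continuous_intros) auto
  have close: "\<bar>?D x\<bar> < pi / 2" for x
  proof (rule ccontr)
    assume n: "\<not> ?thesis"
    have "connected (?D ` UNIV)" using cD by (intro connected_continuous_image) auto
    note conn = connectedD_interval[OF this]
    have 0: "0 \<in> range ?D" using rangeI[of ?D 0] unfolding D0 .
    consider "pi / 2 \<le> ?D x" | "?D x \<le> - (pi / 2)" using n by linarith
    then have "pi / 2 \<in> range ?D \<or> - (pi / 2) \<in> range ?D"
    proof cases
      case 1
      then show ?thesis using conn[OF 0 rangeI[of ?D x], of "pi / 2"] by simp
    next
      case 2
      then show ?thesis using conn[OF rangeI[of ?D x] 0, of "- (pi / 2)"] by simp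
    qed
    then obtain y where "pi / 2 = ?D y \<or> - (pi / 2) = ?D y" unfolding image_iff by blast
    then have "cos (?D y) = 0" by (metis cos_minus cos_pi_half)
    then show False using c0[of y] by simp
  qed
  have K: "sin (\<theta> x) = (s * radius \<alpha> e \<mu> x / r x) * sin (angle \<alpha> e \<mu> x)" "0 < s * radius \<alpha> e \<mu> x / r x" for x
    using r(1)[of x] r(2)[of x] radius_pos[of \<alpha> e \<mu> x] s unfolding sol_angle per by (simp_all add: field_simps)
  have eqv: "real k * pi < angle \<alpha> e \<mu> x \<longleftrightarrow> real k * pi < \<theta> x" for x k
  proof
    assume "real k * pi < angle \<alpha> e \<mu> x"
    then show "real k * pi < \<theta> x"
      using close[of x] K[of x] by (intro same_sign_angle[of "angle \<alpha> e \<mu> x" "\<theta> x" "s * radius \<alpha> e \<mu> x / r x"]) (auto simp: abs_minus_commute)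
  next
    assume "real k * pi < \<theta> x"
    moreover have "sin (angle \<alpha> e \<mu> x) = inverse (s * radius \<alpha> e \<mu> x / r x) * sin (\<theta> x)"
    proof -
      have "X = inverse c * (c * X)" if "0 < c" for c X :: real using that by simp
      then show ?thesis unfolding K(1)[of x] using K(2)[of x] .
    qed
    ultimately show "real k * pi < angle \<alpha> e \<mu> x"
      using same_sign_angle[OF close[of x] _ positive_imp_inverse_positive[OF K(2)[of x]]] by blast
  qed
  show ?thesis using ia close eqv by (intro exI[of _ \<theta>]) (simp add: \<theta>_def)
qed

lemma scaled_angle_deriv:
  assumes ia: "is_angle \<theta> (\<lambda>x. s * sol \<alpha> e \<mu> x) (dsol \<alpha> e \<mu>)" and s: "0 < s"
  shows "(\<theta> has_real_derivative s * (cos (\<theta> x))\<^sup>2 + (e - pot \<mu> x) / s * (sin (\<theta> x))\<^sup>2) (at x)"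
proof -
  let ?u = "s * sol \<alpha> e \<mu> x" and ?v = "dsol \<alpha> e \<mu> x"
  have "((\<lambda>x. s * sol \<alpha> e \<mu> x) has_real_derivative s * dsol \<alpha> e \<mu> x) (at x)"
    by (intro DERIV_cmult sol_has_deriv)
  from is_angle_deriv[OF ia this dsol_has_deriv]
  have D: "(\<theta> has_real_derivative (s * ?v * ?v - ?u * ((pot \<mu> x - e) * sol \<alpha> e \<mu> x)) / (?u\<^sup>2 + ?v\<^sup>2)) (at x)" .
  define r where "r = sqrt (?u\<^sup>2 + ?v\<^sup>2)"
  have r: "0 < r" "?u = r * sin (\<theta> x)" "?v = r * cos (\<theta> x)" "?u\<^sup>2 + ?v\<^sup>2 = r\<^sup>2"
    using ia unfolding is_angle_def r_def by (auto simp: add_pos_nonneg)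
  have "s * ?v * ?v - ?u * ((pot \<mu> x - e) * sol \<alpha> e \<mu> x) = s * ?v\<^sup>2 + (e - pot \<mu> x) / s * ?u\<^sup>2"
    using s by (simp add: field_simps power2_eq_square)
  also have "\<dots> = r\<^sup>2 * (s * (cos (\<theta> x))\<^sup>2 + (e - pot \<mu> x) / s * (sin (\<theta> x))\<^sup>2)"
    unfolding r(2) r(3) by (simp add: power_mult_distrib algebra_simps)
  finally have "(s * ?v * ?v - ?u * ((pot \<mu> x - e) * sol \<alpha> e \<mu> x)) / (?u\<^sup>2 + ?v\<^sup>2)
     = s * (cos (\<theta> x))\<^sup>2 + (e - pot \<mu> x) / s * (sin (\<theta> x))\<^sup>2"
    unfolding r(4) using r(1) by simp
  with D show ?thesis by simp
qed

text \<open>Comparison with a harmonic oscillator of frequency \<open>w\<close>.  Let \<open>s\<^sup>2 = e + d\<close> and use the angle of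
\<open>(u', s u)\<close>.  At distance at least \<open>T = 2 s / w\<close> from the centre the potential is so large that the
angle cannot pass the values \<open>\<pi> / 2\<close> and \<open>k \<pi> - \<pi> / 6\<close> upwards.  Within distance \<open>T\<close> the speed is
at most \<open>s\<close>, which gains at most \<open>2 T s = 4 (e + d) / w\<close>.  To get from \<open>\<pi> / 2\<close> beyond
\<open>k \<pi> - \<pi> / 6\<close> at least \<open>(k - 2/3) \<pi> \<ge> k \<pi> / 3\<close> is needed.\<close>

lemma reach_lower_bound:
  assumes a: "\<alpha> = 0 \<or> \<alpha> = pi / 2" and k: "1 \<le> k" and re: "(e, \<mu>) \<in> reach \<alpha> k"
    and w: "0 < w" and d: "0 \<le> d" and x0: "0 \<le> x0"
    and V: "\<And>x. 0 \<le> x \<Longrightarrow> w\<^sup>2 * (x - x0)\<^sup>2 - d \<le> pot \<mu> x"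
  shows "pi * real k * w / 12 \<le> e + d"
proof (rule ccontr)
  assume n: "\<not> ?thesis"
  have a2: "\<alpha> \<le> pi / 2" using a by auto
  have e: "0 < e" using reach_pos[OF re k a2] .
  define s where "s = sqrt (e + d)"
  have s: "0 < s" "s\<^sup>2 = e + d" using e d unfolding s_def by auto
  obtain \<theta> where ia: "is_angle \<theta> (\<lambda>x. s * sol \<alpha> e \<mu> x) (dsol \<alpha> e \<mu>)" and t0: "\<theta> 0 = \<alpha>"
    and eqv: "\<And>x k. real k * pi < angle \<alpha> e \<mu> x \<longleftrightarrow> real k * pi < \<theta> x"
    using scaled_angle[OF a s(1), of e \<mu>] by blast
  note D = scaled_angle_deriv[OF ia s(1)]
  define T where "T = 2 * s / w"
  have T: "0 < T" "w\<^sup>2 * T\<^sup>2 = 4 * s\<^sup>2" using s w unfolding T_def by (auto simp: power_divide power_mult_distrib)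
  have q: "(e - pot \<mu> x) / s \<le> s - w\<^sup>2 * (x - x0)\<^sup>2 / s" if "0 \<le> x" for x
  proof -
    have "e - pot \<mu> x \<le> s\<^sup>2 - w\<^sup>2 * (x - x0)\<^sup>2" using V[OF that] s(2) by linarith
    then have "(e - pot \<mu> x) / s \<le> (s\<^sup>2 - w\<^sup>2 * (x - x0)\<^sup>2) / s" using s(1) by (intro divide_right_mono) auto
    then show ?thesis using s(1) by (simp add: diff_divide_distrib power2_eq_square)
  qed
  have outer: "\<theta> y \<le> c" if ab: "0 \<le> x" "x \<le> y" and c: "\<theta> x \<le> c" "1 / 4 \<le> (sin c)\<^sup>2"
    and o: "\<And>z. x \<le> z \<Longrightarrow> z \<le> y \<Longrightarrow> T \<le> \<bar>z - x0\<bar>" for x y c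
  proof -
    have "\<theta> y - c \<le> 0"
    proof (rule barrier[OF ab(2), of "\<lambda>z. \<theta> z - c" _ "4 * s"])
      fix z assume z: "x \<le> z" "z \<le> y"
      show "((\<lambda>z. \<theta> z - c) has_real_derivative s * (cos (\<theta> z))\<^sup>2 + (e - pot \<mu> z) / s * (sin (\<theta> z))\<^sup>2) (at z)"
        by (auto intro!: derivative_eq_intros D)
      assume pos: "0 < \<theta> z - c"
      have "T\<^sup>2 \<le> (z - x0)\<^sup>2" using o[OF z] T(1) by (metis abs_le_square_iff abs_of_pos)
      then have "w\<^sup>2 * T\<^sup>2 \<le> w\<^sup>2 * (z - x0)\<^sup>2" by (intro mult_left_mono) auto
      then have "4 * s \<le> w\<^sup>2 * (z - x0)\<^sup>2 / s" unfolding T(2) using s(1) by (simp add: field_simps power2_eq_square)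
      then have "(e - pot \<mu> z) / s \<le> - 3 * s" using q[of z] z ab by simp
      then have "(e - pot \<mu> z) / s * (sin (\<theta> z))\<^sup>2 \<le> - 3 * s * (sin (\<theta> z))\<^sup>2" by (rule mult_right_mono) auto
      then have "s * (cos (\<theta> z))\<^sup>2 + (e - pot \<mu> z) / s * (sin (\<theta> z))\<^sup>2 \<le> s * (1 - 4 * (sin (\<theta> z))\<^sup>2)"
        by (simp add: cos_squared_eq algebra_simps)
      also have "\<dots> \<le> s * (4 * (\<theta> z - c))"
      proof (rule mult_left_mono)
        have gen: "1 / 4 \<le> A \<Longrightarrow> A - B \<le> D \<Longrightarrow> 1 - 4 * B \<le> 4 * D" for A B D :: real by linarith
        have "(sin c)\<^sup>2 - (sin (\<theta> z))\<^sup>2 \<le> \<theta> z - c" using sin_sq_diff_le[of c "\<theta> z"] pos by linarith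
        then show "1 - 4 * (sin (\<theta> z))\<^sup>2 \<le> 4 * (\<theta> z - c)" by (rule gen[OF c(2)])
      qed (use s in simp)
      finally show "s * (cos (\<theta> z))\<^sup>2 + (e - pot \<mu> z) / s * (sin (\<theta> z))\<^sup>2 \<le> 4 * s * (\<theta> z - c)" by (simp only: mult_ac)
    qed (use c in simp)
    then show ?thesis by simp
  qed
  define x1 where "x1 = max 0 (x0 - T)"
  define x2 where "x2 = x0 + T"
  have xx: "0 \<le> x1" "x1 \<le> x2" "x2 - x1 \<le> 2 * T" using T x0 unfolding x1_def x2_def by auto
  have s1: "\<theta> x \<le> pi / 2" if "0 \<le> x" "x \<le> x1" for x
  proof (cases "x = 0")
    case True
    then show ?thesis using t0 a2 by simp
  next
    case False
    then have "x \<le> x0 - T" using that unfolding x1_def by auto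
    then show ?thesis using that t0 a2 by (intro outer[of 0 x]) auto
  qed
  have s2: "\<theta> x \<le> pi / 2 + 2 * T * s" if x: "x1 \<le> x" "x \<le> x2" for x
  proof -
    have "\<theta> x - s * x \<le> \<theta> x1 - s * x1"
    proof (rule DERIV_nonpos_imp_nonincreasing[OF x(1)])
      fix z assume z: "x1 \<le> z" "z \<le> x"
      have "0 \<le> w\<^sup>2 * (z - x0)\<^sup>2 / s" using s(1) by simp
      then have "(e - pot \<mu> z) / s \<le> s" using q[of z] z xx by simp
      then have "(e - pot \<mu> z) / s * (sin (\<theta> z))\<^sup>2 \<le> s * (sin (\<theta> z))\<^sup>2" by (rule mult_right_mono) auto
      then have "s * (cos (\<theta> z))\<^sup>2 + (e - pot \<mu> z) / s * (sin (\<theta> z))\<^sup>2 - s \<le> 0"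
        by (simp add: cos_squared_eq algebra_simps)
      moreover have "((\<lambda>z. \<theta> z - s * z) has_real_derivative s * (cos (\<theta> z))\<^sup>2 + (e - pot \<mu> z) / s * (sin (\<theta> z))\<^sup>2 - s) (at z)"
        by (auto intro!: derivative_eq_intros D)
      ultimately show "\<exists>y. ((\<lambda>z. \<theta> z - s * z) has_real_derivative y) (at z) \<and> y \<le> 0" by blast
    qed
    then have "\<theta> x \<le> \<theta> x1 + s * (x - x1)" by (simp add: algebra_simps)
    also have "\<dots> \<le> pi / 2 + s * (2 * T)"
      using s1[of x1] xx x s by (intro add_mono mult_left_mono) auto
    finally show ?thesis by (simp add: mult_ac)
  qed
  define c where "c = real k * pi - pi / 6"
  have cbound: "pi / 2 + 2 * T * s \<le> c"
  proof -
    have "2 * T * s = 4 * s\<^sup>2 / w" unfolding T_def by (simp add: power2_eq_square)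
    also have "\<dots> \<le> real k * pi / 3" using n w unfolding s(2) by (simp add: field_simps)
    finally have "2 * T * s \<le> real k * pi / 3" .
    moreover have "1 * pi \<le> real k * pi" using k by (intro mult_right_mono) auto
    ultimately show ?thesis unfolding c_def by linarith
  qed
  have sinc: "(sin c)\<^sup>2 = 1 / 4"
    unfolding c_def by (simp only: sin_npi_sq) (simp add: sin_30 power_divide)
  have s3: "\<theta> x \<le> c" if "0 \<le> x" for x
  proof -
    have Ts: "0 \<le> 2 * T * s" using T s by simp
    consider "x \<le> x1" | "x1 \<le> x" "x \<le> x2" | "x2 \<le> x" by linarith
    then show ?thesis
    proof cases
      case 1
      then show ?thesis using s1[OF that] cbound Ts by linarith
    next
      case 2
      then show ?thesis using s2 cbound by force
    next
      case 3
      show ?thesis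
      proof (rule outer[OF _ 3])
        show "\<theta> x2 \<le> c" using s2[of x2] xx cbound by simp
      qed (use xx sinc in \<open>auto simp: x2_def\<close>)
    qed
  qed
  obtain x where x: "0 \<le> x" "real k * pi < angle \<alpha> e \<mu> x" using re unfolding reach_def by auto
  have "real k * pi < c" using eqv x s3[OF x(1)] by force
  then show False unfolding c_def by simp
qed

text \<open>Near its minimum on the half line, at \<open>sqrt (2 \<mu>)\<close> or at \<open>0\<close>, the potential dominates a quadratic
well whose strength grows with \<open>\<mu>\<close>, and far away it is quartic.\<close>

lemma pot_lower:
  assumes "0 \<le> x"
  shows "(x - sqrt (2 * max \<mu> 0))\<^sup>2 * ((x - sqrt (2 * max \<mu> 0))\<^sup>2 + \<bar>\<mu>\<bar>) / 8 \<le> pot \<mu> x"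
proof (cases "0 \<le> \<mu>")
  case True
  define y where "y = sqrt (2 * \<mu>)"
  have y: "0 \<le> y" "y\<^sup>2 = 2 * \<mu>" using True unfolding y_def by auto
  define t where "t = x - y"
  have "x\<^sup>2 / 2 - \<mu> = t * (x + y) / 2" unfolding t_def using y(2) by (simp add: power2_eq_square algebra_simps)
  then have p: "pot \<mu> x = t\<^sup>2 * ((x + y)\<^sup>2 / 4)" by (simp only: pot_def) (simp add: power_mult_distrib power_divide)
  have "t\<^sup>2 \<le> (x + y)\<^sup>2"
    unfolding t_def using mult_nonneg_nonneg[OF assms y(1)] by (simp add: power2_eq_square algebra_simps)
  moreover have "2 * \<mu> \<le> (x + y)\<^sup>2" using y assms power_mono[of y "x + y" 2] by simp
  ultimately have "(t\<^sup>2 + \<bar>\<mu>\<bar>) / 8 \<le> (x + y)\<^sup>2 / 4" using True by simp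
  then have "t\<^sup>2 * ((t\<^sup>2 + \<bar>\<mu>\<bar>) / 8) \<le> t\<^sup>2 * ((x + y)\<^sup>2 / 4)" by (rule mult_left_mono) simp
  then show ?thesis unfolding p using True by (simp add: t_def y_def max_def)
next
  case False
  have "pot \<mu> x = x\<^sup>2 * (x\<^sup>2 / 4 + \<bar>\<mu>\<bar>) + \<mu>\<^sup>2" unfolding pot_def using False by (simp add: power2_eq_square field_simps)
  moreover have "x\<^sup>2 * ((x\<^sup>2 + \<bar>\<mu>\<bar>) / 8) \<le> x\<^sup>2 * (x\<^sup>2 / 4 + \<bar>\<mu>\<bar>)" by (rule mult_left_mono) auto
  moreover have "0 \<le> \<mu>\<^sup>2" by simp
  ultimately have "x\<^sup>2 * ((x\<^sup>2 + \<bar>\<mu>\<bar>) / 8) \<le> pot \<mu> x" by linarith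
  then show ?thesis using False by simp
qed

lemma level_lower_bound:
  assumes a: "\<alpha> = 0 \<or> \<alpha> = pi / 2" and k: "1 \<le> k"
  shows "real k * sqrt (1 + \<bar>\<mu>\<bar>) / 20 \<le> level \<alpha> k \<mu>"
proof (rule dense_ge)
  fix e assume "level \<alpha> k \<mu> < e"
  moreover have "0 \<le> \<alpha>" "\<alpha> \<le> pi / 2" using a pi_gt_zero by linarith+
  ultimately have re: "(e, \<mu>) \<in> reach \<alpha> k" using reach_iff k by blast
  define z where "z = sqrt (1 + \<bar>\<mu>\<bar>)"
  have z: "1 \<le> z" "z\<^sup>2 = 1 + \<bar>\<mu>\<bar>" unfolding z_def by auto
  define x0 where "x0 = sqrt (2 * max \<mu> 0)"
  \<comment> \<open>From \<open>t\<^sup>2 \<ge> t / 2 - 1 / 16\<close> the potential dominates the well with \<open>w = z / 4\<close> and \<open>d = 1 / 128\<close>.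
    The small loss \<open>d\<close> is absorbed because \<open>k z \<ge> 1\<close>.\<close>
  have "pi * real k * (z / 4) / 12 \<le> e + 1 / 128"
  proof (rule reach_lower_bound[OF a k re, of _ _ x0])
    show "0 < z / 4" using z by simp
    show "0 \<le> x0" unfolding x0_def by simp
    fix x :: real assume x: "0 \<le> x"
    define t where "t = (x - x0)\<^sup>2"
    have t: "0 \<le> t" unfolding t_def by simp
    have "t * (t + \<bar>\<mu>\<bar>) / 8 \<le> pot \<mu> x" using pot_lower[OF x, of \<mu>] unfolding t_def x0_def .
    moreover have "t / 2 - 1 / 16 \<le> t * t" using zero_le_power2[of "t - 1 / 4"] by (simp add: power2_eq_square algebra_simps)
    moreover have "\<bar>\<mu>\<bar> * t / 2 \<le> \<bar>\<mu>\<bar> * t" using t by simp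
    ultimately have "((1 + \<bar>\<mu>\<bar>) * t / 2 - 1 / 16) / 8 \<le> pot \<mu> x" by (simp add: algebra_simps)
    then show "(z / 4)\<^sup>2 * (x - x0)\<^sup>2 - 1 / 128 \<le> pot \<mu> x"
      unfolding power_divide z(2) t_def[symmetric] by (simp add: algebra_simps)
  qed auto
  then have "pi * (real k * z) / 48 \<le> e + 1 / 128" by (simp add: mult_ac)
  moreover have "3 * (real k * z) \<le> pi * (real k * z)"
    using pi_gt3 z by (intro mult_right_mono) auto
  moreover have "1 * 1 \<le> real k * z" using k z by (intro mult_mono) auto
  ultimately have "real k * z / 20 \<le> e" by linarith
  then show "real k * sqrt (1 + \<bar>\<mu>\<bar>) / 20 \<le> e" unfolding z_def .
qed

lemma energy_lower_bound: "real (Suc m) * sqrt (1 + \<bar>\<mu>\<bar>) / 40 \<le> energy m \<mu>"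
proof -
  have "Suc m \<le> 2 * Suc (m div 2)" by presburger
  then have "real (Suc m) \<le> real (2 * Suc (m div 2))" by (rule of_nat_mono)
  then have "real (Suc m) / 2 \<le> real (Suc (m div 2))" by simp
  then have "real (Suc m) / 2 * sqrt (1 + \<bar>\<mu>\<bar>) \<le> real (Suc (m div 2)) * sqrt (1 + \<bar>\<mu>\<bar>)"
    by (rule mult_right_mono) simp
  then have "real (Suc m) * sqrt (1 + \<bar>\<mu>\<bar>) / 40 \<le> real (Suc (m div 2)) * sqrt (1 + \<bar>\<mu>\<bar>) / 20" by simp
  also have "\<dots> \<le> energy m \<mu>"
    using level_lower_bound[of "pi / 2" "Suc (m div 2)" \<mu>] level_lower_bound[of 0 "Suc (m div 2)" \<mu>]
    unfolding energy_def by simp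
  finally show ?thesis .
qed

text \<open>On an interval of half length \<open>\<mu> powr (- 1/4)\<close> around the well at \<open>sqrt (2 \<mu>)\<close> the potential is at
most \<open>9/2 * sqrt \<mu>\<close>, so at energy \<open>15 sqrt \<mu>\<close> the rescaled angle gains at least \<open>6\<close> there.\<close>

lemma energy_upper_bound:
  assumes \<mu>: "1 \<le> \<mu>" shows "energy 0 \<mu> \<le> 15 * sqrt \<mu>"
proof -
  define r where "r = sqrt \<mu>"
  have r: "1 \<le> r" "r\<^sup>2 = \<mu>" using \<mu> unfolding r_def by auto
  define e where "e = 15 * r"
  define x0 where "x0 = sqrt (2 * \<mu>)"
  have x0: "1 \<le> x0" "x0\<^sup>2 = 2 * \<mu>" using \<mu> unfolding x0_def by auto
  define l where "l = 1 / sqrt r"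
  have l: "0 < l" "l \<le> 1" "l\<^sup>2 = 1 / r" using r unfolding l_def by (auto simp: power_divide)
  define s where "s = sqrt (21 / 2 * r)"
  have s: "0 < s" "s\<^sup>2 = 21 / 2 * r" using r unfolding s_def by auto
  have a: "pi / 2 = 0 \<or> pi / 2 = pi / 2" by simp
  obtain \<theta> where ia: "is_angle \<theta> (\<lambda>x. s * sol (pi / 2) e \<mu> x) (dsol (pi / 2) e \<mu>)"
    and close: "\<And>x. \<bar>\<theta> x - angle (pi / 2) e \<mu> x\<bar> < pi / 2"
    and eqv: "\<And>x k. real k * pi < angle (pi / 2) e \<mu> x \<longleftrightarrow> real k * pi < \<theta> x"
    using scaled_angle[OF a s(1), of e \<mu>] by blast
  note D = scaled_angle_deriv[OF ia s(1)]
  have "\<theta> (x0 - l) - s * (x0 - l) \<le> \<theta> (x0 + l) - s * (x0 + l)"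
  proof (rule DERIV_nonneg_imp_nondecreasing[of _ _ "\<lambda>x. \<theta> x - s * x"])
    fix x assume x: "x0 - l \<le> x" "x \<le> x0 + l"
    have p: "pot \<mu> x = (x - x0)\<^sup>2 * ((x + x0)\<^sup>2 / 4)"
    proof -
      have "x\<^sup>2 / 2 - \<mu> = (x - x0) * (x + x0) / 2" using x0(2) by (simp add: power2_eq_square algebra_simps)
      then show ?thesis by (simp only: pot_def) (simp add: power_mult_distrib power_divide)
    qed
    have "(x - x0)\<^sup>2 \<le> l\<^sup>2" using x by (intro abs_le_square_iff[THEN iffD1]) auto
    moreover have "(x + x0)\<^sup>2 \<le> (3 * x0)\<^sup>2" using x l x0 by (intro power_mono) auto
    ultimately have "pot \<mu> x \<le> l\<^sup>2 * ((3 * x0)\<^sup>2 / 4)" unfolding p by (intro mult_mono) auto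
    also have "\<dots> = 9 / 2 * r" unfolding l(3) power_mult_distrib x0(2) r(2)[symmetric] using r(1)
      by (simp add: power2_eq_square)
    finally have "s\<^sup>2 \<le> e - pot \<mu> x" unfolding s(2) e_def by simp
    then have "s \<le> (e - pot \<mu> x) / s" using s(1) by (simp add: field_simps power2_eq_square)
    then have "s * (sin (\<theta> x))\<^sup>2 \<le> (e - pot \<mu> x) / s * (sin (\<theta> x))\<^sup>2" by (rule mult_right_mono) simp
    then have "0 \<le> s * (cos (\<theta> x))\<^sup>2 + (e - pot \<mu> x) / s * (sin (\<theta> x))\<^sup>2 - s"
      by (simp add: cos_squared_eq algebra_simps)
    moreover have "((\<lambda>x. \<theta> x - s * x) has_real_derivative s * (cos (\<theta> x))\<^sup>2 + (e - pot \<mu> x) / s * (sin (\<theta> x))\<^sup>2 - s) (at x)"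
      by (auto intro!: derivative_eq_intros D)
    ultimately show "\<exists>y. ((\<lambda>x. \<theta> x - s * x) has_real_derivative y) (at x) \<and> 0 \<le> y" by blast
  qed (use l in simp)
  then have gain: "\<theta> (x0 - l) + 2 * (l * s) \<le> \<theta> (x0 + l)" by (simp add: algebra_simps)
  \<comment> \<open>The gain \<open>2 l s \<ge> 6\<close> suffices to get from \<open>- \<pi> / 2\<close> beyond \<open>\<pi>\<close>.\<close>
  have "3 \<le> l * s"
  proof (rule power2_le_imp_le)
    show "3\<^sup>2 \<le> (l * s)\<^sup>2" unfolding power_mult_distrib l(3) s(2) using r(1) by simp
  qed (use l s in simp)
  moreover have "- (pi / 2) \<le> \<theta> (x0 - l)"
  proof -
    have "real 0 * pi \<le> angle (pi / 2) e \<mu> (x0 - l)"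
      by (rule angle_no_return[of 0 _ _ _ 0]) (use x0 l in auto)
    then have "0 \<le> angle (pi / 2) e \<mu> (x0 - l)" by simp
    then show ?thesis using close[of "x0 - l"] by linarith
  qed
  ultimately have "real 1 * pi < \<theta> (x0 + l)" using gain pi_less_4 by simp
  then have "(e, \<mu>) \<in> reach (pi / 2) 1" unfolding reach_def eqv[symmetric] using x0 l by (auto intro!: exI[of _ "x0 + l"])
  then have "level (pi / 2) 1 \<mu> < e" by (subst (asm) reach_iff) auto
  then show ?thesis unfolding energy_def e_def r_def by simp
qed

section \<open>Convergence of the sum over the eigenvalues\<close>

lemma energy_pos: "0 < energy m \<mu>"
proof -
  have "0 < real (Suc m) * sqrt (1 + \<bar>\<mu>\<bar>) / 40" by simp
  then show ?thesis using energy_lower_bound[of m \<mu>] by linarith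
qed

lemma nn_integral_powr_tail:
  assumes p: "1 < p"
  shows "(\<integral>\<^sup>+x. ennreal ((1 + \<bar>x\<bar>) powr (- p)) \<partial>lborel) < \<infinity>"
proof -
  let ?g = "\<lambda>x::real. ennreal ((1 + \<bar>x\<bar>) powr (- p)) * indicator {0..} x"
  have gm: "?g \<in> borel_measurable borel" by measurable
  have lim: "((\<lambda>x::real. (1 + x) powr (1 - p) / (1 - p)) \<longlongrightarrow> 0 / (1 - p)) at_top"
    using p by (intro tendsto_divide tendsto_const tendsto_neg_powr filterlim_tendsto_add_at_top[OF tendsto_const] filterlim_ident) auto
  have "(\<integral>\<^sup>+x. ennreal ((1 + x) powr (- p)) * indicator {0..} x \<partial>lborel) = ennreal (0 / (1 - p) - (1 + 0) powr (1 - p) / (1 - p))"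
  proof (rule nn_integral_FTC_atLeast[OF _ _ _ lim])
    fix x :: real assume x: "0 \<le> x"
    have "((\<lambda>x. 1 + x) has_real_derivative 1) (at x)" by (auto intro!: derivative_eq_intros)
    from DERIV_chain2[OF has_real_derivative_powr[of "1 + x" "1 - p"] this]
    have "((\<lambda>x. (1 + x) powr (1 - p)) has_real_derivative (1 - p) * (1 + x) powr (1 - p - 1) * 1) (at x)"
      using x by simp
    then have "((\<lambda>x. (1 + x) powr (1 - p) / (1 - p)) has_real_derivative (1 - p) * (1 + x) powr (1 - p - 1) * 1 / (1 - p)) (at x)"
      by (rule DERIV_cdivide)
    then show "((\<lambda>x. (1 + x) powr (1 - p) / (1 - p)) has_real_derivative (1 + x) powr (- p)) (at x)" using p by simp
  qed auto
  also have "(\<integral>\<^sup>+x. ennreal ((1 + x) powr (- p)) * indicator {0..} x \<partial>lborel) = (\<integral>\<^sup>+x. ?g x \<partial>lborel)"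
    by (intro nn_integral_cong) (auto split: split_indicator)
  finally have g: "(\<integral>\<^sup>+x. ?g x \<partial>lborel) < \<infinity>" by simp
  have "(\<integral>\<^sup>+x. ennreal ((1 + \<bar>x\<bar>) powr (- p)) \<partial>lborel) \<le> (\<integral>\<^sup>+x. ?g x + ?g (- x) \<partial>lborel)"
    by (intro nn_integral_mono) (auto split: split_indicator)
  also have "\<dots> = (\<integral>\<^sup>+x. ?g x \<partial>lborel) + (\<integral>\<^sup>+x. ?g (- x) \<partial>lborel)"
    by (intro nn_integral_add) measurable
  also have "\<dots> < \<infinity>" unfolding nn_reflect[OF gm] using g by simp
  finally show ?thesis .
qed

lemma energy_measurable [measurable]: "energy m \<in> borel_measurable borel" by (rule borel_energy)

text \<open>By the lower bound the terms are at most a constant times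
\<open>(m + 1) powr (- \<gamma>) * (1 + \<bar>\<mu>\<bar>) powr (- \<gamma> / 2)\<close>; the integral over \<open>\<mu>\<close> is what needs \<open>\<gamma> > 2\<close>.\<close>

lemma energy_sum_finite:
  assumes \<gamma>: "2 < \<gamma>"
  shows "(\<Sum>m. \<integral>\<^sup>+ \<mu>. ennreal (1 / energy m \<mu> powr \<gamma>) \<partial>lborel) < \<infinity>"
proof -
  define I where "I = (\<integral>\<^sup>+x. ennreal ((1 + \<bar>x\<bar>) powr (- (\<gamma> / 2))) \<partial>lborel)"
  have I: "I < \<infinity>" unfolding I_def using \<gamma> by (intro nn_integral_powr_tail) simp
  define a where "a m = 40 powr \<gamma> * real (Suc m) powr (- \<gamma>)" for m
  have a0: "0 \<le> a m" for m unfolding a_def by simp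
  have sa: "summable a"
  proof -
    have "summable (\<lambda>n. real n powr (- \<gamma>))" using \<gamma> by (subst summable_real_powr_iff) simp
    then have "summable (\<lambda>n. real (Suc n) powr (- \<gamma>))" by (subst summable_Suc_iff)
    then show ?thesis unfolding a_def by (rule summable_mult)
  qed
  have pw: "1 / energy m \<mu> powr \<gamma> \<le> a m * (1 + \<bar>\<mu>\<bar>) powr (- (\<gamma> / 2))" for m \<mu>
  proof -
    let ?b = "real (Suc m) * sqrt (1 + \<bar>\<mu>\<bar>) / 40"
    have b: "0 < ?b" by simp
    have "1 / energy m \<mu> powr \<gamma> = energy m \<mu> powr (- \<gamma>)" by (simp add: powr_minus_divide)
    also have "\<dots> \<le> ?b powr (- \<gamma>)" using energy_lower_bound[of m \<mu>] b \<gamma> by (intro powr_mono2') auto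
    also have "\<dots> = a m * (1 + \<bar>\<mu>\<bar>) powr (- (\<gamma> / 2))"
      unfolding a_def by (simp add: powr_mult powr_divide powr_minus powr_powr powr_half_sqrt[symmetric] field_simps del: of_nat_Suc)
    finally show ?thesis .
  qed
  have "(\<Sum>m. \<integral>\<^sup>+ \<mu>. ennreal (1 / energy m \<mu> powr \<gamma>) \<partial>lborel) \<le> (\<Sum>m. ennreal (a m) * I)"
  proof (intro suminf_le allI)
    fix m
    have "(\<integral>\<^sup>+ \<mu>. ennreal (1 / energy m \<mu> powr \<gamma>) \<partial>lborel)
        \<le> (\<integral>\<^sup>+ \<mu>. ennreal (a m) * ennreal ((1 + \<bar>\<mu>\<bar>) powr (- (\<gamma> / 2))) \<partial>lborel)"
      using pw a0 by (intro nn_integral_mono) (auto simp: ennreal_mult[symmetric] intro!: ennreal_leI)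
    also have "\<dots> = ennreal (a m) * I" unfolding I_def by (intro nn_integral_cmult) measurable
    finally show "(\<integral>\<^sup>+ \<mu>. ennreal (1 / energy m \<mu> powr \<gamma>) \<partial>lborel) \<le> ennreal (a m) * I" .
  qed auto
  also have "\<dots> = (\<Sum>m. ennreal (a m)) * I" by (rule ennreal_suminf_multc)
  also have "\<dots> = ennreal (\<Sum>m. a m) * I" by (subst suminf_ennreal2[OF a0 sa]) (rule refl)
  also have "\<dots> < \<infinity>" using I by (simp add: ennreal_mult_less_top)
  finally show ?thesis .
qed

lemma nn_integral_inverse_tail: "(\<integral>\<^sup>+x. ennreal (1 / x) * indicator {1..} x \<partial>lborel) = \<infinity>"
proof (rule ccontr)
  assume "\<not> ?thesis"
  then obtain r where r: "0 \<le> r" "(\<integral>\<^sup>+x. ennreal (1 / x) * indicator {1..} x \<partial>lborel) = ennreal r"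
    by (cases "\<integral>\<^sup>+x. ennreal (1 / x) * indicator {1..} x \<partial>lborel") auto
  define b where "b = exp (r + 1)"
  have b: "1 \<le> b" "0 < b" unfolding b_def using r by auto
  have "ennreal (ln b - ln 1) = (\<integral>\<^sup>+x. ennreal (1 / x) * indicator {1..b} x \<partial>lborel)"
    by (rule nn_integral_FTC_Icc[symmetric]) (use b in \<open>auto intro!: derivative_eq_intros\<close>)
  also have "\<dots> \<le> (\<integral>\<^sup>+x. ennreal (1 / x) * indicator {1..} x \<partial>lborel)"
    by (intro nn_integral_mono) (auto split: split_indicator)
  also have "\<dots> = ennreal r" by (rule r)
  finally have "ln b \<le> r" using r(1) by (simp add: ennreal_le_iff)
  then show False unfolding b_def by simp
qed

text \<open>The lowest eigenvalue alone makes the sum diverge: its square is at most \<open>225 \<mu>\<close>, and the remaining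
factor \<open>energy powr (2 - \<gamma>)\<close> is bounded below because the eigenvalue is.\<close>

lemma energy_sum_infinite:
  assumes \<gamma>: "\<gamma> \<le> 2"
  shows "(\<Sum>m. \<integral>\<^sup>+ \<mu>. ennreal (1 / energy m \<mu> powr \<gamma>) \<partial>lborel) = \<infinity>"
proof -
  \<comment> \<open>\<open>1 / 40\<close> bounds the lowest eigenvalue from below, and \<open>225\<close> is the square of \<open>15\<close>.\<close>
  define c where "c = (1 / 40) powr (2 - \<gamma>) / 225"
  have c: "0 < c" unfolding c_def by simp
  have pw: "c * (1 / \<mu>) \<le> 1 / energy 0 \<mu> powr \<gamma>" if \<mu>: "1 \<le> \<mu>" for \<mu>
  proof -
    let ?E = "energy 0 \<mu>"
    have E: "0 < ?E" by (rule energy_pos)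
    have "1 / 40 \<le> sqrt (1 + \<bar>\<mu>\<bar>) / 40" by simp
    also have "\<dots> \<le> ?E" using energy_lower_bound[of 0 \<mu>] by simp
    finally have lo: "1 / 40 \<le> ?E" .
    have "?E\<^sup>2 \<le> (15 * sqrt \<mu>)\<^sup>2" using energy_upper_bound[OF \<mu>] E by (intro power_mono) auto
    then have up: "?E\<^sup>2 \<le> 225 * \<mu>" using \<mu> by (simp add: power_mult_distrib)
    have "c * (1 / \<mu>) = (1 / 40) powr (2 - \<gamma>) * (1 / (225 * \<mu>))" unfolding c_def by simp
    also have "\<dots> \<le> ?E powr (2 - \<gamma>) * (1 / ?E\<^sup>2)"
      using lo up E \<gamma> \<mu> by (intro mult_mono powr_mono2 divide_left_mono) auto
    also have "\<dots> = 1 / ?E powr \<gamma>"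
      using E by (simp add: powr_diff powr_numeral)
    finally show ?thesis .
  qed
  have "\<infinity> = ennreal c * (\<integral>\<^sup>+\<mu>. ennreal (1 / \<mu>) * indicator {1..} \<mu> \<partial>lborel)"
    unfolding nn_integral_inverse_tail using c by (simp add: ennreal_mult_top)
  also have "\<dots> = (\<integral>\<^sup>+\<mu>. ennreal c * (ennreal (1 / \<mu>) * indicator {1..} \<mu>) \<partial>lborel)"
    by (intro nn_integral_cmult[symmetric]) measurable
  also have "\<dots> \<le> (\<integral>\<^sup>+ \<mu>. ennreal (1 / energy 0 \<mu> powr \<gamma>) \<partial>lborel)"
  proof (intro nn_integral_mono)
    fix \<mu> :: real
    show "ennreal c * (ennreal (1 / \<mu>) * indicator {1..} \<mu>) \<le> ennreal (1 / energy 0 \<mu> powr \<gamma>)"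
    proof (cases "1 \<le> \<mu>")
      case True
      have "ennreal c * ennreal (1 / \<mu>) = ennreal (c * (1 / \<mu>))" using c True by (subst ennreal_mult) auto
      also have "\<dots> \<le> ennreal (1 / energy 0 \<mu> powr \<gamma>)" by (rule ennreal_leI[OF pw[OF True]])
      finally show ?thesis using True by simp
    qed simp
  qed
  also have "\<dots> \<le> (\<Sum>m. \<integral>\<^sup>+ \<mu>. ennreal (1 / energy m \<mu> powr \<gamma>) \<partial>lborel)"
    using sum_le_suminf[of "\<lambda>m. \<integral>\<^sup>+ \<mu>. ennreal (1 / energy m \<mu> powr \<gamma>) \<partial>lborel" "{0}"] by simp
  finally show ?thesis by (simp add: top_unique)
qed

section \<open>Change of variables\<close>

lemma nn_integral_exhaust:
  fixes h :: "real \<Rightarrow> ennreal"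
  assumes h: "h \<in> borel_measurable borel" and A: "\<And>n. A n \<in> sets borel" "incseq A"
  shows "(\<integral>\<^sup>+x. h x * indicator (\<Union>n. A n) x \<partial>lborel) = (SUP n. \<integral>\<^sup>+x. h x * indicator (A n) x \<partial>lborel)"
proof -
  have "emeasure (density lborel h) (\<Union>n. A n) = (SUP n. emeasure (density lborel h) (A n))"
    using A by (intro SUP_emeasure_incseq[symmetric]) auto
  moreover have "emeasure (density lborel h) B = (\<integral>\<^sup>+x. h x * indicator B x \<partial>lborel)" if "B \<in> sets borel" for B
    using h that by (intro emeasure_density) auto
  ultimately show ?thesis using A by simp
qed

text \<open>The substitution \<open>l = (r / E) powr (3/2)\<close> on compact subintervals that exhaust the half line.\<close>

lemma nn_integral_power_substitution:
  fixes h :: "real \<Rightarrow> ennreal"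
  assumes h: "h \<in> borel_measurable borel" and E: "0 < E"
  shows "(\<integral>\<^sup>+l. h l * indicator {0<..} l \<partial>lborel)
    = (\<integral>\<^sup>+r. h ((r / E) powr (3 / 2)) * ennreal (3 / 2 * (r / E) powr (1 / 2) / E) * indicator {0<..} r \<partial>lborel)"
proof -
  let ?g = "\<lambda>r. (r / E) powr (3 / 2)" and ?g' = "\<lambda>r. 3 / 2 * (r / E) powr (1 / 2) / E"
  \<comment> \<open>The shift by \<open>2\<close> keeps the intervals nondegenerate from \<open>n = 0\<close> on.\<close>
  define A where "A n = {1 / (real n + 2)..real n + 2}" for n
  define B where "B n = {?g (1 / (real n + 2))..?g (real n + 2)}" for n
  have Aab: "1 / (real n + 2) < real n + 2" for n
  proof -
    have "1 / (real n + 2) \<le> 1" by simp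
    then show ?thesis by linarith
  qed
  have Ainc: "incseq A" unfolding A_def incseq_def by (auto intro!: divide_left_mono intro: order_trans)
  have gmono: "?g x \<le> ?g y" if "0 \<le> x" "x \<le> y" for x y
    using that E by (intro powr_mono2 divide_right_mono) auto
  have Binc: "incseq B" unfolding B_def incseq_def
  proof (intro allI impI)
    fix m n :: nat assume "m \<le> n"
    then have "?g (1 / (real n + 2)) \<le> ?g (1 / (real m + 2))" "?g (real m + 2) \<le> ?g (real n + 2)"
      by (intro gmono divide_left_mono; simp)+
    then show "{?g (1 / (real m + 2))..?g (real m + 2)} \<subseteq> {?g (1 / (real n + 2))..?g (real n + 2)}" by auto
  qed
  have UA: "(\<Union>n. A n) = {0<..}"
  proof (intro equalityI subsetI)
    fix x assume "x \<in> (\<Union>n. A n)"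
    then show "x \<in> {0<..}" unfolding A_def by (auto intro: less_le_trans[rotated])
  next
    fix x :: real assume x: "x \<in> {0<..}"
    obtain n where n: "max x (1 / x) \<le> real n" using real_arch_simple by blast
    then have "1 / x \<le> real n + 2" "x \<le> real n + 2" by auto
    then have "x \<in> A n" unfolding A_def using x by (auto simp: field_simps)
    then show "x \<in> (\<Union>n. A n)" by blast
  qed
  have UB: "(\<Union>n. B n) = {0<..}"
  proof (intro equalityI subsetI)
    fix x assume "x \<in> (\<Union>n. B n)"
    then obtain n where "?g (1 / (real n + 2)) \<le> x" unfolding B_def by auto
    moreover have "0 < ?g (1 / (real n + 2))" using E by simp
    ultimately show "x \<in> {0<..}" unfolding greaterThan_iff by (rule less_le_trans[rotated])
  next
    fix x :: real assume x: "x \<in> {0<..}"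
    define r where "r = E * x powr (2 / 3)"
    have r: "0 < r" "?g r = x" using x E unfolding r_def by (auto simp: powr_powr)
    then have "r \<in> (\<Union>n. A n)" unfolding UA by simp
    then obtain n where "r \<in> A n" by blast
    then have rn: "1 / (real n + 2) \<le> r" "r \<le> real n + 2" unfolding A_def by auto
    then have "?g r \<in> B n"
      unfolding B_def atLeastAtMost_iff using r(1) by (intro conjI gmono) (assumption | simp)+
    then show "x \<in> (\<Union>n. B n)" using r by auto
  qed
  have sub: "(\<integral>\<^sup>+l. h l * indicator (B n) l \<partial>lborel) = (\<integral>\<^sup>+r. h (?g r) * ennreal (?g' r) * indicator (A n) r \<partial>lborel)" for n
    unfolding A_def B_def
  proof (rule nn_integral_substitution_aux[OF h _ _ _ _ Aab])
    fix x assume "x \<in> {1 / (real n + 2)..real n + 2}"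
    then have x: "0 < x" by (auto intro: less_le_trans[rotated])
    have "((\<lambda>r. r / E) has_real_derivative 1 / E) (at x)" by (rule DERIV_cdivide[OF DERIV_ident])
    moreover have "((\<lambda>y. y powr (3 / 2)) has_real_derivative 3 / 2 * (x / E) powr (3 / 2 - 1)) (at (x / E))"
      using x E by (intro has_real_derivative_powr) auto
    ultimately have "(?g has_real_derivative 3 / 2 * (x / E) powr (3 / 2 - 1) * (1 / E)) (at x)"
      by (rule DERIV_chain2[rotated])
    then show "(?g has_real_derivative ?g' x) (at x)" by simp
    show "0 \<le> ?g' x" using E by simp
  next
    show "continuous_on {1 / (real n + 2)..real n + 2} ?g'"
    proof -
      have "0 < x" if "1 / (real n + 2) \<le> x" for x
        using that by (rule less_le_trans[rotated]) simp
      then show ?thesis using E by (intro continuous_intros ballI) force+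
    qed
  qed simp
  have "(\<integral>\<^sup>+l. h l * indicator {0<..} l \<partial>lborel) = (SUP n. \<integral>\<^sup>+l. h l * indicator (B n) l \<partial>lborel)"
    unfolding UB[symmetric] by (rule nn_integral_exhaust[OF h _ Binc]) (simp add: B_def)
  also have "\<dots> = (SUP n. \<integral>\<^sup>+r. h (?g r) * ennreal (?g' r) * indicator (A n) r \<partial>lborel)"
    unfolding sub ..
  also have "\<dots> = (\<integral>\<^sup>+r. h (?g r) * ennreal (?g' r) * indicator {0<..} r \<partial>lborel)"
    unfolding UA[symmetric]
  proof (rule nn_integral_exhaust[OF _ _ Ainc, symmetric])
    note [measurable] = h
    show "(\<lambda>r. h (?g r) * ennreal (?g' r)) \<in> borel_measurable borel" by measurable
  qed (simp add: A_def)
  finally show ?thesis .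
qed

text \<open>The integral over \<open>l\<close> for a fixed value \<open>E\<close> of the eigenvalue; the factor \<open>\<bar>l\<bar> powr (4/3)\<close> comes from
the scaling of \<open>\<nu>\<close>.\<close>

lemma fibre_integral:
  fixes f :: "real \<Rightarrow> ennreal"
  assumes f[measurable]: "f \<in> borel_measurable borel" and E: "0 < E"
  shows "(\<integral>\<^sup>+l. ennreal (\<bar>l\<bar> powr (4 / 3)) * f (\<bar>l\<bar> powr (2 / 3) * E) * indicator (UNIV - {0}) l \<partial>lborel)
     = ennreal (3 / E powr (7 / 2)) * (\<integral>\<^sup>+r. ennreal (r powr (5 / 2)) * f r * indicator {0..} r \<partial>lborel)"
proof -
  define h where "h l = ennreal (\<bar>l\<bar> powr (4 / 3)) * f (\<bar>l\<bar> powr (2 / 3) * E)" for l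
  have hm[measurable]: "h \<in> borel_measurable borel" unfolding h_def[abs_def] by measurable
  let ?k = "\<lambda>l. h l * indicator {0<..} l"
  have km: "?k \<in> borel_measurable borel" by measurable
  have "(\<integral>\<^sup>+l. h l * indicator (UNIV - {0}) l \<partial>lborel) = (\<integral>\<^sup>+l. ?k l + ?k (- l) \<partial>lborel)"
  proof (intro nn_integral_cong)
    fix l :: real
    have "h (- l) = h l" unfolding h_def by simp
    then show "h l * indicator (UNIV - {0}) l = ?k l + ?k (- l)"
      by (cases l "0 :: real" rule: linorder_cases) auto
  qed
  also have "\<dots> = (\<integral>\<^sup>+l. ?k l \<partial>lborel) + (\<integral>\<^sup>+l. ?k (- l) \<partial>lborel)"
    by (intro nn_integral_add) measurable
  also have "\<dots> = 2 * (\<integral>\<^sup>+l. ?k l \<partial>lborel)" unfolding nn_reflect[OF km] by (simp add: mult_2)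
  also have "(\<integral>\<^sup>+l. ?k l \<partial>lborel)
     = (\<integral>\<^sup>+r. h ((r / E) powr (3 / 2)) * ennreal (3 / 2 * (r / E) powr (1 / 2) / E) * indicator {0<..} r \<partial>lborel)"
    by (rule nn_integral_power_substitution[OF hm E])
  also have "\<dots> = (\<integral>\<^sup>+r. ennreal (3 / 2 / E powr (7 / 2)) * (ennreal (r powr (5 / 2)) * f r * indicator {0..} r) \<partial>lborel)"
  proof (intro nn_integral_cong)
    fix r :: real
    consider "r < 0" | "r = 0" | "0 < r" by linarith
    then show "h ((r / E) powr (3 / 2)) * ennreal (3 / 2 * (r / E) powr (1 / 2) / E) * indicator {0<..} r
      = ennreal (3 / 2 / E powr (7 / 2)) * (ennreal (r powr (5 / 2)) * f r * indicator {0..} r)"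
    proof cases
      case 3
      let ?l = "(r / E) powr (3 / 2)"
      have l: "\<bar>?l\<bar> = ?l" by simp
      have l1: "\<bar>?l\<bar> powr (4 / 3) = (r / E) powr 2" "\<bar>?l\<bar> powr (2 / 3) * E = r"
        unfolding l powr_powr using 3 E by (simp_all add: powr_one)
      have real: "(r / E) powr 2 * (3 / 2 * (r / E) powr (1 / 2) / E) = 3 / 2 / E powr (7 / 2) * r powr (5 / 2)"
      proof -
        have "(r / E) powr 2 * (r / E) powr (1 / 2) = (r / E) powr (5 / 2)" by (simp flip: powr_add)
        also have "\<dots> = r powr (5 / 2) / E powr (5 / 2)" using 3 E by (simp add: powr_divide)
        finally have "(r / E) powr 2 * (3 / 2 * (r / E) powr (1 / 2) / E) = 3 / 2 * r powr (5 / 2) / (E powr (5 / 2) * E)"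
          by (simp add: field_simps)
        also have "E powr (5 / 2) * E = E powr (7 / 2)"
          using E powr_add[of E "5 / 2" 1] by simp
        finally show ?thesis by (simp add: field_simps)
      qed
      have "h ?l * ennreal (3 / 2 * (r / E) powr (1 / 2) / E)
          = ennreal ((r / E) powr 2 * (3 / 2 * (r / E) powr (1 / 2) / E)) * f r"
        unfolding h_def l1 using E by (subst ennreal_mult) (auto simp: mult_ac)
      also have "\<dots> = ennreal (3 / 2 / E powr (7 / 2)) * (ennreal (r powr (5 / 2)) * f r)"
        unfolding real using E by (subst ennreal_mult) (auto simp: mult_ac)
      finally show ?thesis using 3 by simp
    qed auto
  qed
  also have "\<dots> = ennreal (3 / 2 / E powr (7 / 2)) * (\<integral>\<^sup>+r. ennreal (r powr (5 / 2)) * f r * indicator {0..} r \<partial>lborel)"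
    by (intro nn_integral_cmult) measurable
  also have "2 * (ennreal (3 / 2 / E powr (7 / 2)) * (\<integral>\<^sup>+r. ennreal (r powr (5 / 2)) * f r * indicator {0..} r \<partial>lborel))
     = ennreal (3 / E powr (7 / 2)) * (\<integral>\<^sup>+r. ennreal (r powr (5 / 2)) * f r * indicator {0..} r \<partial>lborel)"
  proof -
    have "2 * ennreal (3 / 2 / E powr (7 / 2)) = ennreal (2 * (3 / 2 / E powr (7 / 2)))"
      by (subst ennreal_mult) auto
    then show ?thesis by (simp add: mult.assoc[symmetric])
  qed
  finally show ?thesis unfolding h_def .
qed

definition slice :: "nat \<Rightarrow> real \<times> real \<Rightarrow> real" where
  "slice m = (\<lambda>(\<nu>, l). scaled_eigval m \<nu> l)"

lemma slice_measurable [measurable]: "slice m \<in> borel_measurable borel"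
proof -
  have "(\<lambda>p::real \<times> real. \<bar>snd p\<bar> powr (2 / 3) * energy m (fst p / \<bar>snd p\<bar> powr (4 / 3))) \<in> borel_measurable borel"
    unfolding borel_prod[symmetric] by measurable
  then show ?thesis unfolding slice_def scaled_eigval_def eigval_eq case_prod_unfold .
qed

lemma punctured_plane_borel [measurable]: "UNIV \<times> (UNIV - {0::real}) \<in> sets (borel :: (real \<times> real) measure)"
  by (intro borel_open open_Times) auto

text \<open>Scale \<open>\<nu>\<close> for fixed \<open>l\<close>, exchange the integrals, and substitute in \<open>l\<close> for fixed \<open>\<mu>\<close>.\<close>

lemma slice_integral:
  fixes f :: "real \<Rightarrow> ennreal"
  assumes f[measurable]: "f \<in> borel_measurable borel"
  shows "(\<integral>\<^sup>+p. f (slice m p) * indicator (UNIV \<times> (UNIV - {0})) p \<partial>lborel)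
     = (\<integral>\<^sup>+\<mu>. ennreal (3 / energy m \<mu> powr (7 / 2)) \<partial>lborel) * (\<integral>\<^sup>+r. ennreal (r powr (5 / 2)) * f r * indicator {0..} r \<partial>lborel)"
proof -
  let ?J = "\<integral>\<^sup>+r. ennreal (r powr (5 / 2)) * f r * indicator {0..} r \<partial>lborel"
  let ?e = "\<lambda>\<nu> l. \<bar>l\<bar> powr (2 / 3) * energy m (\<nu> / \<bar>l\<bar> powr (4 / 3))"
  have sl: "slice m (\<nu>, l) = ?e \<nu> l" for \<nu> l unfolding slice_def scaled_eigval_def eigval_eq by simp
  have lb: "(lborel :: (real \<times> real) measure) = lborel \<Otimes>\<^sub>M lborel" by (rule lborel_prod[symmetric])
  have "(\<integral>\<^sup>+p. f (slice m p) * indicator (UNIV \<times> (UNIV - {0})) p \<partial>lborel)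
     = (\<integral>\<^sup>+l. \<integral>\<^sup>+\<nu>. f (slice m (\<nu>, l)) * indicator (UNIV \<times> (UNIV - {0})) (\<nu>, l) \<partial>lborel \<partial>lborel)"
    unfolding lb by (rule lborel_pair.nn_integral_snd[symmetric]) (simp add: lborel_prod)
  also have "\<dots> = (\<integral>\<^sup>+l. \<integral>\<^sup>+\<mu>. ennreal (\<bar>l\<bar> powr (4 / 3)) * f (\<bar>l\<bar> powr (2 / 3) * energy m \<mu>) * indicator (UNIV - {0}) l \<partial>lborel \<partial>lborel)"
  proof (rule nn_integral_cong)
    fix l :: real
    show "(\<integral>\<^sup>+\<nu>. f (slice m (\<nu>, l)) * indicator (UNIV \<times> (UNIV - {0})) (\<nu>, l) \<partial>lborel)
       = (\<integral>\<^sup>+\<mu>. ennreal (\<bar>l\<bar> powr (4 / 3)) * f (\<bar>l\<bar> powr (2 / 3) * energy m \<mu>) * indicator (UNIV - {0}) l \<partial>lborel)"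
    proof (cases "l = 0")
      case False
      let ?c = "\<bar>l\<bar> powr (4 / 3)"
      have c: "?c \<noteq> 0" "0 < ?c" using False by auto
      have "(\<integral>\<^sup>+\<nu>. f (?e \<nu> l) \<partial>lborel) = ennreal \<bar>?c\<bar> * (\<integral>\<^sup>+\<mu>. f (?e (0 + ?c * \<mu>) l) \<partial>lborel)"
        by (rule nn_integral_real_affine[OF _ c(1)]) measurable
      also have "(\<integral>\<^sup>+\<mu>. f (?e (0 + ?c * \<mu>) l) \<partial>lborel) = (\<integral>\<^sup>+\<mu>. f (\<bar>l\<bar> powr (2 / 3) * energy m \<mu>) \<partial>lborel)"
        using c by simp
      also have "ennreal \<bar>?c\<bar> * \<dots> = (\<integral>\<^sup>+\<mu>. ennreal ?c * f (\<bar>l\<bar> powr (2 / 3) * energy m \<mu>) \<partial>lborel)"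
        by (subst nn_integral_cmult) auto
      finally show ?thesis using False unfolding sl by simp
    qed simp
  qed
  also have "\<dots> = (\<integral>\<^sup>+\<mu>. \<integral>\<^sup>+l. ennreal (\<bar>l\<bar> powr (4 / 3)) * f (\<bar>l\<bar> powr (2 / 3) * energy m \<mu>) * indicator (UNIV - {0}) l \<partial>lborel \<partial>lborel)"
    by (rule lborel_pair.Fubini') measurable
  also have "\<dots> = (\<integral>\<^sup>+\<mu>. ennreal (3 / energy m \<mu> powr (7 / 2)) * ?J \<partial>lborel)"
    by (intro nn_integral_cong fibre_integral[OF f energy_pos])
  also have "\<dots> = (\<integral>\<^sup>+\<mu>. ennreal (3 / energy m \<mu> powr (7 / 2)) \<partial>lborel) * ?J"
    by (intro nn_integral_multc) measurable
  finally show ?thesis .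
qed

text \<open>The integral formula for the indicator of the set shows this off the line \<open>l = 0\<close>, which is itself a
null set.\<close>

lemma slice_null:
  assumes N: "N \<in> null_sets lborel" shows "slice m -` N \<in> null_sets lborel"
proof -
  have Nb[measurable]: "N \<in> sets borel" using N by auto
  have ms: "slice m -` N \<in> sets borel" using measurable_sets[OF slice_measurable Nb, of m] by simp
  have "AE r in lborel. r \<notin> N" using N by (rule AE_not_in)
  then have "(\<integral>\<^sup>+r. ennreal (r powr (5 / 2)) * indicator N r * indicator {0..} r \<partial>lborel) = (\<integral>\<^sup>+r. 0 \<partial>(lborel :: real measure))"
    by (intro nn_integral_cong_AE) (auto elim!: eventually_mono)
  then have "(\<integral>\<^sup>+p. indicator N (slice m p) * indicator (UNIV \<times> (UNIV - {0})) p \<partial>lborel) = 0"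
    using slice_integral[of "indicator N" m] by simp
  also have "(\<lambda>p. indicator N (slice m p) * indicator (UNIV \<times> (UNIV - {0})) p :: ennreal)
     = indicator (slice m -` N \<inter> UNIV \<times> (UNIV - {0}))"
    by (auto simp: fun_eq_iff split: split_indicator)
  finally have "slice m -` N \<inter> UNIV \<times> (UNIV - {0}) \<in> null_sets lborel"
    using ms by (auto simp: null_sets_def)
  moreover have "UNIV \<times> {0} \<in> null_sets (lborel :: (real \<times> real) measure)"
  proof -
    have "emeasure (lborel \<Otimes>\<^sub>M lborel) ((UNIV :: real set) \<times> {0::real}) = emeasure lborel (UNIV :: real set) * emeasure lborel {0::real}"
      by (rule lborel.emeasure_pair_measure_Times) auto
    moreover have "UNIV \<times> {0::real} \<in> sets (borel :: (real \<times> real) measure)"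
      by (intro borel_closed closed_Times) auto
    ultimately show ?thesis by (simp add: lborel_prod null_sets_def)
  qed
  ultimately have "slice m -` N \<inter> UNIV \<times> (UNIV - {0}) \<union> UNIV \<times> {0} \<in> null_sets lborel" by (rule null_sets.Un)
  then show ?thesis by (rule null_sets_subset) (use ms in auto)
qed

lemma slice_lebesgue: "slice m \<in> lebesgue \<rightarrow>\<^sub>M lebesgue"
proof (rule completion.measurable_completion2)
  show m: "slice m \<in> lebesgue \<rightarrow>\<^sub>M lborel" by (intro measurable_completion) simp
  show "null_sets lborel \<subseteq> null_sets (distr lebesgue lborel (slice m))"
  proof
    fix N :: "real set" assume N: "N \<in> null_sets lborel"
    have "slice m -` N \<in> null_sets lebesgue" by (rule null_sets_completionI[OF slice_null[OF N]])
    then show "N \<in> null_sets (distr lebesgue lborel (slice m))"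
      using null_setsD2[OF N] by (simp add: null_sets_distr_iff[OF m])
  qed
qed

abbreviation half_plane :: "(real \<times> real) measure" where
  "half_plane \<equiv> lebesgue_on (UNIV \<times> (UNIV - {0}))"

lemma slice_half_line: "slice m \<in> half_plane \<rightarrow>\<^sub>M lebesgue_on {0..}"
proof (rule measurable_restrict_space2)
  show "slice m \<in> space half_plane \<rightarrow> {0..}"
    using energy_pos[of m] by (auto simp: slice_def scaled_eigval_def eigval_eq less_imp_le intro!: mult_nonneg_nonneg)
  show "slice m \<in> half_plane \<rightarrow>\<^sub>M lebesgue" using slice_lebesgue by (rule measurable_restrict_space1)
qed

lemma symb_slice: "symb ((n, m), p) = slice m p"
  unfolding symb_def slice_def by (cases p) simp

text \<open>The index set is countable, so measurability may be checked on each slice, where the half plane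
carries the completed measure.\<close>

lemma symb_compose_measurable:
  assumes "F \<in> lebesgue_on {0..} \<rightarrow>\<^sub>M K"
  shows "(\<lambda>x. F (symb x)) \<in> dual_measure \<rightarrow>\<^sub>M K"
  unfolding dual_measure_def
proof (rule measurable_pair_measure_countable1)
  fix nm :: "nat \<times> nat"
  show "(\<lambda>p. F (symb (nm, p))) \<in> half_plane \<rightarrow>\<^sub>M K"
    using measurable_compose[OF slice_half_line assms] by (cases nm) (simp add: symb_slice)
qed auto

section \<open>Integration over the dual space\<close>

lemma kronecker_measurable: "(\<lambda>x. ennreal (kronecker x)) \<in> borel_measurable dual_measure"
  unfolding dual_measure_def
proof (rule measurable_pair_measure_countable1)
  fix nm :: "nat \<times> nat"
  show "(\<lambda>p. ennreal (kronecker (nm, p))) \<in> borel_measurable half_plane"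
    by (cases nm) (simp add: kronecker_def case_prod_unfold)
qed auto

lemma sigma_finite_lebesgue: "sigma_finite_measure (lebesgue :: 'a::euclidean_space measure)"
proof -
  obtain A :: "'a set set" where A: "countable A" "A \<subseteq> sets lborel" "\<Union>A = space lborel" "\<forall>a\<in>A. emeasure lborel a \<noteq> \<infinity>"
    using lborel.sigma_finite_countable by blast
  then have "\<forall>a\<in>A. emeasure lebesgue a \<noteq> \<infinity>" by (auto dest!: subsetD)
  moreover have "A \<subseteq> sets lebesgue" using A(2) by auto
  ultimately show ?thesis using A(1,3) by (intro sigma_finite_measure.intro exI[of _ A]) auto
qed

lemma nn_integral_dual:
  assumes G: "G \<in> borel_measurable dual_measure"
  shows "(\<integral>\<^sup>+x. G x \<partial>density dual_measure (\<lambda>x. ennreal (kronecker x))) = (\<Sum>m. \<integral>\<^sup>+p. G ((m, m), p) \<partial>half_plane)"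
proof -
  have sf: "sigma_finite_measure half_plane"
    by (intro sigma_finite_measure_restrict_space sigma_finite_lebesgue) auto
  let ?K = "\<lambda>x. ennreal (kronecker x) * G x"
  have Km: "?K \<in> borel_measurable (count_space UNIV \<Otimes>\<^sub>M half_plane)"
  proof -
    note [measurable] = kronecker_measurable G
    have "?K \<in> borel_measurable dual_measure" by measurable
    then show ?thesis unfolding dual_measure_def .
  qed
  have "(\<integral>\<^sup>+x. G x \<partial>density dual_measure (\<lambda>x. ennreal (kronecker x))) = (\<integral>\<^sup>+x. ?K x \<partial>dual_measure)"
    by (rule nn_integral_density[OF kronecker_measurable G])
  also have "\<dots> = (\<integral>\<^sup>+nm. \<integral>\<^sup>+p. ?K (nm, p) \<partial>half_plane \<partial>count_space UNIV)"
    unfolding dual_measure_def by (rule sigma_finite_measure.nn_integral_fst[OF sf Km, symmetric])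
  also have "\<dots> = (\<integral>\<^sup>+n. \<integral>\<^sup>+m. \<integral>\<^sup>+p. ?K ((n, m), p) \<partial>half_plane \<partial>count_space UNIV \<partial>count_space UNIV)"
    by (rule nn_integral_fst_count_space[symmetric])
  also have "\<dots> = (\<integral>\<^sup>+n. \<integral>\<^sup>+p. G ((n, n), p) \<partial>half_plane \<partial>count_space UNIV)"
  proof (rule nn_integral_cong)
    fix n :: nat
    have "(\<integral>\<^sup>+p. ?K ((n, m), p) \<partial>half_plane) = (if m = n then \<integral>\<^sup>+p. G ((n, n), p) \<partial>half_plane else 0)" for m
      by (auto simp: kronecker_def case_prod_unfold)
    then show "(\<integral>\<^sup>+m. \<integral>\<^sup>+p. ?K ((n, m), p) \<partial>half_plane \<partial>count_space UNIV) = (\<integral>\<^sup>+p. G ((n, n), p) \<partial>half_plane)"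
      using sums_unique[OF sums_single[of n "\<lambda>_. \<integral>\<^sup>+p. G ((n, n), p) \<partial>half_plane"]]
      by (simp add: nn_integral_count_space_nat)
  qed
  finally show ?thesis by (simp add: nn_integral_count_space_nat)
qed

definition spectral_const :: ennreal where
  "spectral_const = (\<Sum>m. \<integral>\<^sup>+\<mu>. ennreal (3 / energy m \<mu> powr (7 / 2)) \<partial>lborel)"

text \<open>The function may be replaced by a Borel function that agrees with it off a null set, since the
preimages of that null set under all slices are null sets.\<close>

lemma nn_integral_symb:
  assumes H: "H \<in> borel_measurable (lebesgue_on {0..})"
  shows "(\<integral>\<^sup>+x. H (symb x) \<partial>density dual_measure (\<lambda>x. ennreal (kronecker x)))
    = spectral_const * (\<integral>\<^sup>+r. H r \<partial>density (lebesgue_on {0..}) (\<lambda>r. ennreal (r powr (5 / 2))))"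
proof -
  let ?S = "UNIV \<times> (UNIV - {0}) :: (real \<times> real) set"
  have pm: "(\<lambda>r::real. ennreal (r powr (5 / 2))) \<in> borel_measurable (lebesgue_on {0..})"
    by (intro measurable_restrict_space1 borel_imp_lebesgue) measurable
  define H0 where "H0 r = H r * indicator {0..} r" for r
  have H0: "H0 \<in> borel_measurable lebesgue"
    using H unfolding H0_def[abs_def] by (subst (asm) borel_measurable_restrict_space_iff_ennreal) auto
  obtain H1 where H1: "H1 \<in> borel_measurable lborel" and ae: "AE r in lborel. H0 r = H1 r"
    using completion_ex_borel_measurable[OF H0] by blast
  have H1b[measurable]: "H1 \<in> borel_measurable borel" using H1 by simp
  have Q: "(\<integral>\<^sup>+r. H r \<partial>density (lebesgue_on {0..}) (\<lambda>r. ennreal (r powr (5 / 2))))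
     = (\<integral>\<^sup>+r. ennreal (r powr (5 / 2)) * H1 r * indicator {0..} r \<partial>lborel)"
  proof -
    have "(\<integral>\<^sup>+r. H r \<partial>density (lebesgue_on {0..}) (\<lambda>r. ennreal (r powr (5 / 2))))
       = (\<integral>\<^sup>+r. ennreal (r powr (5 / 2)) * H r * indicator {0..} r \<partial>lebesgue)"
      unfolding nn_integral_density[OF pm H] by (rule nn_integral_restrict_space) auto
    also have "\<dots> = (\<integral>\<^sup>+r. ennreal (r powr (5 / 2)) * H1 r * indicator {0..} r \<partial>lebesgue)"
      using AE_completion[OF ae] by (intro nn_integral_cong_AE) (auto elim!: eventually_mono simp: H0_def split: split_indicator)
    also have "\<dots> = (\<integral>\<^sup>+r. ennreal (r powr (5 / 2)) * H1 r * indicator {0..} r \<partial>lborel)"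
      by (rule nn_integral_completion)
    finally show ?thesis .
  qed
  obtain N where N: "N \<in> null_sets lborel" "\<And>r. r \<notin> N \<Longrightarrow> H0 r = H1 r"
    using ae unfolding eventually_ae_filter by auto
  have "(\<integral>\<^sup>+p. H (symb ((m, m), p)) \<partial>half_plane)
     = (\<integral>\<^sup>+\<mu>. ennreal (3 / energy m \<mu> powr (7 / 2)) \<partial>lborel) * (\<integral>\<^sup>+r. ennreal (r powr (5 / 2)) * H1 r * indicator {0..} r \<partial>lborel)" for m
  proof -
    have "AE p in lborel. p \<notin> slice m -` N" by (rule AE_not_in[OF slice_null[OF N(1)]])
    then have ae2: "AE p in lebesgue. H0 (slice m p) = H1 (slice m p)"
      using N(2) by (intro AE_completion) (auto elim!: eventually_mono)
    have "(\<integral>\<^sup>+p. H (symb ((m, m), p)) \<partial>half_plane) = (\<integral>\<^sup>+p. H (slice m p) * indicator ?S p \<partial>lebesgue)"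
      unfolding symb_slice by (rule nn_integral_restrict_space) auto
    also have "\<dots> = (\<integral>\<^sup>+p. H1 (slice m p) * indicator ?S p \<partial>lebesgue)"
    proof (rule nn_integral_cong_AE)
      show "AE p in lebesgue. H (slice m p) * indicator ?S p = H1 (slice m p) * indicator ?S p"
        using ae2
      proof eventually_elim
        case (elim p)
        have "0 \<le> slice m p"
          using energy_pos[of m] by (auto simp: slice_def scaled_eigval_def eigval_eq less_imp_le case_prod_unfold)
        then show ?case using elim by (simp add: H0_def)
      qed
    qed
    also have "\<dots> = (\<integral>\<^sup>+p. H1 (slice m p) * indicator ?S p \<partial>lborel)" by (rule nn_integral_completion)
    finally show ?thesis unfolding slice_integral[OF H1b] .
  qed
  then show ?thesis
    unfolding nn_integral_dual[OF symb_compose_measurable[OF H]] Q spectral_const_def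
    by (simp add: ennreal_suminf_multc)
qed

lemma spectral_const_finite: "spectral_const < \<infinity>"
proof -
  have "spectral_const = (\<Sum>m. ennreal 3 * (\<integral>\<^sup>+\<mu>. ennreal (1 / energy m \<mu> powr (7 / 2)) \<partial>lborel))"
    unfolding spectral_const_def
  proof (intro suminf_cong)
    fix m
    have "(\<integral>\<^sup>+\<mu>. ennreal (3 / energy m \<mu> powr (7 / 2)) \<partial>lborel) = (\<integral>\<^sup>+\<mu>. ennreal 3 * ennreal (1 / energy m \<mu> powr (7 / 2)) \<partial>lborel)"
      by (intro nn_integral_cong) (subst ennreal_mult[symmetric], auto)
    also have "\<dots> = ennreal 3 * (\<integral>\<^sup>+\<mu>. ennreal (1 / energy m \<mu> powr (7 / 2)) \<partial>lborel)"
      by (intro nn_integral_cmult) measurable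
    finally show "(\<integral>\<^sup>+\<mu>. ennreal (3 / energy m \<mu> powr (7 / 2)) \<partial>lborel)
      = ennreal 3 * (\<integral>\<^sup>+\<mu>. ennreal (1 / energy m \<mu> powr (7 / 2)) \<partial>lborel)" .
  qed
  also have "\<dots> = ennreal 3 * (\<Sum>m. \<integral>\<^sup>+\<mu>. ennreal (1 / energy m \<mu> powr (7 / 2)) \<partial>lborel)" by (rule ennreal_suminf_cmult)
  also have "\<dots> < \<infinity>" using energy_sum_finite[of "7 / 2"] by (simp add: ennreal_mult_less_top)
  finally show ?thesis .
qed

lemma spectral_const_nonzero: "spectral_const \<noteq> 0"
proof
  assume "spectral_const = 0"
  then have "(\<integral>\<^sup>+\<mu>. ennreal (3 / energy 0 \<mu> powr (7 / 2)) \<partial>lborel) = 0"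
    unfolding spectral_const_def
    using sum_le_suminf[of "\<lambda>m. \<integral>\<^sup>+\<mu>. ennreal (3 / energy m \<mu> powr (7 / 2)) \<partial>lborel" "{0}"] by simp
  then have "AE \<mu> in lborel. ennreal (3 / energy 0 \<mu> powr (7 / 2)) = 0"
    by (subst (asm) nn_integral_0_iff_AE) auto
  moreover have "ennreal (3 / energy 0 \<mu> powr (7 / 2)) \<noteq> 0" for \<mu> using energy_pos[of 0 \<mu>] by simp
  ultimately have "AE \<mu> in (lborel :: real measure). False" by simp
  then show False by (simp add: AE_iff_null null_sets_def emeasure_lborel_UNIV)
qed

lemma spectral_const_real: "enn2real spectral_const = (\<Sum>m. LINT \<mu>|lebesgue. 3 / eigval m \<mu> powr (7/2))"
proof -
  define c where "c m = (LINT \<mu>|lebesgue. 3 / eigval m \<mu> powr (7/2))" for m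
  let ?I = "\<lambda>m. \<integral>\<^sup>+\<mu>. ennreal (3 / energy m \<mu> powr (7 / 2)) \<partial>lborel"
  have fin: "?I m < \<infinity>" for m
    using le_less_trans[OF _ spectral_const_finite, of "?I m"] sum_le_suminf[of ?I "{m}"]
    unfolding spectral_const_def by simp
  have c: "c m = enn2real (?I m)" for m
  proof -
    have "c m = enn2real (\<integral>\<^sup>+\<mu>. ennreal (3 / energy m \<mu> powr (7 / 2)) \<partial>lebesgue)"
      unfolding c_def eigval_eq by (intro integral_eq_nn_integral borel_imp_lebesgue) auto
    then show ?thesis by (simp add: nn_integral_completion)
  qed
  have I: "?I m = ennreal (c m)" for m unfolding c using fin[of m] by simp
  have c0: "0 \<le> c m" for m unfolding c by simp
  have "(\<Sum>m. ennreal (c m)) \<noteq> top" using spectral_const_finite unfolding spectral_const_def I by simp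
  then have s: "summable c" by (rule summable_suminf_not_top[OF c0])
  have pc: "spectral_const = ennreal (\<Sum>m. c m)"
    unfolding spectral_const_def I by (rule suminf_ennreal2[OF c0 s])
  have "enn2real spectral_const = (\<Sum>m. c m)"
    unfolding pc by (rule enn2real_ennreal[OF suminf_nonneg[OF s c0]])
  then show ?thesis unfolding c_def .
qed

theorem theorem1p3:
  shows "(\<forall>F :: real \<Rightarrow> real. F \<in> borel_measurable (lebesgue_on {0..}) \<longrightarrow>
            (integrable (density dual_measure (\<lambda>x. ennreal (kronecker x))) (F \<circ> symb) \<longleftrightarrow>
             integrable (density (lebesgue_on {0..}) (\<lambda>r. ennreal (r powr (5/2)))) F) \<and>
            (integrable (density (lebesgue_on {0..}) (\<lambda>r. ennreal (r powr (5/2)))) F \<longrightarrow>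
             (LINT x|density dual_measure (\<lambda>x. ennreal (kronecker x)). F (symb x)) =
             (\<Sum>m. LINT \<mu>|lebesgue. 3 / eigval m \<mu> powr (7/2)) *
             (LINT r|lebesgue_on {0..}. r powr (5/2) * F r)))
       \<and> (\<forall>\<gamma> :: real.
            (\<Sum>m. \<integral>\<^sup>+ \<mu>. ennreal (1 / eigval m \<mu> powr \<gamma>) \<partial>lebesgue) < \<infinity> \<longleftrightarrow> \<gamma> > 2)"
proof (intro conjI allI impI)
  fix F :: "real \<Rightarrow> real"
  assume F: "F \<in> borel_measurable (lebesgue_on {0..})"
  let ?M = "density dual_measure (\<lambda>x. ennreal (kronecker x))"
  let ?Q = "density (lebesgue_on {0..}) (\<lambda>r. ennreal (r powr (5/2)))"
  have pm: "(\<lambda>r::real. r powr (5 / 2)) \<in> borel_measurable (lebesgue_on {0..})"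
    by (intro measurable_restrict_space1 borel_imp_lebesgue) measurable
  have FM: "(\<lambda>x. F (symb x)) \<in> borel_measurable ?M" using symb_compose_measurable[OF F] by simp
  have FQ: "F \<in> borel_measurable ?Q" using F by simp
  have nn: "(\<integral>\<^sup>+x. ennreal (g (F (symb x))) \<partial>?M) = spectral_const * (\<integral>\<^sup>+r. ennreal (g (F r)) \<partial>?Q)"
    if "g \<in> borel_measurable borel" for g :: "real \<Rightarrow> real"
    using nn_integral_symb[of "\<lambda>r. ennreal (g (F r))"] measurable_compose[OF F that] by simp
  show iff: "integrable ?M (F \<circ> symb) \<longleftrightarrow> integrable ?Q F"
    using nn[of abs] FM FQ spectral_const_finite spectral_const_nonzero
    unfolding integrable_iff_bounded comp_def real_norm_def
    by (auto simp: ennreal_mult_less_top)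
  assume iQ: "integrable ?Q F"
  then have iM: "integrable ?M (\<lambda>x. F (symb x))" using iff by (simp add: comp_def)
  have "(LINT x|?M. F (symb x)) = enn2real (\<integral>\<^sup>+x. ennreal (F (symb x)) \<partial>?M) - enn2real (\<integral>\<^sup>+x. ennreal (- F (symb x)) \<partial>?M)"
    by (rule real_lebesgue_integral_def[OF iM])
  also have "\<dots> = enn2real spectral_const * (enn2real (\<integral>\<^sup>+r. ennreal (F r) \<partial>?Q) - enn2real (\<integral>\<^sup>+r. ennreal (- F r) \<partial>?Q))"
    using nn[of "\<lambda>x. x"] nn[of "\<lambda>x. - x"] by (simp add: enn2real_mult right_diff_distrib)
  also have "enn2real (\<integral>\<^sup>+r. ennreal (F r) \<partial>?Q) - enn2real (\<integral>\<^sup>+r. ennreal (- F r) \<partial>?Q) = (LINT r|?Q. F r)"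
    by (rule real_lebesgue_integral_def[OF iQ, symmetric])
  also have "(LINT r|?Q. F r) = (LINT r|lebesgue_on {0..}. r powr (5/2) * F r)"
    using integral_density[OF F pm] by simp
  finally show "(LINT x|?M. F (symb x)) = (\<Sum>m. LINT \<mu>|lebesgue. 3 / eigval m \<mu> powr (7/2)) * (LINT r|lebesgue_on {0..}. r powr (5/2) * F r)"
    unfolding spectral_const_real .
next
  fix \<gamma> :: real
  show "(\<Sum>m. \<integral>\<^sup>+ \<mu>. ennreal (1 / eigval m \<mu> powr \<gamma>) \<partial>lebesgue) < \<infinity> \<longleftrightarrow> \<gamma> > 2"
    using energy_sum_finite[of \<gamma>] energy_sum_infinite[of \<gamma>]
    unfolding eigval_eq nn_integral_completion by (cases "2 < \<gamma>") auto
qed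

end
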